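(* Let $G=\mathrm{PSL}_2(\mathbb{F}_8)$ and $H\simeq(C_2)^3$ a Sylow $2$-subgroup. There is a flabby resolution $0\to J_{G/H}\to P\to F\to0$ with $\mathrm{rank}_{\mathbb{Z}}F=73$ such that there is an isomorphism of $G$-lattices $$\mathbb{Z}[G/S_3]\oplus\mathbb{Z}[G/C_9]\oplus\mathbb{Z}[G/((C_2)^3\rtimes C_7)]^{\oplus2}\simeq\mathbb{Z}[G/S_3]\oplus\mathbb{Z}\oplus F$$ (rank $158$). In particular $F$ is stably permutation.
   Context: A $G$-lattice is a finitely generated $\mathbb{Z}[G]$-module free over $\mathbb{Z}$. A permutation $G$-lattice is one isomorphic to $\bigoplus_i\mathbb{Z}[G/H_i]$; $\mathbb{Z}$ is the trivial lattice. Stably permutation: $M\oplus P\simeq P'$ with $P,P'$ permutation. $F$ is flabby if $\widehat H^{-1}(H',F)=0$ for all subgroups $H'\le G$. A flabby resolution of $M$ is an exact sequence $0\to M\to P\to F\to0$ with $P$ permutation and $F$ flabby. The Chevalley module is $J_{G/H}=\mathrm{Hom}_{\mathbb{Z}}(I_{G/H},\mathbb{Z})$ where $I_{G/H}=\ker(\mathbb{Z}[G/H]\to\mathbb{Z})$. In $\mathrm{PSL}_2(\mathbb{F}_8)$ the subgroups isomorphic to $S_3$, $C_9$ and $(C_2)^3\rtimes C_7$ (the normalizer of a Sylow 2-subgroup) are each unique up to conjugacy. *)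

theory Defs
  imports "HOL-Algebra.Algebra" "HOL-Algebra.Left_Coset" "HOL-Algebra.Group_Action" "HOL-Library.Product_Plus"
          "HOL-Library.Function_Algebras"
begin

type_synonym 'k mat2 = "'k \<times> 'k \<times> 'k \<times> 'k"   (* (a,b,c,d) = [[a,b],[c,d]] *)

definition mat2_mult :: "'k::field mat2 \<Rightarrow> 'k mat2 \<Rightarrow> 'k mat2" where
  "mat2_mult A B = (case A of (a,b,c,d) \<Rightarrow> case B of (e,f,g,h) \<Rightarrow>
      (a*e + b*g, a*f + b*h, c*e + d*g, c*f + d*h))"

definition SL2 :: "('k::field mat2) monoid" where
  "SL2 = \<lparr> carrier = {A. case A of (x11,x12,x21,x22) \<Rightarrow> x11*x22 - x12*x21 = 1}, monoid.mult = mat2_mult, one = (1,0,0,1) \<rparr>"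

definition SL2_center :: "('k::field mat2) set" where
  "SL2_center = {(s,0,0,s) | s. s*s = 1}"

definition PSL2 :: "('k::field mat2) set monoid" where
  "PSL2 = SL2 Mod SL2_center"

definition zsc :: "int \<Rightarrow> 'v::ab_group_add \<Rightarrow> 'v" where
  "zsc k x = (if 0 \<le> k then sum (\<lambda>_. x) {..<nat k} else - sum (\<lambda>_. x) {..<nat (-k)})"

definition zcomb :: "int list \<Rightarrow> 'v::ab_group_add list \<Rightarrow> 'v" where
  "zcomb cs bs = sum_list (map2 zsc cs bs)"

definition zspan :: "'v::ab_group_add set \<Rightarrow> 'v set" where
  "zspan S = {zcomb cs bs | cs bs. length cs = length bs \<and> set bs \<subseteq> S}"

definition zbasis :: "'v::ab_group_add set \<Rightarrow> 'v list \<Rightarrow> bool" where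
  "zbasis M bs \<longleftrightarrow> set bs \<subseteq> M
     \<and> (\<forall>cs. length cs = length bs \<longrightarrow> zcomb cs bs = 0 \<longrightarrow> (\<forall>c\<in>set cs. c = 0))
     \<and> M = {zcomb cs bs | cs. length cs = length bs}"

definition zrank :: "'v::ab_group_add set \<Rightarrow> nat" where
  "zrank M = (LEAST n. \<exists>bs. zbasis M bs \<and> length bs = n)"

type_synonym ('g,'v) glat = "'v set \<times> ('g \<Rightarrow> 'v \<Rightarrow> 'v)"

definition is_glat :: "('g,'h) monoid_scheme \<Rightarrow> ('g,'v::ab_group_add) glat \<Rightarrow> bool" where
  "is_glat G L \<longleftrightarrow> (case L of (M, act) \<Rightarrow>
      (\<exists>bs. zbasis M bs)
    \<and> (\<forall>g\<in>carrier G. \<forall>x\<in>M. act g x \<in> M)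
    \<and> (\<forall>g\<in>carrier G. \<forall>x\<in>M. \<forall>y\<in>M. act g (x + y) = act g x + act g y)
    \<and> (\<forall>x\<in>M. act \<one>\<^bsub>G\<^esub> x = x)
    \<and> (\<forall>g\<in>carrier G. \<forall>h\<in>carrier G. \<forall>x\<in>M. act (g \<otimes>\<^bsub>G\<^esub> h) x = act g (act h x)))"

definition glat_rank :: "('g,'v::ab_group_add) glat \<Rightarrow> nat" where
  "glat_rank L = zrank (fst L)"

definition ghom :: "('g,'h) monoid_scheme \<Rightarrow> ('g,'v::ab_group_add) glat \<Rightarrow> ('g,'w::ab_group_add) glat
                     \<Rightarrow> ('v \<Rightarrow> 'w) \<Rightarrow> bool" where
  "ghom G L N f \<longleftrightarrow>
      (\<forall>x\<in>fst L. f x \<in> fst N)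
    \<and> (\<forall>x\<in>fst L. \<forall>y\<in>fst L. f (x + y) = f x + f y)
    \<and> (\<forall>g\<in>carrier G. \<forall>x\<in>fst L. f (snd L g x) = snd N g (f x))"

definition glat_iso :: "('g,'h) monoid_scheme \<Rightarrow> ('g,'v::ab_group_add) glat \<Rightarrow> ('g,'w::ab_group_add) glat \<Rightarrow> bool" where
  "glat_iso G L N \<longleftrightarrow> (\<exists>f. ghom G L N f \<and> bij_betw f (fst L) (fst N))"

definition dsum :: "('g,'v::ab_group_add) glat \<Rightarrow> ('g,'w::ab_group_add) glat \<Rightarrow> ('g,'v \<times> 'w) glat"
  (infixr \<open>\<oplus>\<^sub>L\<close> 65) where
  "dsum L N = (fst L \<times> fst N, \<lambda>g (x,y). (snd L g x, snd N g y))"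

definition trivial_lat :: "('g, int) glat" where
  "trivial_lat = (UNIV, \<lambda>g x. x)"


(* Z[G/H]: finitely supported Z-valued functions on G/H, G acting by left translation *)
definition coset_lat :: "('g,'h) monoid_scheme \<Rightarrow> 'g set \<Rightarrow> ('g, 'g set \<Rightarrow> int) glat" where
  "coset_lat G H = ({f. \<forall>C. C \<notin> LCOSETS G H \<longrightarrow> f C = 0},
     \<lambda>g f C. if C \<in> LCOSETS G H then f (l_coset G (inv\<^bsub>G\<^esub> g) C) else 0)"

definition perm_sum :: "('g,'h) monoid_scheme \<Rightarrow> 'g set list \<Rightarrow> ('g, 'g set \<times> nat \<Rightarrow> int) glat" where
  "perm_sum G Hs = ({f. \<forall>C i. \<not> (i < length Hs \<and> C \<in> LCOSETS G (Hs ! i)) \<longrightarrow> f (C, i) = 0},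
     \<lambda>g f (C, i). if i < length Hs \<and> C \<in> LCOSETS G (Hs ! i) then f (l_coset G (inv\<^bsub>G\<^esub> g) C, i) else 0)"

definition permutation_lat :: "('g,'h) monoid_scheme \<Rightarrow> ('g,'v::ab_group_add) glat \<Rightarrow> bool" where
  "permutation_lat G L \<longleftrightarrow> (\<exists>Hs. (\<forall>H\<in>set Hs. subgroup H G) \<and> glat_iso G L (perm_sum G Hs))"

definition stably_permutation :: "('g,'h) monoid_scheme \<Rightarrow> ('g,'v::ab_group_add) glat \<Rightarrow> bool" where
  "stably_permutation G L \<longleftrightarrow> (\<exists>Hs Hs'. (\<forall>H\<in>set Hs. subgroup H G) \<and> (\<forall>H\<in>set Hs'. subgroup H G)
      \<and> glat_iso G (L \<oplus>\<^sub>L perm_sum G Hs) (perm_sum G Hs'))"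

definition aug_lat :: "('g,'h) monoid_scheme \<Rightarrow> 'g set \<Rightarrow> ('g, 'g set \<Rightarrow> int) glat" where
  "aug_lat G H = ({f \<in> fst (coset_lat G H). (\<Sum>C\<in>LCOSETS G H. f C) = 0}, snd (coset_lat G H))"

(* Z-dual Hom_Z(M, Z), with (g.phi)(x) = phi(g^{-1} x); functions extended by 0 off M *)
definition dual_lat :: "('g,'h) monoid_scheme \<Rightarrow> ('g,'v::ab_group_add) glat \<Rightarrow> ('g, 'v \<Rightarrow> int) glat" where
  "dual_lat G L = ({\<phi>. (\<forall>x\<in>fst L. \<forall>y\<in>fst L. \<phi> (x + y) = \<phi> x + \<phi> y) \<and> (\<forall>x. x \<notin> fst L \<longrightarrow> \<phi> x = 0)},
     \<lambda>g \<phi> x. if x \<in> fst L then \<phi> (snd L (inv\<^bsub>G\<^esub> g) x) else 0)"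

definition chevalley :: "('g,'h) monoid_scheme \<Rightarrow> 'g set \<Rightarrow> ('g, ('g set \<Rightarrow> int) \<Rightarrow> int) glat" where
  "chevalley G H = dual_lat G (aug_lat G H)"

(* \<hat>H^{-1}(H', M) = ker(N_{H'}) / I_{H'} M vanishes *)
definition tate_Hm1_vanishes :: "('g,'h) monoid_scheme \<Rightarrow> 'g set \<Rightarrow> ('g,'v::ab_group_add) glat \<Rightarrow> bool" where
  "tate_Hm1_vanishes G H' L \<longleftrightarrow>
     (\<forall>x\<in>fst L. (\<Sum>h\<in>H'. snd L h x) = 0 \<longrightarrow>
        x \<in> zspan {snd L h y - y | h y. h \<in> H' \<and> y \<in> fst L})"

definition flabby :: "('g,'h) monoid_scheme \<Rightarrow> ('g,'v::ab_group_add) glat \<Rightarrow> bool" where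
  "flabby G L \<longleftrightarrow> (\<forall>H'. subgroup H' G \<longrightarrow> tate_Hm1_vanishes G H' L)"

definition flabby_resolution :: "('g,'h) monoid_scheme \<Rightarrow> ('g,'u::ab_group_add) glat \<Rightarrow> ('g,'v::ab_group_add) glat
     \<Rightarrow> ('g,'w::ab_group_add) glat \<Rightarrow> ('u \<Rightarrow> 'v) \<Rightarrow> ('v \<Rightarrow> 'w) \<Rightarrow> bool" where
  "flabby_resolution G M P F i p \<longleftrightarrow>
      is_glat G M \<and> is_glat G P \<and> is_glat G F
    \<and> ghom G M P i \<and> ghom G P F p
    \<and> inj_on i (fst M) \<and> p ` fst P = fst F \<and> {x \<in> fst P. p x = 0} = i ` fst M
    \<and> permutation_lat G P \<and> flabby G F"

definition sylow_subgroup :: "('g,'h) monoid_scheme \<Rightarrow> nat \<Rightarrow> 'g set \<Rightarrow> bool" where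
  "sylow_subgroup G p H \<longleftrightarrow> subgroup H G \<and> card H = p ^ multiplicity p (order G)"

end

theory Submission
  imports Defs "HOL-Library.Countable"
begin

text \<open>
  Here \<open>PSL\<^sub>2(8) = SL\<^sub>2(8)\<close>. Let \<open>U\<close> be its upper unitriangular subgroup, \<open>T\<close> the diagonal torus,
  \<open>B = U T\<close>, \<open>C\<close> the nonsplit torus of order 9 and \<open>S = SL\<^sub>2(2)\<close>. Explicit integral matrices define a
  sequence \<open>\<int>[G/U] \<rightarrow> P \<rightarrow> X \<rightarrow> R\<close> of equivariant maps \<open>\<iota>\<close>, \<open>\<alpha>\<close>, \<open>\<gamma>\<close>, where
  \<open>P = \<int>[G/U] \<oplus> \<int>[G/T]\<close>, \<open>X = \<int>[G/C] \<oplus> \<int>[G/B]\<^sup>2 \<oplus> \<int>[G/S]\<close> and \<open>R = \<int>[G/S] \<oplus> \<int>\<close>. It is exact at \<open>P\<close>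
  and \<open>X\<close>, the kernel of \<open>\<iota>\<close> consists of the constants, and \<open>\<gamma>\<close> has an equivariant section \<open>\<beta>\<close>.
  The Chevalley module is \<open>\<int>[G/U]\<close> modulo constants, so \<open>F = ker \<gamma>\<close> is the cokernel of an embedding
  of it into \<open>P\<close>. The section gives \<open>X \<cong> F \<oplus> R\<close>, which is the stated isomorphism, of ranks
  \<open>158 = 73 + 85\<close>; being a direct summand of a permutation lattice, \<open>F\<close> is flabby.

  The identities \<open>\<alpha> \<iota> = 0\<close>, \<open>\<gamma> \<alpha> = 0\<close>, \<open>\<gamma> \<beta> = 1\<close> need only be checked on coset representatives.
  Exactness at \<open>X\<close> holds because \<open>1 - \<beta> \<gamma>\<close> maps the generators into the image of \<open>\<alpha>\<close>. Exactness at \<open>P\<close>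
  follows from a homotopy \<open>\<iota> \<sigma> + \<tau> \<alpha> = 1071\<close>, together with the fact that \<open>\<iota> \<psi>\<close> is divisible by \<open>m\<close>
  only if \<open>\<psi>\<close> is constant modulo \<open>m\<close>.
\<close>

subsection \<open>Lattices\<close>

text \<open>The constant 1071 cannot be replaced by 1. With a constant m the homotopy makes m times
  the identity of the Chevalley module J factor through P, so m annihilates the Tate group H^-1(G,
  J), because P is flabby. By 0 -> Z -> Z[G/U] -> J -> 0 that group is the kernel of Z/504 -> Z/8,
  cyclic of order 63; hence 63 divides m, and 1071 = 63 * 17. The homotopy therefore gives exactness
  at P only up to torsion, and the divisibility property of \<open>\<iota> \<psi>\<close> makes up
  for it. Equivariance costs nothing when maps are convolutions with functions invariant on both
  sides: composites are again convolutions, and an identity between maps becomes a list of integer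
  identities to be evaluated in a concrete model of SL_2(8). The theorem however speaks about any
  field with eight elements, any Sylow 2-subgroup and any subgroups isomorphic to S_3 and C_9. For
  this reason the relevant subgroups are classified up to conjugacy and the lattices are carried
  along an isomorphism adapted to the given H.\<close>

definition add_subgroup :: "'v::ab_group_add set \<Rightarrow> bool" where
  "add_subgroup M \<longleftrightarrow> 0 \<in> M \<and> (\<forall>x\<in>M. \<forall>y\<in>M. x - y \<in> M)"

lemma add_subgroupD:
  assumes "add_subgroup M"
  shows "0 \<in> M" "x \<in> M \<Longrightarrow> y \<in> M \<Longrightarrow> x - y \<in> M" "x \<in> M \<Longrightarrow> - x \<in> M" "x \<in> M \<Longrightarrow> y \<in> M \<Longrightarrow> x + y \<in> M"
proof -
  show 0: "0 \<in> M" using assms by (simp add: add_subgroup_def)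
  show d: "x - y \<in> M" if "x \<in> M" "y \<in> M" for x y using assms that by (simp add: add_subgroup_def)
  show n: "- x \<in> M" if "x \<in> M" for x using d[OF 0 that] by simp
  show "x + y \<in> M" if "x \<in> M" "y \<in> M" for x y using d[OF that(1) n[OF that(2)]] by simp
qed

lemma add_subgroup_sum: "add_subgroup M \<Longrightarrow> (\<And>i. i \<in> A \<Longrightarrow> f i \<in> M) \<Longrightarrow> sum f A \<in> M"
  by (induction A rule: infinite_finite_induct) (auto simp: add_subgroupD)

definition additive_on :: "'v::ab_group_add set \<Rightarrow> ('v \<Rightarrow> 'w::ab_group_add) \<Rightarrow> bool" where
  "additive_on M f \<longleftrightarrow> (\<forall>x\<in>M. \<forall>y\<in>M. f (x + y) = f x + f y)"

lemma additive_onD: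
  assumes "additive_on M f" "add_subgroup M"
  shows "f 0 = 0" "x \<in> M \<Longrightarrow> y \<in> M \<Longrightarrow> f (x + y) = f x + f y" "x \<in> M \<Longrightarrow> f (- x) = - f x"
    "x \<in> M \<Longrightarrow> y \<in> M \<Longrightarrow> f (x - y) = f x - f y"
proof -
  note M = add_subgroupD[OF assms(2)]
  show a: "f (x + y) = f x + f y" if "x \<in> M" "y \<in> M" for x y
    using assms(1) that by (simp add: additive_on_def)
  show z: "f 0 = 0" using a[OF M(1) M(1)] by simp
  show n: "f (- x) = - f x" if "x \<in> M" for x
    using a[OF that M(3)[OF that]] z by (simp add: eq_neg_iff_add_eq_0 add.commute)
  show "f (x - y) = f x - f y" if "x \<in> M" "y \<in> M" for x y
    using a[OF that(1) M(3)[OF that(2)]] n[OF that(2)] by simp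
qed

lemma additive_on_sum:
  assumes "additive_on M f" "add_subgroup M" "\<And>i. i \<in> A \<Longrightarrow> g i \<in> M"
  shows "f (sum g A) = (\<Sum>i\<in>A. f (g i))"
  using assms(3)
proof (induction A rule: infinite_finite_induct)
  case (insert x F)
  then show ?case
    using additive_onD(2)[OF assms(1,2), of "g x" "sum g F"] add_subgroup_sum[OF assms(2), of F g] by auto
qed (simp_all add: additive_onD[OF assms(1,2)])

section \<open>Integer multiples and integer combinations\<close>

lemma zsc_int: "zsc (int n) x = (\<Sum>_<n. x)"
  by (simp add: zsc_def)

lemma zsc_neg_int: "zsc (- int n) x = - (\<Sum>_<n. x)"
  by (cases "n = 0") (simp_all add: zsc_def)

lemma zsc_0 [simp]: "zsc 0 x = 0"
  by (simp add: zsc_def)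

lemma zsc_add_one: "zsc (k + 1) x = zsc k x + x"
proof (cases k rule: int_cases)
  case (nonneg n)
  then show ?thesis using zsc_int[of "Suc n" x] zsc_int[of n x] by (simp add: add.commute)
next
  case (neg n)
  then show ?thesis using zsc_neg_int[of "Suc n" x] zsc_neg_int[of n x] by simp
qed

lemma zsc_diff_one: "zsc (k - 1) x = zsc k x - x"
  using zsc_add_one[of "k - 1" x] by (simp add: eq_diff_eq)

lemma zsc_one [simp]: "zsc 1 x = x"
  using zsc_add_one[of 0 x] by simp

lemma zsc_add: "zsc (a + b) x = zsc a x + zsc b x"
proof (induction b rule: int_induct[of _ 0])
  case (step1 i)
  have "zsc (a + (i + 1)) x = zsc (a + i) x + x" using zsc_add_one[of "a + i" x] by (simp add: add.assoc)
  then show ?case using step1 by (simp add: zsc_add_one add.assoc)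
next
  case (step2 i)
  have "zsc (a + (i - 1)) x = zsc (a + i) x - x" using zsc_diff_one[of "a + i" x] by (simp add: add_diff_eq)
  then show ?case using step2 by (simp add: zsc_diff_one add_diff_eq)
qed simp

lemma zsc_minus: "zsc (- a) x = - zsc a x"
  using zsc_add[of a "- a" x] by (simp add: eq_neg_iff_add_eq_0 add.commute)

lemma zsc_diff: "zsc (a - b) x = zsc a x - zsc b x"
  using zsc_add[of a "- b" x] by (simp add: zsc_minus)

lemma zsc_mem: "add_subgroup M \<Longrightarrow> x \<in> M \<Longrightarrow> zsc k x \<in> M"
  by (simp add: zsc_def add_subgroup_sum add_subgroupD)

lemma zsc_hom: "additive_on M f \<Longrightarrow> add_subgroup M \<Longrightarrow> x \<in> M \<Longrightarrow> f (zsc k x) = zsc k (f x)"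
  by (simp add: zsc_def additive_on_sum additive_onD add_subgroup_sum)

lemma zsc_int_eq [simp]: "zsc k (x :: int) = k * x"
  by (simp add: zsc_def)

lemma zsc_fun [simp]: "zsc k f i = k * f i" for f :: "'i \<Rightarrow> int"
  using zsc_hom[of UNIV "\<lambda>f. f i" f k] by (simp add: additive_on_def add_subgroup_def)

lemma sum_fun_apply: "(\<Sum>i\<in>A. f i) x = (\<Sum>i\<in>A. f i x)"
  by (induction A rule: infinite_finite_induct) auto

lemma zcomb_Cons [simp]: "zcomb (c # cs) (b # bs) = zsc c b + zcomb cs bs"
  by (simp add: zcomb_def)

lemma zcomb_Nil [simp]: "zcomb [] [] = 0"
  by (simp add: zcomb_def)

lemma zcomb_append:
  "length cs = length bs \<Longrightarrow> zcomb (cs @ cs') (bs @ bs') = zcomb cs bs + zcomb cs' bs'"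
  by (simp add: zcomb_def)

lemma zcomb_sum: "length cs = length bs \<Longrightarrow> zcomb cs bs = (\<Sum>i<length bs. zsc (cs ! i) (bs ! i))"
  unfolding zcomb_def by (subst sum_list_sum_nth) (auto intro!: sum.cong)

lemma zcomb_map: "zcomb (map c [0..<length bs]) bs = (\<Sum>i<length bs. zsc (c i) (bs ! i))"
  by (simp add: zcomb_sum)

lemma zcomb_mem: "add_subgroup M \<Longrightarrow> set bs \<subseteq> M \<Longrightarrow> length cs = length bs \<Longrightarrow> zcomb cs bs \<in> M"
  unfolding zcomb_sum by (rule add_subgroup_sum) (auto intro!: zsc_mem)

lemma zcomb_hom:
  assumes "additive_on M f" "add_subgroup M" "set bs \<subseteq> M" "length cs = length bs"
  shows "f (zcomb cs bs) = zcomb cs (map f bs)"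
proof -
  have "f (zcomb cs bs) = (\<Sum>i<length bs. f (zsc (cs ! i) (bs ! i)))"
    using assms by (auto simp: zcomb_sum intro!: additive_on_sum zsc_mem)
  also have "\<dots> = zcomb cs (map f bs)"
    using assms by (auto simp: zcomb_sum intro!: sum.cong zsc_hom)
  finally show ?thesis .
qed

lemma zcomb_pairs:
  "length cs = length bs \<Longrightarrow> zcomb cs (map (\<lambda>b. (b, 0)) bs) = (zcomb cs bs, 0)"
  "length cs = length bs \<Longrightarrow> zcomb cs (map (\<lambda>b. (0, b)) bs) = (0, zcomb cs bs)"
  by (rule zcomb_hom[of UNIV "\<lambda>b. (b, 0)" bs cs, symmetric]; simp add: additive_on_def add_subgroup_def)
     (rule zcomb_hom[of UNIV "\<lambda>b. (0, b)" bs cs, symmetric]; simp add: additive_on_def add_subgroup_def)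

lemma zspan_sum:
  assumes "finite A" "\<And>i. i \<in> A \<Longrightarrow> v i \<in> S"
  shows "(\<Sum>i\<in>A. zsc (c i) (v i)) \<in> zspan S"
proof -
  obtain xs where xs: "set xs = A" "distinct xs" using assms(1) finite_distinct_list by auto
  have "(\<Sum>i\<in>A. zsc (c i) (v i)) = zcomb (map c xs) (map v xs)"
    using sum.distinct_set_conv_list[OF xs(2), of "\<lambda>i. zsc (c i) (v i)"] xs(1)
    by (simp add: zcomb_def zip_map_map comp_def zip_same_conv_map)
  then show ?thesis using assms(2) xs(1) unfolding zspan_def by fastforce
qed

lemma zspan_hom:
  assumes "x \<in> zspan A" "A \<subseteq> M" "additive_on M f" "add_subgroup M" "f ` A \<subseteq> B"
  shows "f x \<in> zspan B"
proof -
  obtain cs bs where c: "x = zcomb cs bs" "length cs = length bs" "set bs \<subseteq> A"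
    using assms(1) by (auto simp: zspan_def)
  have "f x = zcomb cs (map f bs)"
    using zcomb_hom[OF assms(3,4), of bs cs] c assms(2) by auto
  moreover have "set (map f bs) \<subseteq> B" using c(3) assms(5) by auto
  ultimately show ?thesis using c(2) unfolding zspan_def by force
qed

section \<open>Bases and rank\<close>

lemma zbasis_subset: "zbasis M bs \<Longrightarrow> set bs \<subseteq> M"
  unfolding zbasis_def by (elim conjE)

lemma zbasis_span: "zbasis M bs \<Longrightarrow> M = {zcomb cs bs | cs. length cs = length bs}"
  unfolding zbasis_def by (elim conjE)

lemma zbasis_indep:
  "zbasis M bs \<Longrightarrow> length cs = length bs \<Longrightarrow> zcomb cs bs = 0 \<Longrightarrow> \<forall>c\<in>set cs. c = 0"
  unfolding zbasis_def by (elim conjE) blast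

lemma zbasisD:
  assumes "zbasis M bs"
  shows "set bs \<subseteq> M" "x \<in> M \<Longrightarrow> \<exists>c. x = (\<Sum>i<length bs. zsc (c i) (bs ! i))"
    "(\<Sum>i<length bs. zsc (c i) (bs ! i)) \<in> M"
    "(\<Sum>i<length bs. zsc (c i) (bs ! i)) = 0 \<Longrightarrow> i < length bs \<Longrightarrow> c i = 0"
proof -
  show "set bs \<subseteq> M" by (rule zbasis_subset[OF assms])
  show "\<exists>c. x = (\<Sum>i<length bs. zsc (c i) (bs ! i))" if "x \<in> M"
    using zbasis_span[OF assms] that by (auto simp: zcomb_sum)
  have M: "M = {zcomb cs bs | cs. length cs = length bs}" by (rule zbasis_span[OF assms])
  show "(\<Sum>i<length bs. zsc (c i) (bs ! i)) \<in> M"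
    unfolding M zcomb_map[symmetric] by (auto intro!: exI[of _ "map c [0..<length bs]"])
  from zbasis_indep[OF assms, of "map c [0..<length bs]"]
  show "c i = 0" if "(\<Sum>i<length bs. zsc (c i) (bs ! i)) = 0" "i < length bs"
    using that by (auto simp: zcomb_map)
qed

lemma zbasis_add_subgroup:
  assumes "zbasis M bs"
  shows "add_subgroup M"
  unfolding add_subgroup_def
proof (intro conjI ballI)
  show "0 \<in> M" using zbasisD(3)[OF assms, of "\<lambda>_. 0"] by simp
  fix x y assume "x \<in> M" "y \<in> M"
  then obtain c d where "x = (\<Sum>i<length bs. zsc (c i) (bs ! i))" "y = (\<Sum>i<length bs. zsc (d i) (bs ! i))"
    using zbasisD(2)[OF assms] by meson
  then show "x - y \<in> M" using zbasisD(3)[OF assms, of "\<lambda>i. c i - d i"] by (simp add: zsc_diff sum_subtractf)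
qed

lemma zbasis_image:
  assumes "zbasis M bs" "additive_on M f" "bij_betw f M N"
  shows "zbasis N (map f bs)"
proof -
  have M: "add_subgroup M" by (rule zbasis_add_subgroup[OF assms(1)])
  have bs: "set bs \<subseteq> M" by (rule zbasis_subset[OF assms(1)])
  have eq: "f (zcomb cs bs) = zcomb cs (map f bs)" if "length cs = length bs" for cs
    by (rule zcomb_hom[OF assms(2) M bs that])
  have inM: "zcomb cs bs \<in> M" if "length cs = length bs" for cs
    by (rule zcomb_mem[OF M bs that])
  have inj: "x = 0" if "x \<in> M" "f x = 0" for x
    using assms(3) that additive_onD(1)[OF assms(2) M] add_subgroupD(1)[OF M]
    by (metis bij_betw_imp_inj_on inj_onD)
  have ind: "\<forall>c\<in>set cs. c = 0" if "length cs = length bs" "zcomb cs bs = 0" for cs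
    by (rule zbasis_indep[OF assms(1) that])
  have N: "N = f ` M" using assms(3) by (simp add: bij_betw_def)
  have "M = {zcomb cs bs | cs. length cs = length bs}" by (rule zbasis_span[OF assms(1)])
  then have "N = {zcomb cs (map f bs) | cs. length cs = length bs}"
    unfolding N using eq by (auto simp: image_iff) metis+
  moreover have "\<forall>c\<in>set cs. c = 0" if "length cs = length bs" "zcomb cs (map f bs) = 0" for cs
    using ind[OF that(1)] inj[OF inM[OF that(1)]] eq[OF that(1)] that(2) by simp
  moreover have "set (map f bs) \<subseteq> N" using bs N by auto
  ultimately show ?thesis unfolding zbasis_def length_map by blast
qed

text \<open>This makes ranks additive; the rank of the kernel of \<open>\<gamma>\<close> is later
  obtained from it by subtraction.\<close>

lemma zbasis_prod:
  assumes "zbasis M bs" "zbasis N ds"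
  shows "zbasis (M \<times> N) (map (\<lambda>b. (b, 0)) bs @ map (\<lambda>d. (0, d)) ds)" (is "zbasis _ (?B @ ?D)")
proof -
  have M: "set bs \<subseteq> M" "M = {zcomb cs bs | cs. length cs = length bs}"
      "\<And>cs. length cs = length bs \<Longrightarrow> zcomb cs bs = 0 \<Longrightarrow> \<forall>c\<in>set cs. c = 0"
    using zbasis_subset[OF assms(1)] zbasis_span[OF assms(1)] zbasis_indep[OF assms(1)] by blast+
  have N: "set ds \<subseteq> N" "N = {zcomb cs ds | cs. length cs = length ds}"
      "\<And>cs. length cs = length ds \<Longrightarrow> zcomb cs ds = 0 \<Longrightarrow> \<forall>c\<in>set cs. c = 0"
    using zbasis_subset[OF assms(2)] zbasis_span[OF assms(2)] zbasis_indep[OF assms(2)] by blast+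
  have z: "zcomb (cs @ cs') (?B @ ?D) = (zcomb cs bs, zcomb cs' ds)"
    if "length cs = length bs" "length cs' = length ds" for cs cs'
    using that by (simp add: zcomb_append zcomb_pairs)
  have split: "\<exists>cs1 cs2. cs = cs1 @ cs2 \<and> length cs1 = length bs \<and> length cs2 = length ds"
    if "length cs = length (?B @ ?D)" for cs :: "int list"
    using that by (intro exI[of _ "take (length bs) cs"] exI[of _ "drop (length bs) cs"]) auto
  have 1: "set (?B @ ?D) \<subseteq> M \<times> N"
    using M(1) N(1) add_subgroupD(1)[OF zbasis_add_subgroup[OF assms(1)]]
      add_subgroupD(1)[OF zbasis_add_subgroup[OF assms(2)]] by auto
  have 2: "\<forall>c\<in>set cs. c = 0" if "length cs = length (?B @ ?D)" "zcomb cs (?B @ ?D) = 0" for cs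
  proof -
    obtain cs1 cs2 where c: "cs = cs1 @ cs2" "length cs1 = length bs" "length cs2 = length ds"
      using split[OF \<open>length cs = length (?B @ ?D)\<close>] by blast
    show ?thesis using z[OF c(2,3)] that(2) M(3)[OF c(2)] N(3)[OF c(3)] c(1) by (auto simp: zero_prod_def)
  qed
  have 3: "M \<times> N = {zcomb cs (?B @ ?D) | cs. length cs = length (?B @ ?D)}"
  proof (intro equalityI subsetI)
    fix p assume "p \<in> M \<times> N"
    then obtain cs1 cs2 where "p = (zcomb cs1 bs, zcomb cs2 ds)" "length cs1 = length bs" "length cs2 = length ds"
      unfolding M(2) N(2) by auto
    then show "p \<in> {zcomb cs (?B @ ?D) | cs. length cs = length (?B @ ?D)}"
      using z by (auto intro!: exI[of _ "cs1 @ cs2"])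
  next
    fix p assume "p \<in> {zcomb cs (?B @ ?D) | cs. length cs = length (?B @ ?D)}"
    then obtain cs where "p = zcomb cs (?B @ ?D)" "length cs = length (?B @ ?D)" by blast
    then show "p \<in> M \<times> N" using split[of cs] z M(2) N(2) by auto
  qed
  show ?thesis unfolding zbasis_def using 1 2 3 by blast
qed

lemma zbasis_supported:
  assumes "finite S"
  shows "\<exists>bs. zbasis {f :: 'i \<Rightarrow> int. \<forall>x. x \<notin> S \<longrightarrow> f x = 0} bs \<and> length bs = card S"
proof -
  obtain xs where xs: "set xs = S" "distinct xs" using assms finite_distinct_list by auto
  define e :: "'i \<Rightarrow> 'i \<Rightarrow> int" where "e x = (\<lambda>y. of_bool (y = x))" for x
  have z: "zcomb cs (map e xs) (xs ! j) = cs ! j" if "length cs = length xs" "j < length xs" for cs j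
  proof -
    have "zcomb cs (map e xs) (xs ! j) = (\<Sum>i<length xs. if i = j then cs ! i else 0)"
      using that xs(2) by (auto simp: zcomb_sum sum_fun_apply e_def nth_eq_iff_index_eq intro!: sum.cong)
    then show ?thesis using that by simp
  qed
  have z0: "zcomb cs (map e xs) y = 0" if "length cs = length xs" "y \<notin> S" for cs y
    using that xs(1) by (auto simp: zcomb_sum sum_fun_apply e_def intro!: sum.neutral)
  have "zbasis {f. \<forall>x. x \<notin> S \<longrightarrow> f x = 0} (map e xs)"
    unfolding zbasis_def
  proof (intro conjI allI impI)
    show "set (map e xs) \<subseteq> {f. \<forall>x. x \<notin> S \<longrightarrow> f x = 0}" using xs(1) by (auto simp: e_def)
    show "\<forall>c\<in>set cs. c = 0" if "length cs = length (map e xs)" "zcomb cs (map e xs) = 0" for cs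
      using z that by (metis in_set_conv_nth length_map zero_fun_apply)
    show "{f. \<forall>x. x \<notin> S \<longrightarrow> f x = 0} = {zcomb cs (map e xs) | cs. length cs = length (map e xs)}"
    proof (intro equalityI subsetI)
      fix f :: "'i \<Rightarrow> int" assume f: "f \<in> {f. \<forall>x. x \<notin> S \<longrightarrow> f x = 0}"
      have "f = zcomb (map f xs) (map e xs)"
      proof
        fix y show "f y = zcomb (map f xs) (map e xs) y"
          using f z[of "map f xs"] z0[of "map f xs" y] xs(1) by (cases "y \<in> S") (auto simp: in_set_conv_nth)
      qed
      then show "f \<in> {zcomb cs (map e xs) | cs. length cs = length (map e xs)}" by fastforce
    qed (use z0 in auto)
  qed
  then show ?thesis using xs distinct_card by fastforce
qed

text \<open>Split off one coordinate \<open>s\<close>: the elements vanishing at \<open>s\<close>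
  have a basis by induction, and one further element, with the least positive value at
  \<open>s\<close>, completes it. In this way kernels of maps are seen to be lattices without
  computing a basis.\<close>

lemma zbasis_subgroup_exists:
  assumes "finite S" "add_subgroup M" "\<And>f x. f \<in> M \<Longrightarrow> x \<notin> S \<Longrightarrow> f x = (0 :: int)"
  shows "\<exists>bs. zbasis M bs"
  using assms
proof (induction S arbitrary: M rule: finite_induct)
  case empty
  then have "M = {0}" using add_subgroupD(1) by (fastforce simp: zero_fun_def)
  then have "zbasis M []" by (auto simp: zbasis_def)
  then show ?case by blast
next
  case (insert s S)
  note M = add_subgroupD[OF insert.prems(1)]
  define M0 where "M0 = {f \<in> M. f s = 0}"
  have M0: "add_subgroup M0" using M by (auto simp: M0_def add_subgroup_def)
  then obtain bs where bs: "zbasis M0 bs"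
    using insert.IH[of M0] insert.prems(2) by (fastforce simp: M0_def)
  show ?case
  proof (cases "M = M0")
    case True
    then show ?thesis using bs by blast
  next
    case False
    then obtain f where f: "f \<in> M" "f s \<noteq> 0" by (auto simp: M0_def)
    define Q where "Q n \<longleftrightarrow> 0 < n \<and> (\<exists>f\<in>M. f s = int n)" for n
    have "Q (nat \<bar>f s\<bar>)"
      using f M(3)[OF f(1)] by (auto simp: Q_def abs_if intro: bexI[of _ f] bexI[of _ "- f"])
    then have QL: "Q (LEAST n. Q n)" by (rule LeastI)
    define d where "d = (LEAST n. Q n)"
    obtain g where g: "g \<in> M" "g s = int d" "0 < d" using QL by (auto simp: d_def Q_def)
    \<comment> \<open>A nonzero remainder would be a positive value at \<open>s\<close> smaller than
      the least one.\<close>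
    have dvd: "f s mod int d = 0" if "f \<in> M" for f
    proof (rule ccontr)
      assume a: "f s mod int d \<noteq> 0"
      have "f - zsc (f s div int d) g \<in> M"
        by (intro M(2) that zsc_mem insert.prems(1) g(1))
      moreover have "(f - zsc (f s div int d) g) s = f s mod int d"
        using g(2) by (simp add: minus_div_mult_eq_mod)
      ultimately have "Q (nat (f s mod int d))"
        using a g(3) by (auto simp: Q_def intro!: bexI[of _ "f - zsc (f s div int d) g"])
      then have "d \<le> nat (f s mod int d)" unfolding d_def by (rule Least_le)
      moreover have "f s mod int d < int d" using g(3) by simp
      ultimately show False using g(3) by linarith
    qed
    have bM: "set bs \<subseteq> M0" "M0 = {zcomb cs bs | cs. length cs = length bs}"
        "\<And>cs. length cs = length bs \<Longrightarrow> zcomb cs bs = 0 \<Longrightarrow> \<forall>c\<in>set cs. c = 0"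
      using zbasis_subset[OF bs] zbasis_span[OF bs] zbasis_indep[OF bs] by blast+
    have z0: "zcomb cs bs s = 0" if "length cs = length bs" for cs
      using bM(2) that by (auto simp: M0_def)
    have "zbasis M (g # bs)"
      unfolding zbasis_def
    proof (intro conjI allI impI)
      show "set (g # bs) \<subseteq> M" using g bM(1) by (auto simp: M0_def)
      show "\<forall>c\<in>set cs. c = 0" if l: "length cs = length (g # bs)" and z: "zcomb cs (g # bs) = 0" for cs
      proof -
        obtain c cs' where c: "cs = c # cs'" "length cs' = length bs" using l by (cases cs) auto
        have "zcomb cs (g # bs) s = c * int d" using c z0 g(2) by simp
        then have "c = 0" using z g(3) by simp
        then show ?thesis using z c bM(3) by simp
      qed
      show "M = {zcomb cs (g # bs) | cs. length cs = length (g # bs)}"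
      proof (intro equalityI subsetI)
        fix f assume fM: "f \<in> M"
        define q where "q = f s div int d"
        have "f - zsc q g \<in> M0"
          using dvd[OF fM] g by (auto simp: M0_def q_def intro!: M(2) fM zsc_mem insert.prems(1))
        then obtain cs where "f - zsc q g = zcomb cs bs" "length cs = length bs" using bM(2) by auto
        then have "f = zcomb (q # cs) (g # bs)" "length (q # cs) = length (g # bs)"
          by (auto simp: diff_eq_eq add.commute)
        then show "f \<in> {zcomb cs (g # bs) | cs. length cs = length (g # bs)}" by blast
      next
        fix f assume "f \<in> {zcomb cs (g # bs) | cs. length cs = length (g # bs)}"
        then show "f \<in> M" using g(1) bM(1) by (auto simp: M0_def intro!: zcomb_mem insert.prems(1))
      qed
    qed
    then show ?thesis by blast
  qed
qed

text \<open>Rank is well defined because \<open>M / 2 M\<close> has \<open>2 ^ n\<close> elements for a basis of length \<open>n\<close>.\<close>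

lemma zbasis_length:
  assumes "zbasis M bs"
  shows "card (M // {(x, y). x \<in> M \<and> y \<in> M \<and> (\<exists>z\<in>M. x - y = z + z)}) = 2 ^ length bs"
proof -
  define R where "R = {(x, y). x \<in> M \<and> y \<in> M \<and> (\<exists>z\<in>M. x - y = z + z)}"
  note M = add_subgroupD[OF zbasis_add_subgroup[OF assms]]
  have "refl_on M R"
    unfolding R_def refl_on_def using M(1) by (auto intro!: bexI[of _ 0])
  moreover have "sym R"
  proof (rule symI)
    fix x y assume "(x, y) \<in> R"
    then obtain z where z: "x \<in> M" "y \<in> M" "z \<in> M" "x - y = z + z" by (auto simp: R_def)
    then have "y - x = - z + - z" by (metis minus_add_distrib minus_diff_eq)
    then show "(y, x) \<in> R" unfolding R_def using z M(3) by blast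
  qed
  moreover have "trans R"
  proof (rule transI)
    fix x y w assume "(x, y) \<in> R" "(y, w) \<in> R"
    then obtain z z' where z: "x \<in> M" "w \<in> M" "z \<in> M" "x - y = z + z" "z' \<in> M" "y - w = z' + z'"
      by (auto simp: R_def)
    have "x - w = (x - y) + (y - w)" by simp
    also have "\<dots> = (z + z') + (z + z')" unfolding z by (simp add: ac_simps)
    finally show "(x, w) \<in> R" unfolding R_def using z M(4) by blast
  qed
  ultimately have eq: "equiv M R" by (auto simp: equiv_def R_def refl_on_def)
  define n where "n = length bs"
  define comb where "comb c = (\<Sum>i<n. zsc (c i) (bs ! i))" for c
  have comb_M: "comb c \<in> M" for c unfolding comb_def n_def by (rule zbasisD(3)[OF assms])
  have comb_add: "comb (\<lambda>i. c i + d i) = comb c + comb d" for c d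
    by (simp add: comb_def zsc_add sum.distrib)
  have comb_diff: "comb (\<lambda>i. c i - d i) = comb c - comb d" for c d
    by (simp add: comb_def zsc_diff sum_subtractf)
  have comb_inj: "c i = d i" if "comb c = comb d" "i < n" for c d i
    using zbasisD(4)[OF assms, of "\<lambda>i. c i - d i" i] comb_diff[of c d] that by (simp add: comb_def n_def)
  have comb_surj: "\<exists>c. x = comb c" if "x \<in> M" for x
    using zbasisD(2)[OF assms that] by (simp add: comb_def n_def)
  define L where "L = {bs :: bool list. set bs \<subseteq> UNIV \<and> length bs = n}"
  define cl where "cl p = R `` {comb (\<lambda>i. of_bool (p ! i))}" for p :: "bool list"
  have "bij_betw cl L (M // R)"
    unfolding bij_betw_def
  proof (intro conjI inj_onI equalityI subsetI)
    fix p p' assume p: "p \<in> L" "p' \<in> L" "cl p = cl p'"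
    have "(comb (\<lambda>i. of_bool (p ! i)), comb (\<lambda>i. of_bool (p' ! i))) \<in> R"
      using p(3) eq comb_M unfolding cl_def by (metis eq_equiv_class)
    then obtain z where z: "z \<in> M" "comb (\<lambda>i. of_bool (p ! i)) - comb (\<lambda>i. of_bool (p' ! i)) = z + z"
      by (auto simp: R_def)
    obtain c where c: "z = comb c" using comb_surj z(1) by blast
    have e: "comb (\<lambda>i. of_bool (p ! i) - of_bool (p' ! i)) = comb (\<lambda>i. c i + c i)"
      using z(2) unfolding comb_diff comb_add c .
    have "p ! i = p' ! i" if "i < n" for i
    proof -
      have "odd (of_bool (p ! i) - of_bool (p' ! i) :: int) = False"
        using comb_inj[OF e that] by simp
      then show ?thesis by (cases "p ! i"; cases "p' ! i") auto
    qed
    then show "p = p'" using p by (intro nth_equalityI) (auto simp: L_def)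
  next
    fix C assume "C \<in> cl ` L"
    then show "C \<in> M // R" using comb_M by (auto simp: cl_def intro: quotientI)
  next
    fix C assume "C \<in> M // R"
    then obtain x where x: "x \<in> M" "C = R `` {x}" by (auto elim: quotientE)
    obtain c where c: "x = comb c" using comb_surj x(1) by blast
    define p where "p = map (\<lambda>i. odd (c i)) [0..<n]"
    have c2: "c i = of_bool (odd (c i)) + (c i div 2 + c i div 2)" for i
      using mult_div_mod_eq[of 2 "c i"] by (simp add: mod_2_eq_odd)
    have "comb c = comb (\<lambda>i. of_bool (odd (c i)) + (c i div 2 + c i div 2))"
      by (rule arg_cong[of _ _ comb], rule ext, rule c2)
    then have "comb c = comb (\<lambda>i. of_bool (odd (c i))) + comb (\<lambda>i. c i div 2 + c i div 2)"
      unfolding comb_add .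
    moreover have "comb (\<lambda>i. of_bool (odd (c i))) = comb (\<lambda>i. of_bool (p ! i))"
      by (auto simp: comb_def p_def intro!: sum.cong)
    ultimately have "x - comb (\<lambda>i. of_bool (p ! i)) = comb (\<lambda>i. c i div 2) + comb (\<lambda>i. c i div 2)"
      unfolding c comb_add by simp
    then have "(x, comb (\<lambda>i. of_bool (p ! i))) \<in> R" unfolding R_def using x(1) comb_M by blast
    then have "C = cl p" unfolding x(2) cl_def using eq by (metis equiv_class_eq)
    moreover have "p \<in> L" by (simp add: L_def p_def)
    ultimately show "C \<in> cl ` L" by blast
  qed
  then have "card (M // R) = card L" by (simp add: bij_betw_same_card)
  also have "\<dots> = 2 ^ n" unfolding L_def by (subst card_lists_length_eq) auto
  finally show ?thesis by (simp add: R_def n_def)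
qed

lemma zbasis_length_unique: "zbasis M bs \<Longrightarrow> zbasis M bs' \<Longrightarrow> length bs = length bs'"
  using zbasis_length[of M bs] zbasis_length[of M bs'] by simp

lemma zrank_eq: "zbasis M bs \<Longrightarrow> zrank M = length bs"
  unfolding zrank_def by (rule Least_equality) (auto dest: zbasis_length_unique)

section \<open>Equivariant maps, isomorphisms and flabbiness\<close>

definition glat_ok :: "('g,'h) monoid_scheme \<Rightarrow> ('g,'v::ab_group_add) glat \<Rightarrow> bool" where
  "glat_ok G L \<longleftrightarrow> add_subgroup (fst L) \<and> (\<forall>g\<in>carrier G. \<forall>x\<in>fst L. snd L g x \<in> fst L)"

lemma glat_ok_dsum: "glat_ok G L \<Longrightarrow> glat_ok G N \<Longrightarrow> glat_ok G (L \<oplus>\<^sub>L N)"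
  by (auto simp: glat_ok_def dsum_def add_subgroup_def zero_prod_def)

lemma ghomD:
  assumes "ghom G L N f"
  shows "x \<in> fst L \<Longrightarrow> f x \<in> fst N" "x \<in> fst L \<Longrightarrow> y \<in> fst L \<Longrightarrow> f (x + y) = f x + f y"
    "g \<in> carrier G \<Longrightarrow> x \<in> fst L \<Longrightarrow> f (snd L g x) = snd N g (f x)" "additive_on (fst L) f"
  using assms by (auto simp: ghom_def additive_on_def)

lemma ghom_comp: "ghom G L N f \<Longrightarrow> ghom G N K k \<Longrightarrow> ghom G L K (k \<circ> f)"
  by (simp add: ghom_def)

lemma glat_isoI:
  assumes "ghom G L N f" "ghom G N L k" "\<And>x. x \<in> fst L \<Longrightarrow> k (f x) = x" "\<And>y. y \<in> fst N \<Longrightarrow> f (k y) = y"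
  shows "glat_iso G L N"
  unfolding glat_iso_def
proof (intro exI conjI)
  show "bij_betw f (fst L) (fst N)"
    by (rule bij_betw_byWitness[of _ k]) (use assms ghomD(1) in fastforce)+
qed (rule assms(1))

text \<open>The inverse is additive and equivariant because sums and translates of its values stay
  inside \<open>L\<close>; this is what \<open>glat_ok\<close> provides.\<close>

lemma glat_isoE:
  assumes "glat_iso G L N" "glat_ok G L"
  obtains f k where "ghom G L N f" "ghom G N L k"
    "\<And>x. x \<in> fst L \<Longrightarrow> k (f x) = x" "\<And>y. y \<in> fst N \<Longrightarrow> f (k y) = y"
proof -
  obtain f where f: "ghom G L N f" "bij_betw f (fst L) (fst N)" using assms(1) by (auto simp: glat_iso_def)
  define k where "k = the_inv_into (fst L) f"
  have k: "k y \<in> fst L" "f (k y) = y" if "y \<in> fst N" for y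
    using f(2) that the_inv_into_into[of f "fst L" y "fst L"] f_the_inv_into_f[of f "fst L" y]
    by (auto simp: bij_betw_def k_def)
  have kf: "k (f x) = x" if "x \<in> fst L" for x
    using f(2) that by (simp add: bij_betw_def k_def the_inv_into_f_f)
  have "ghom G N L k"
    unfolding ghom_def
  proof (intro conjI ballI)
    fix x y assume xy: "x \<in> fst N" "y \<in> fst N"
    have "k (f (k x + k y)) = k x + k y"
      by (rule kf) (use k xy assms(2) in \<open>auto simp: glat_ok_def add_subgroupD\<close>)
    then show "k (x + y) = k x + k y" using ghomD(2)[OF f(1)] k xy by simp
  next
    fix g x assume gx: "g \<in> carrier G" "x \<in> fst N"
    have "k (f (snd L g (k x))) = snd L g (k x)"
      by (rule kf) (use k gx assms(2) in \<open>auto simp: glat_ok_def\<close>)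
    then show "k (snd N g x) = snd L g (k x)" using ghomD(3)[OF f(1)] k gx by simp
  qed (use k in auto)
  then show thesis using that f(1) kf k(2) by blast
qed

lemma glat_iso_refl: "glat_iso G L L"
  by (rule glat_isoI[of _ _ _ id id]) (auto simp: ghom_def)

lemma glat_iso_trans: "glat_iso G L N \<Longrightarrow> glat_iso G N K \<Longrightarrow> glat_iso G L K"
  unfolding glat_iso_def using ghom_comp bij_betw_trans by blast

lemma glat_iso_sym: "glat_iso G L N \<Longrightarrow> glat_ok G L \<Longrightarrow> glat_iso G N L"
  by (metis glat_isoE glat_isoI)

lemma glat_iso_dsum:
  assumes "glat_iso G L L'" "glat_iso G N N'"
  shows "glat_iso G (L \<oplus>\<^sub>L N) (L' \<oplus>\<^sub>L N')"
proof -
  obtain f k where "ghom G L L' f" "bij_betw f (fst L) (fst L')" "ghom G N N' k" "bij_betw k (fst N) (fst N')"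
    using assms by (auto simp: glat_iso_def)
  then have "ghom G (L \<oplus>\<^sub>L N) (L' \<oplus>\<^sub>L N') (map_prod f k)
      \<and> bij_betw (map_prod f k) (fst (L \<oplus>\<^sub>L N)) (fst (L' \<oplus>\<^sub>L N'))"
    by (auto simp: ghom_def dsum_def map_prod_def intro: bij_betw_map_prod[unfolded map_prod_def])
  then show ?thesis unfolding glat_iso_def by blast
qed

lemma is_glat_ok: "is_glat G L \<Longrightarrow> glat_ok G L"
  by (auto simp: is_glat_def glat_ok_def split: prod.splits intro: zbasis_add_subgroup)

lemma is_glat_iso:
  assumes "is_glat G L" "ghom G L N f" "bij_betw f (fst L) (fst N)" "group G"
  shows "is_glat G N"
proof -
  interpret group G by fact
  obtain M a where L: "L = (M, a)" by (cases L)
  obtain M' a' where N: "N = (M', a')" by (cases N)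
  have f: "bij_betw f M M'" "additive_on M f" using assms ghomD(4) by (auto simp: L N)
  have fM: "f x \<in> M'" if "x \<in> M" for x using that f(1) by (auto simp: bij_betw_def)
  have fa: "a' g (f x) = f (a g x)" if "g \<in> carrier G" "x \<in> M" for g x
    using ghomD(3)[OF assms(2)] that by (simp add: L N)
  have fp: "f x + f y = f (x + y)" if "x \<in> M" "y \<in> M" for x y
    using f(2) that by (simp add: additive_on_def)
  have l: "\<exists>bs. zbasis M bs" "\<And>g x. g \<in> carrier G \<Longrightarrow> x \<in> M \<Longrightarrow> a g x \<in> M"
    "\<And>g x y. g \<in> carrier G \<Longrightarrow> x \<in> M \<Longrightarrow> y \<in> M \<Longrightarrow> a g (x + y) = a g x + a g y"
    "\<And>x. x \<in> M \<Longrightarrow> a \<one>\<^bsub>G\<^esub> x = x"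
    "\<And>g h x. g \<in> carrier G \<Longrightarrow> h \<in> carrier G \<Longrightarrow> x \<in> M \<Longrightarrow> a (g \<otimes>\<^bsub>G\<^esub> h) x = a g (a h x)"
    using assms(1) by (simp_all add: is_glat_def L)
  have "x + y \<in> M" if "x \<in> M" "y \<in> M" for x y
    using l(1) that add_subgroupD(4) zbasis_add_subgroup by blast
  moreover have "M' = f ` M" using f(1) by (simp add: bij_betw_def)
  moreover have "\<exists>bs. zbasis M' bs" using l(1) zbasis_image[OF _ f(2,1)] by blast
  ultimately show ?thesis unfolding is_glat_def N by (simp add: fa fp l)
qed

text \<open>An \<open>x\<close> of norm zero goes by \<open>s\<close> to an element of
  \<open>B\<close> of norm zero, hence to a combination of elements h y - y. Applying
  \<open>r\<close> turns this into a combination of the same kind for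
  \<open>r (s x) = x\<close>.\<close>

lemma flabby_retract:
  assumes "ghom G F B s" "ghom G B F r" "\<And>x. x \<in> fst F \<Longrightarrow> r (s x) = x"
    and "glat_ok G F" "glat_ok G B" "flabby G B"
  shows "flabby G F"
  unfolding flabby_def tate_Hm1_vanishes_def
proof (intro allI impI ballI)
  fix H x assume H: "subgroup H G" and x: "x \<in> fst F" and z: "(\<Sum>h\<in>H. snd F h x) = 0"
  have HG: "h \<in> carrier G" if "h \<in> H" for h using H that subgroup.mem_carrier by fast
  have F: "add_subgroup (fst F)" "add_subgroup (fst B)" using assms(4,5) by (auto simp: glat_ok_def)
  have sx: "s x \<in> fst B" using ghomD(1)[OF assms(1) x] .
  have "(\<Sum>h\<in>H. snd B h (s x)) = (\<Sum>h\<in>H. s (snd F h x))"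
    using ghomD(3)[OF assms(1) HG x] by simp
  also have "\<dots> = s (\<Sum>h\<in>H. snd F h x)"
    using assms(4) x HG
    by (intro additive_on_sum[OF ghomD(4)[OF assms(1)] F(1), symmetric]) (auto simp: glat_ok_def)
  also have "\<dots> = 0" using z additive_onD(1)[OF ghomD(4)[OF assms(1)] F(1)] by simp
  finally have zs: "s x \<in> zspan {snd B h y - y | h y. h \<in> H \<and> y \<in> fst B}"
    using assms(6) H sx unfolding flabby_def tate_Hm1_vanishes_def by blast
  have sub: "{snd B h y - y | h y. h \<in> H \<and> y \<in> fst B} \<subseteq> fst B"
    using assms(5) HG by (auto simp: glat_ok_def add_subgroupD)
  have img: "r ` {snd B h y - y | h y. h \<in> H \<and> y \<in> fst B} \<subseteq> {snd F h y - y | h y. h \<in> H \<and> y \<in> fst F}"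
  proof clarify
    fix h y assume hy: "h \<in> H" "y \<in> fst B"
    then have "r (snd B h y - y) = snd F h (r y) - r y"
      using additive_onD(4)[OF ghomD(4)[OF assms(2)] F(2)] assms(5) HG ghomD(3)[OF assms(2)]
      by (auto simp: glat_ok_def)
    then show "\<exists>h' y'. r (snd B h y - y) = snd F h' y' - y' \<and> h' \<in> H \<and> y' \<in> fst F"
      using hy(1) ghomD(1)[OF assms(2) hy(2)] by blast
  qed
  have "r (s x) \<in> zspan {snd F h y - y | h y. h \<in> H \<and> y \<in> fst F}"
    by (rule zspan_hom[OF zs sub ghomD(4)[OF assms(2)] F(2) img])
  then show "x \<in> zspan {snd F h y - y | h y. h \<in> H \<and> y \<in> fst F}" using assms(3) x by simp
qed

text \<open>Each basis vector is moved to the chosen representative of its H-orbit, at the cost of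
  elements h y - y. What is left has the orbit sums of \<open>f\<close> as coefficients, and these
  vanish as soon as the norm of \<open>f\<close> does.\<close>

lemma flabby_permutation:
  fixes \<sigma> :: "'g \<Rightarrow> 'o \<Rightarrow> 'o"
  assumes "group G" "finite (carrier G)" "finite \<Omega>"
    and \<sigma>: "\<And>g x. g \<in> carrier G \<Longrightarrow> x \<in> \<Omega> \<Longrightarrow> \<sigma> g x \<in> \<Omega>" "\<And>x. x \<in> \<Omega> \<Longrightarrow> \<sigma> \<one>\<^bsub>G\<^esub> x = x"
      "\<And>g h x. g \<in> carrier G \<Longrightarrow> h \<in> carrier G \<Longrightarrow> x \<in> \<Omega> \<Longrightarrow> \<sigma> (g \<otimes>\<^bsub>G\<^esub> h) x = \<sigma> g (\<sigma> h x)"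
  shows "flabby G ({f :: 'o \<Rightarrow> int. \<forall>x. x \<notin> \<Omega> \<longrightarrow> f x = 0},
    \<lambda>g f x. if x \<in> \<Omega> then f (\<sigma> (inv\<^bsub>G\<^esub> g) x) else 0)"
  unfolding flabby_def tate_Hm1_vanishes_def fst_conv snd_conv
proof (intro allI impI ballI)
  interpret group G by fact
  fix H and f :: "'o \<Rightarrow> int"
  assume H: "subgroup H G" and f: "f \<in> {f. \<forall>x. x \<notin> \<Omega> \<longrightarrow> f x = 0}"
    and sum0: "(\<Sum>h\<in>H. (\<lambda>x. if x \<in> \<Omega> then f (\<sigma> (inv\<^bsub>G\<^esub> h) x) else 0)) = 0"
  interpret H: subgroup H G by fact
  have finH: "finite H" using H.subset assms(2) finite_subset by blast
  have inv_l: "\<sigma> (inv\<^bsub>G\<^esub> h) (\<sigma> h x) = x" if "h \<in> carrier G" "x \<in> \<Omega>" for h x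
  proof -
    have "\<sigma> (inv\<^bsub>G\<^esub> h) (\<sigma> h x) = \<sigma> (inv\<^bsub>G\<^esub> h \<otimes>\<^bsub>G\<^esub> h) x"
      by (rule \<sigma>(3)[symmetric]) (use that in auto)
    then show ?thesis using that \<sigma>(2) by simp
  qed
  have inv_r: "\<sigma> h (\<sigma> (inv\<^bsub>G\<^esub> h) x) = x" if "h \<in> carrier G" "x \<in> \<Omega>" for h x
    using inv_l[of "inv\<^bsub>G\<^esub> h" x] that by simp
  define orb where "orb x = (\<lambda>h. \<sigma> h x) ` H" for x
  have orb_sub: "orb x \<subseteq> \<Omega>" if "x \<in> \<Omega>" for x using that \<sigma>(1) by (auto simp: orb_def)
  have orb_self: "x \<in> orb x" if "x \<in> \<Omega>" for x 
    unfolding orb_def by (rule image_eqI[of _ _ "\<one>\<^bsub>G\<^esub>"]) (simp_all add: \<sigma>(2)[OF that])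
  have orb_eq: "orb y = orb x" if "x \<in> \<Omega>" "y \<in> orb x" for x y
  proof -
    obtain h where h: "h \<in> H" "y = \<sigma> h x" using \<open>y \<in> orb x\<close> by (auto simp: orb_def)
    have "\<sigma> k y \<in> orb x" if "k \<in> H" for k
      unfolding orb_def h(2)
      by (rule image_eqI[of _ _ "k \<otimes>\<^bsub>G\<^esub> h"]) (use h(1) that \<sigma>(3)[of k h x] \<open>x \<in> \<Omega>\<close> in auto)
    moreover have "\<sigma> k x \<in> orb y" if "k \<in> H" for k
    proof -
      have "\<sigma> (k \<otimes>\<^bsub>G\<^esub> inv\<^bsub>G\<^esub> h) y = \<sigma> k (\<sigma> (inv\<^bsub>G\<^esub> h) (\<sigma> h x))"
        unfolding h(2) using that h \<open>x \<in> \<Omega>\<close> by (intro \<sigma>(3)) (auto intro: \<sigma>(1))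
      also have "\<dots> = \<sigma> k x" using inv_l h \<open>x \<in> \<Omega>\<close> by auto
      finally show ?thesis
        unfolding orb_def
        by (intro image_eqI[of _ _ "k \<otimes>\<^bsub>G\<^esub> inv\<^bsub>G\<^esub> h"]) (use that h(1) in auto)
    qed
    ultimately show ?thesis by (auto simp: orb_def)
  qed
  \<comment> \<open>The choice depends on \<open>x\<close> only through the set
    \<open>orb x\<close>, so it is constant on orbits.\<close>
  define \<rho> where "\<rho> x = (SOME y. y \<in> orb x)" for x
  have \<rho>: "\<rho> x \<in> orb x" if "x \<in> \<Omega>" for x
    unfolding \<rho>_def by (rule someI[of _ x]) (rule orb_self[OF that])
  have \<rho>_eq: "\<rho> y = \<rho> x" if "x \<in> \<Omega>" "y \<in> orb x" for x y
    using orb_eq[OF that] by (simp add: \<rho>_def)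
  define k where "k x = (SOME h. h \<in> H \<and> \<rho> x = \<sigma> h x)" for x
  have k: "k x \<in> H" "\<rho> x = \<sigma> (k x) x" if "x \<in> \<Omega>" for x
  proof -
    have "\<exists>h. h \<in> H \<and> \<rho> x = \<sigma> h x" using \<rho>[OF that] by (auto simp: orb_def)
    then have "k x \<in> H \<and> \<rho> x = \<sigma> (k x) x" unfolding k_def by (rule someI_ex)
    then show "k x \<in> H" "\<rho> x = \<sigma> (k x) x" by auto
  qed
  define act where "act g f = (\<lambda>x. if x \<in> \<Omega> then f (\<sigma> (inv\<^bsub>G\<^esub> g) x) else (0::int))" for g and f :: "'o \<Rightarrow> int"
  define e where "e x = (\<lambda>y. of_bool (y = x) :: int)" for x :: 'o
  have act_e: "act h (e x) = e (\<sigma> h x)" if "h \<in> H" "x \<in> \<Omega>" for h x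
  proof
    fix y
    have "h \<in> carrier G" using that by simp
    then have "y \<in> \<Omega> \<Longrightarrow> \<sigma> (inv\<^bsub>G\<^esub> h) y = x \<longleftrightarrow> y = \<sigma> h x"
      using inv_l[of h x] inv_r[of h y] that(2) by auto
    moreover have "\<sigma> h x \<in> \<Omega>" using \<sigma>(1) that by auto
    ultimately show "act h (e x) y = e (\<sigma> h x) y" by (auto simp: act_def e_def)
  qed
  \<comment> \<open>Summing the norm of \<open>f\<close> over an orbit counts the orbit sum |H|
    times.\<close>
  have orbit_sum: "(\<Sum>y\<in>orb x. f y) = 0" if x: "x \<in> \<Omega>" for x
  proof -
    have bij: "bij_betw (\<lambda>y. \<sigma> (inv\<^bsub>G\<^esub> h) y) (orb x) (orb x)" if h: "h \<in> H" for h
    proof (rule bij_betw_byWitness[of _ "\<sigma> h"])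
      have cl: "\<sigma> g y \<in> orb x" if "g \<in> H" "y \<in> orb x" for g y
        using orb_eq[OF x that(2)] that(1) unfolding orb_def by blast
      show "(\<lambda>y. \<sigma> (inv\<^bsub>G\<^esub> h) y) ` orb x \<subseteq> orb x" "\<sigma> h ` orb x \<subseteq> orb x" using cl h by auto
      show "\<forall>y\<in>orb x. \<sigma> h (\<sigma> (inv\<^bsub>G\<^esub> h) y) = y" "\<forall>y\<in>orb x. \<sigma> (inv\<^bsub>G\<^esub> h) (\<sigma> h y) = y"
        using inv_l inv_r orb_sub[OF x] h by auto
    qed
    have "(\<Sum>h\<in>H. f (\<sigma> (inv\<^bsub>G\<^esub> h) y)) = 0" if "y \<in> orb x" for y
      using fun_cong[OF sum0, of y] orb_sub[OF x] that by (auto simp: sum_fun_apply)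
    then have "0 = (\<Sum>y\<in>orb x. \<Sum>h\<in>H. f (\<sigma> (inv\<^bsub>G\<^esub> h) y))" by simp
    also have "\<dots> = (\<Sum>h\<in>H. \<Sum>y\<in>orb x. f (\<sigma> (inv\<^bsub>G\<^esub> h) y))" by (rule sum.swap)
    also have "\<dots> = (\<Sum>h\<in>H. \<Sum>y\<in>orb x. f y)"
      by (intro sum.cong refl sum.reindex_bij_betw[OF bij])
    also have "\<dots> = int (card H) * (\<Sum>y\<in>orb x. f y)" by simp
    finally have "card H = 0 \<or> (\<Sum>y\<in>orb x. f y) = 0" by simp
    moreover have "H \<noteq> {}" using H.one_closed by blast
    ultimately show ?thesis using finH by simp
  qed
  \<comment> \<open>Here \<open>e x = e (\<rho> x) - (act (k x) (e x) - e x)\<close>, whence the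
    sign; the terms with \<open>e (\<rho> x)\<close> cancel by \<open>orbit_sum\<close>.\<close>
  have "f = (\<Sum>x\<in>\<Omega>. zsc (- f x) (act (k x) (e x) - e x))"
  proof
    fix p
    have "(\<Sum>x\<in>\<Omega>. zsc (- f x) (act (k x) (e x) - e x)) p = (\<Sum>x\<in>\<Omega>. f x * of_bool (p = x) - f x * of_bool (\<rho> x = p))"
      unfolding sum_fun_apply
    proof (intro sum.cong refl)
      fix x assume x: "x \<in> \<Omega>"
      have "act (k x) (e x) = e (\<rho> x)" using act_e[OF k(1)[OF x] x] k(2)[OF x] by simp
      then show "zsc (- f x) (act (k x) (e x) - e x) p = f x * of_bool (p = x) - f x * of_bool (\<rho> x = p)"
        by (auto simp: e_def)
    qed
    also have "\<dots> = (\<Sum>x\<in>\<Omega>. f x * of_bool (p = x)) - (\<Sum>x\<in>\<Omega>. f x * of_bool (\<rho> x = p))"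
      by (rule sum_subtractf)
    also have "(\<Sum>x\<in>\<Omega>. f x * of_bool (p = x)) = f p"
    proof -
      have "(\<Sum>x\<in>\<Omega>. f x * of_bool (p = x)) = (\<Sum>x\<in>\<Omega>. if p = x then f x else 0)"
        by (intro sum.cong) auto
      then show ?thesis using f assms(3) by auto
    qed
    also have "(\<Sum>x\<in>\<Omega>. f x * of_bool (\<rho> x = p)) = (\<Sum>x\<in>{x \<in> \<Omega>. \<rho> x = p}. f x)"
      using assms(3) by (simp add: sum.inter_filter of_bool_def if_distrib cong: if_cong)
    also have "\<dots> = 0"
    proof (cases "\<exists>x\<in>\<Omega>. \<rho> x = p")
      case True
      then obtain x where x: "x \<in> \<Omega>" "\<rho> x = p" by blast
      have "{y \<in> \<Omega>. \<rho> y = p} = orb x"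
      proof (intro equalityI subsetI)
        fix y assume "y \<in> {y \<in> \<Omega>. \<rho> y = p}"
        then have y: "y \<in> \<Omega>" "\<rho> y = p" by auto
        have "orb p = orb y" "orb p = orb x"
          using orb_eq[OF y(1) \<rho>[OF y(1)]] orb_eq[OF x(1) \<rho>[OF x(1)]] y(2) x(2) by auto
        then show "y \<in> orb x" using orb_self[OF y(1)] by simp
      next
        fix y assume "y \<in> orb x"
        then show "y \<in> {y \<in> \<Omega>. \<rho> y = p}" using \<rho>_eq x orb_sub by auto
      qed
      then show ?thesis using orbit_sum x by simp
    qed (metis (mono_tags, lifting) mem_Collect_eq sum.neutral)
    finally show "f p = (\<Sum>x\<in>\<Omega>. zsc (- f x) (act (k x) (e x) - e x)) p"
      by (simp only: diff_zero)
  qed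
  also have "\<dots> \<in> zspan {act h y - y | h y. h \<in> H \<and> y \<in> {f. \<forall>x. x \<notin> \<Omega> \<longrightarrow> f x = 0}}"
  proof (rule zspan_sum[OF assms(3)])
    fix x assume "x \<in> \<Omega>"
    then have "k x \<in> H" "e x \<in> {f. \<forall>x. x \<notin> \<Omega> \<longrightarrow> f x = 0}" using k(1) by (auto simp: e_def)
    then show "act (k x) (e x) - e x \<in> {act h y - y | h y. h \<in> H \<and> y \<in> {f. \<forall>x. x \<notin> \<Omega> \<longrightarrow> f x = 0}}"
      by blast
  qed
  finally show "f \<in> zspan {(\<lambda>x. if x \<in> \<Omega> then y (\<sigma> (inv\<^bsub>G\<^esub> h) x) else 0) - y | h y.
      h \<in> H \<and> y \<in> {f. \<forall>x. x \<notin> \<Omega> \<longrightarrow> f x = 0}}"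
    unfolding act_def .
qed

subsection \<open>Invariant functions and kernel operators\<close>

text \<open>\<open>RL G Ks\<close> is the lattice \<open>\<Oplus>\<^sub>j \<int>[G/K\<^sub>j]\<close>, realised as right \<open>K\<^sub>j\<close>-invariant functions on \<open>G\<close>.\<close>

definition RL :: "('a,'b) monoid_scheme \<Rightarrow> 'a set list \<Rightarrow> (nat \<times> 'a \<Rightarrow> int) set" where
  "RL G Ks = {f. (\<forall>j x. \<not> (j < length Ks \<and> x \<in> carrier G) \<longrightarrow> f (j, x) = 0)
     \<and> (\<forall>j<length Ks. \<forall>x\<in>carrier G. \<forall>k\<in>Ks ! j. f (j, x \<otimes>\<^bsub>G\<^esub> k) = f (j, x))}"

definition lt :: "('a,'b) monoid_scheme \<Rightarrow> 'a \<Rightarrow> (nat \<times> 'a \<Rightarrow> int) \<Rightarrow> nat \<times> 'a \<Rightarrow> int" where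
  "lt G g f = (\<lambda>(j, x). if x \<in> carrier G then f (j, inv\<^bsub>G\<^esub> g \<otimes>\<^bsub>G\<^esub> x) else 0)"

definition transversal :: "('a,'b) monoid_scheme \<Rightarrow> 'a set \<Rightarrow> 'a set \<Rightarrow> bool" where
  "transversal G K T \<longleftrightarrow> T \<subseteq> carrier G \<and> finite T \<and> (\<forall>x\<in>carrier G. \<exists>!t. t \<in> T \<and> inv\<^bsub>G\<^esub> t \<otimes>\<^bsub>G\<^esub> x \<in> K)"

definition tsys :: "('a,'b) monoid_scheme \<Rightarrow> 'a set list \<Rightarrow> 'a set list \<Rightarrow> bool" where
  "tsys G Ks Ts \<longleftrightarrow> length Ts = length Ks
     \<and> (\<forall>j<length Ks. subgroup (Ks ! j) G \<and> transversal G (Ks ! j) (Ts ! j))"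

text \<open>Left invariance puts the values of \<open>kop\<close> into \<open>RL G Ks\<close>; right
  invariance makes a sum over coset representatives commute with translation.\<close>

definition binv :: "('a,'b) monoid_scheme \<Rightarrow> 'a set list \<Rightarrow> 'a set list \<Rightarrow> (nat \<Rightarrow> nat \<Rightarrow> 'a \<Rightarrow> int) \<Rightarrow> bool" where
  "binv G Ks Ls w \<longleftrightarrow> (\<forall>i<length Ks. \<forall>j<length Ls. \<forall>x\<in>carrier G.
     (\<forall>k\<in>Ks ! i. w i j (k \<otimes>\<^bsub>G\<^esub> x) = w i j x) \<and> (\<forall>l\<in>Ls ! j. w i j (x \<otimes>\<^bsub>G\<^esub> l) = w i j x))"

text \<open>The matrix entry between the cosets of \<open>x\<close> and \<open>t\<close> depends
  only on the double coset of \<open>inv x \<otimes> t\<close>. Equivariant maps between permutation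
  lattices are exactly the matrices of this shape.\<close>

definition kop :: "('a,'b) monoid_scheme \<Rightarrow> nat \<Rightarrow> 'a set list \<Rightarrow> (nat \<Rightarrow> nat \<Rightarrow> 'a \<Rightarrow> int)
    \<Rightarrow> (nat \<times> 'a \<Rightarrow> int) \<Rightarrow> nat \<times> 'a \<Rightarrow> int" where
  "kop G n Ts w f = (\<lambda>(i, x). if i < n \<and> x \<in> carrier G
     then \<Sum>j<length Ts. \<Sum>t\<in>Ts ! j. w i j (inv\<^bsub>G\<^esub> x \<otimes>\<^bsub>G\<^esub> t) * f (j, t) else 0)"

text \<open>Kernel of the composite of the operators with kernels \<open>w\<close> and
  \<open>v\<close>, read off at the cosets of 1 and \<open>g\<close>.\<close>

definition conv :: "('a,'b) monoid_scheme \<Rightarrow> 'a set list \<Rightarrow> (nat \<Rightarrow> nat \<Rightarrow> 'a \<Rightarrow> int)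
    \<Rightarrow> (nat \<Rightarrow> nat \<Rightarrow> 'a \<Rightarrow> int) \<Rightarrow> nat \<Rightarrow> nat \<Rightarrow> 'a \<Rightarrow> int" where
  "conv G Ts w v i k g = (\<Sum>j<length Ts. \<Sum>t\<in>Ts ! j. w i j t * v j k (inv\<^bsub>G\<^esub> t \<otimes>\<^bsub>G\<^esub> g))"

definition delta :: "'a set list \<Rightarrow> nat \<Rightarrow> nat \<Rightarrow> 'a \<Rightarrow> int" where
  "delta Ks i k g = of_bool (i = k \<and> g \<in> Ks ! k)"

lemma add_subgroup_RL: "add_subgroup (RL G Ks)"
  by (auto simp: add_subgroup_def RL_def)

lemma RL_zero: "f \<in> RL G Ks \<Longrightarrow> \<not> (j < length Ks \<and> x \<in> carrier G) \<Longrightarrow> f (j, x) = 0"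
  by (simp add: RL_def)

lemma RL_right: "f \<in> RL G Ks \<Longrightarrow> j < length Ks \<Longrightarrow> x \<in> carrier G \<Longrightarrow> k \<in> Ks ! j \<Longrightarrow> f (j, x \<otimes>\<^bsub>G\<^esub> k) = f (j, x)"
  by (simp add: RL_def)

lemma lt_add: "lt G g (f + f') = lt G g f + lt G g f'"
  by (auto simp: lt_def fun_eq_iff)

lemma kop_add: "kop G n Ts w (f + f') = kop G n Ts w f + kop G n Ts w f'"
  by (auto simp: kop_def fun_eq_iff algebra_simps sum.distrib)

lemma additive_on_kop: "additive_on M (kop G n Ts w)"
  by (simp add: additive_on_def kop_add)

lemma kop_diff: "kop G n Ts w (f - f') = kop G n Ts w f - kop G n Ts w f'"
  using additive_onD(4)[OF additive_on_kop[of UNIV]] by (simp add: add_subgroup_def)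

lemma kop_zsc: "kop G n Ts w (zsc k f) = zsc k (kop G n Ts w f)"
  using zsc_hom[OF additive_on_kop[of UNIV], of f] by (simp add: add_subgroup_def)

context group
begin

lemma inv_cancel [simp]:
  assumes "a \<in> carrier G" "b \<in> carrier G"
  shows "inv a \<otimes> (a \<otimes> b) = b" "a \<otimes> (inv a \<otimes> b) = b"
  using assms by (simp_all add: m_assoc[symmetric])

lemma lt_RL:
  assumes f: "f \<in> RL G Ks" and g: "g \<in> carrier G" and K: "\<forall>K\<in>set Ks. K \<subseteq> carrier G"
  shows "lt G g f \<in> RL G Ks"
proof -
  have "lt G g f (j, x \<otimes> k) = lt G g f (j, x)" if "j < length Ks" "x \<in> carrier G" "k \<in> Ks ! j" for j x k
  proof -
    have "k \<in> carrier G" using K that by (meson nth_mem subsetD)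
    then show ?thesis using that g RL_right[OF f that(1), of "inv g \<otimes> x" k] by (simp add: lt_def m_assoc)
  qed
  then show ?thesis using RL_zero[OF f] g by (auto simp: RL_def lt_def)
qed

lemma lt_one: "f \<in> RL G Ks \<Longrightarrow> lt G \<one> f = f"
  by (auto simp: RL_def lt_def fun_eq_iff)

lemma lt_mult: "g \<in> carrier G \<Longrightarrow> h \<in> carrier G \<Longrightarrow> lt G (g \<otimes> h) f = lt G g (lt G h f)"
  by (auto simp: lt_def fun_eq_iff inv_mult_group m_assoc)

text \<open>Left multiplication by \<open>g\<close> permutes the left cosets, so it permutes
  \<open>T\<close> up to right factors from \<open>K\<close>, which \<open>F\<close> does not
  see.\<close>

lemma transversal_sum:
  assumes "subgroup K G" "transversal G K T" "g \<in> carrier G"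
    and F: "\<And>x k. x \<in> carrier G \<Longrightarrow> k \<in> K \<Longrightarrow> F (x \<otimes> k) = F x"
  shows "(\<Sum>t\<in>T. F (g \<otimes> t)) = sum F T"
proof -
  interpret K: subgroup K G by fact
  have T: "T \<subseteq> carrier G" "finite T" "\<And>x. x \<in> carrier G \<Longrightarrow> \<exists>!t. t \<in> T \<and> inv t \<otimes> x \<in> K"
    using assms(2) by (auto simp: transversal_def)
  define p where "p t = (THE t'. t' \<in> T \<and> inv t' \<otimes> (g \<otimes> t) \<in> K)" for t
  have p: "p t \<in> T" "inv (p t) \<otimes> (g \<otimes> t) \<in> K" if "t \<in> T" for t
  proof -
    have "g \<otimes> t \<in> carrier G" using that T(1) assms(3) by auto
    from theI'[OF T(3)[OF this]] show "p t \<in> T" "inv (p t) \<otimes> (g \<otimes> t) \<in> K" by (auto simp: p_def)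
  qed
  have "inj_on p T"
  proof (rule inj_onI)
    fix t s assume ts: "t \<in> T" "s \<in> T" "p t = p s"
    then have c: "t \<in> carrier G" "s \<in> carrier G" "p s \<in> carrier G" using T(1) p(1) by auto
    have "inv (inv (p s) \<otimes> (g \<otimes> s)) \<otimes> (inv (p s) \<otimes> (g \<otimes> t)) \<in> K"
      using p(2)[OF ts(1)] p(2)[OF ts(2)] ts(3) by simp
    also have "inv (inv (p s) \<otimes> (g \<otimes> s)) \<otimes> (inv (p s) \<otimes> (g \<otimes> t)) = inv s \<otimes> t"
      using c assms(3) by (simp add: inv_mult_group m_assoc)
    finally have "inv s \<otimes> t \<in> K" .
    moreover have "inv t \<otimes> t \<in> K" using c(1) by simp
    ultimately show "t = s" using T(3)[OF c(1)] ts(1,2) by blast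
  qed
  moreover have "p ` T = T"
    using endo_inj_surj[OF T(2)] \<open>inj_on p T\<close> p(1) by blast
  ultimately have bij: "bij_betw p T T" by (simp add: bij_betw_def)
  have "F (g \<otimes> t) = F (p t)" if "t \<in> T" for t
  proof -
    have c: "t \<in> carrier G" "p t \<in> carrier G" using that T(1) p(1) by auto
    have "F (p t \<otimes> (inv (p t) \<otimes> (g \<otimes> t))) = F (p t)" by (rule F) (use c p(2) that in auto)
    then show ?thesis using c assms(3) by (simp add: m_assoc[symmetric])
  qed
  then have "(\<Sum>t\<in>T. F (g \<otimes> t)) = (\<Sum>t\<in>T. F (p t))" by simp
  also have "\<dots> = sum F T" by (rule sum.reindex_bij_betw[OF bij])
  finally show ?thesis .
qed

lemma tsysD:
  assumes "tsys G Ks Ts" "j < length Ks"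
  shows "subgroup (Ks ! j) G" "transversal G (Ks ! j) (Ts ! j)" "t \<in> Ts ! j \<Longrightarrow> t \<in> carrier G"
    "finite (Ts ! j)" "k \<in> Ks ! j \<Longrightarrow> k \<in> carrier G"
  using assms subgroup.subset by (fastforce simp: tsys_def transversal_def)+

lemma tsys_length: "tsys G Ks Ts \<Longrightarrow> length Ts = length Ks"
  by (simp add: tsys_def)

lemma kop_RL:
  assumes "binv G Ks Ls w" "tsys G Ls Ts" "\<forall>K\<in>set Ks. subgroup K G"
  shows "kop G (length Ks) Ts w f \<in> RL G Ks"
proof -
  have "w i j (inv (x \<otimes> k) \<otimes> t) = w i j (inv x \<otimes> t)"
    if "i < length Ks" "x \<in> carrier G" "k \<in> Ks ! i" "j < length Ls" "t \<in> Ts ! j" for i j x k t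
  proof -
    interpret subgroup "Ks ! i" G using assms(3) that(1) by simp
    have "inv (x \<otimes> k) \<otimes> t = inv k \<otimes> (inv x \<otimes> t)"
      using that tsysD(3)[OF assms(2)] by (simp add: inv_mult_group m_assoc)
    then show ?thesis using assms(1) that tsysD(3)[OF assms(2)] by (simp add: binv_def)
  qed
  moreover have "x \<otimes> k \<in> carrier G" if "i < length Ks" "x \<in> carrier G" "k \<in> Ks ! i" for i x k
    using that assms(3) subgroup.mem_carrier[of "Ks ! i" G] by simp
  ultimately show ?thesis using tsys_length[OF assms(2)] by (auto simp: RL_def kop_def)
qed

text \<open>Substitute g t for t in the sum; this is legitimate because both the kernel and
  \<open>f\<close> are right invariant under \<open>Ls ! j\<close>.\<close>

lemma kop_lt:
  assumes "binv G Ks Ls w" "tsys G Ls Ts" "f \<in> RL G Ls" "g \<in> carrier G"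
  shows "kop G (length Ks) Ts w (lt G g f) = lt G g (kop G (length Ks) Ts w f)"
proof (rule ext, clarify)
  fix i x
  show "kop G (length Ks) Ts w (lt G g f) (i, x) = lt G g (kop G (length Ks) Ts w f) (i, x)"
  proof (cases "i < length Ks \<and> x \<in> carrier G")
    case True
    have "(\<Sum>t\<in>Ts ! j. w i j (inv x \<otimes> t) * lt G g f (j, t)) = (\<Sum>t\<in>Ts ! j. w i j (inv (inv g \<otimes> x) \<otimes> t) * f (j, t))"
      if j: "j < length Ls" for j
    proof -
      note T = tsysD[OF assms(2) j]
      define F where "F y = w i j (inv x \<otimes> y) * f (j, inv g \<otimes> y)" for y
      have "(\<Sum>t\<in>Ts ! j. w i j (inv x \<otimes> t) * lt G g f (j, t)) = sum F (Ts ! j)"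
        using T(3) by (intro sum.cong) (auto simp: F_def lt_def)
      also have "\<dots> = (\<Sum>t\<in>Ts ! j. F (g \<otimes> t))"
      proof (rule transversal_sum[symmetric, OF T(1,2) assms(4)])
        fix y k assume "y \<in> carrier G" "k \<in> Ls ! j"
        then have "w i j (inv x \<otimes> y \<otimes> k) = w i j (inv x \<otimes> y)" "f (j, inv g \<otimes> y \<otimes> k) = f (j, inv g \<otimes> y)"
          using assms(1,3,4) True j by (auto simp: binv_def RL_right)
        then show "F (y \<otimes> k) = F y"
          using \<open>y \<in> carrier G\<close> T(5)[OF \<open>k \<in> Ls ! j\<close>] True assms(4) by (simp add: F_def m_assoc)
      qed
      also have "\<dots> = (\<Sum>t\<in>Ts ! j. w i j (inv (inv g \<otimes> x) \<otimes> t) * f (j, t))"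
        using True assms(4) T(3) by (intro sum.cong) (auto simp: F_def inv_mult_group m_assoc)
      finally show ?thesis .
    qed
    then show ?thesis using True assms(4) tsys_length[OF assms(2)] by (simp add: kop_def lt_def)
  qed (use assms(4) in \<open>auto simp: kop_def lt_def\<close>)
qed

text \<open>After the substitution of x t for t only the product \<open>inv x \<otimes> r\<close>
  remains, so the composite is again given by a kernel.\<close>

lemma conv_shift:
  assumes "binv G Ks Ls w" "binv G Ls Ms v" "tsys G Ls Ts" "i < length Ks" "k < length Ms"
    and "x \<in> carrier G" "r \<in> carrier G"
  shows "(\<Sum>j<length Ts. \<Sum>t\<in>Ts ! j. w i j (inv x \<otimes> t) * v j k (inv t \<otimes> r)) = conv G Ts w v i k (inv x \<otimes> r)"
  unfolding conv_def
proof (rule sum.cong[OF refl])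
  fix j assume "j \<in> {..<length Ts}"
  then have j: "j < length Ls" using tsys_length[OF assms(3)] by simp
  note T = tsysD[OF assms(3) j]
  interpret L: subgroup "Ls ! j" G by (rule T(1))
  define F where "F y = w i j (inv x \<otimes> y) * v j k (inv y \<otimes> r)" for y
  have "sum F (Ts ! j) = (\<Sum>t\<in>Ts ! j. F (x \<otimes> t))"
  proof (rule transversal_sum[symmetric, OF T(1,2) assms(6)])
    fix y l assume y: "y \<in> carrier G" "l \<in> Ls ! j"
    have "w i j (inv x \<otimes> y \<otimes> l) = w i j (inv x \<otimes> y)" "v j k (inv l \<otimes> (inv y \<otimes> r)) = v j k (inv y \<otimes> r)"
      using assms y j by (auto simp: binv_def)
    then show "F (y \<otimes> l) = F y"
      using y assms(6,7) by (simp add: F_def m_assoc inv_mult_group)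
  qed
  also have "\<dots> = (\<Sum>t\<in>Ts ! j. w i j t * v j k (inv t \<otimes> (inv x \<otimes> r)))"
    using T(3) assms(6,7) by (intro sum.cong) (auto simp: F_def m_assoc[symmetric] inv_mult_group)
  finally show "(\<Sum>t\<in>Ts ! j. w i j (inv x \<otimes> t) * v j k (inv t \<otimes> r))
      = (\<Sum>t\<in>Ts ! j. w i j t * v j k (inv t \<otimes> (inv x \<otimes> r)))"
    by (simp add: F_def)
qed

lemma sum_swap3:
  "(\<Sum>t\<in>A. \<Sum>k\<in>B. \<Sum>r\<in>C k. h t k r) = (\<Sum>k\<in>B. \<Sum>r\<in>C k. \<Sum>t\<in>A. (h t k r :: 'z::comm_monoid_add))"
  by (subst sum.swap) (rule sum.cong[OF refl], rule sum.swap)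

lemma kop_comp:
  assumes "binv G Ks Ls w" "binv G Ls Ms v" "tsys G Ls Ts" "tsys G Ms Us"
  shows "kop G (length Ks) Ts w (kop G (length Ls) Us v f) = kop G (length Ks) Us (conv G Ts w v) f"
proof (rule ext, clarify)
  fix i x
  note l = tsys_length[OF assms(3)] tsys_length[OF assms(4)]
  show "kop G (length Ks) Ts w (kop G (length Ls) Us v f) (i, x) = kop G (length Ks) Us (conv G Ts w v) f (i, x)"
  proof (cases "i < length Ks \<and> x \<in> carrier G")
    case True
    have "kop G (length Ks) Ts w (kop G (length Ls) Us v f) (i, x)
        = (\<Sum>j<length Ts. \<Sum>t\<in>Ts ! j. \<Sum>k<length Us. \<Sum>r\<in>Us ! k. w i j (inv x \<otimes> t) * v j k (inv t \<otimes> r) * f (k, r))"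
      using True l tsysD(3)[OF assms(3)] by (simp add: kop_def sum_distrib_left mult.assoc)
    also have "\<dots> = (\<Sum>j<length Ts. \<Sum>k<length Us. \<Sum>r\<in>Us ! k. \<Sum>t\<in>Ts ! j. w i j (inv x \<otimes> t) * v j k (inv t \<otimes> r) * f (k, r))"
      by (rule sum.cong[OF refl], rule sum_swap3)
    also have "\<dots> = (\<Sum>k<length Us. \<Sum>r\<in>Us ! k. \<Sum>j<length Ts. \<Sum>t\<in>Ts ! j. w i j (inv x \<otimes> t) * v j k (inv t \<otimes> r) * f (k, r))"
      by (rule sum_swap3)
    also have "\<dots> = (\<Sum>k<length Us. \<Sum>r\<in>Us ! k. conv G Ts w v i k (inv x \<otimes> r) * f (k, r))"
    proof (rule sum.cong[OF refl], rule sum.cong[OF refl])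
      fix k r assume "k \<in> {..<length Us}" "r \<in> Us ! k"
      then have "k < length Ms" "r \<in> carrier G" using l tsysD(3)[OF assms(4)] by auto
      then show "(\<Sum>j<length Ts. \<Sum>t\<in>Ts ! j. w i j (inv x \<otimes> t) * v j k (inv t \<otimes> r) * f (k, r))
          = conv G Ts w v i k (inv x \<otimes> r) * f (k, r)"
        using conv_shift[OF assms(1-3)] True by (simp add: sum_distrib_right[symmetric])
    qed
    finally show ?thesis using True by (simp add: kop_def)
  qed (auto simp: kop_def)
qed

lemma conv_right:
  assumes "binv G Ls Ms v" "tsys G Ls Ts" "k < length Ms" "g \<in> carrier G" "l \<in> Ms ! k" "l \<in> carrier G"
  shows "conv G Ts w v i k (g \<otimes> l) = conv G Ts w v i k g"
  unfolding conv_def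
proof (intro sum.cong refl)
  fix j t assume "j \<in> {..<length Ts}" "t \<in> Ts ! j"
  then have "j < length Ls" "t \<in> carrier G" using tsys_length[OF assms(2)] tsysD(3)[OF assms(2)] by auto
  then show "w i j t * v j k (inv t \<otimes> (g \<otimes> l)) = w i j t * v j k (inv t \<otimes> g)"
    using assms by (simp add: binv_def m_assoc[symmetric])
qed

text \<open>Right invariance propagates an equality of kernels from the representatives to the whole
  group. Through this lemma every identity of equivariant maps becomes a finite check.\<close>

lemma kop_cong_transversal:
  assumes "tsys G Ms Us"
    and "\<And>i k g l. i < n \<Longrightarrow> k < length Ms \<Longrightarrow> g \<in> carrier G \<Longrightarrow> l \<in> Ms ! k \<Longrightarrow> w i k (g \<otimes> l) = w i k g"
    and "\<And>i k g l. i < n \<Longrightarrow> k < length Ms \<Longrightarrow> g \<in> carrier G \<Longrightarrow> l \<in> Ms ! k \<Longrightarrow> v i k (g \<otimes> l) = v i k g"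
    and eq: "\<And>i k g. i < n \<Longrightarrow> k < length Ms \<Longrightarrow> g \<in> Us ! k \<Longrightarrow> w i k g = v i k g"
  shows "kop G n Us w f = kop G n Us v f"
proof -
  have "w i k g = v i k g" if i: "i < n" and k: "k < length Ms" and g: "g \<in> carrier G" for i k g
  proof -
    obtain t where t: "t \<in> Us ! k" "inv t \<otimes> g \<in> Ms ! k"
      using tsysD(2)[OF assms(1) k] g by (auto simp: transversal_def)
    have c: "t \<in> carrier G" using tsysD(3)[OF assms(1) k t(1)] .
    then have "t \<otimes> (inv t \<otimes> g) = g" using g by simp
    then show ?thesis
      using assms(2)[OF i k c t(2)] assms(3)[OF i k c t(2)] eq[OF i k t(1)] by simp
  qed
  then show ?thesis
    using tsysD(3)[OF assms(1)] tsys_length[OF assms(1)] by (auto simp: kop_def fun_eq_iff)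
qed

lemma kop_conv_eq:
  assumes "binv G Ks Ls w" "binv G Ls Ms v" "tsys G Ls Ts" "tsys G Ms Us"
    and "\<And>i k g l. i < length Ks \<Longrightarrow> k < length Ms \<Longrightarrow> g \<in> carrier G \<Longrightarrow> l \<in> Ms ! k \<Longrightarrow> u i k (g \<otimes> l) = u i k g"
    and "\<And>i k g. i < length Ks \<Longrightarrow> k < length Ms \<Longrightarrow> g \<in> Us ! k \<Longrightarrow> conv G Ts w v i k g = u i k g"
  shows "kop G (length Ks) Ts w (kop G (length Ls) Us v f) = kop G (length Ks) Us u f"
  unfolding kop_comp[OF assms(1-4)]
  by (rule kop_cong_transversal[OF assms(4)])
     (use assms(5,6) conv_right[OF assms(2,3)] tsysD(5)[OF assms(4)] in auto)

lemma delta_right: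
  assumes "tsys G Ks Ts" "k < length Ks" "g \<in> carrier G" "l \<in> Ks ! k"
  shows "delta Ks i k (g \<otimes> l) = delta Ks i k g"
proof -
  interpret subgroup "Ks ! k" G by (rule tsysD(1)[OF assms(1,2)])
  have "g \<in> Ks ! k" if "g \<otimes> l \<in> Ks ! k"
  proof -
    have "g \<otimes> l \<otimes> inv l \<in> Ks ! k" using that assms(4) by simp
    then show ?thesis using assms(3,4) by (simp add: m_assoc)
  qed
  then show ?thesis using assms(4) by (auto simp: delta_def)
qed

text \<open>Only the representative of the coset of \<open>x\<close> contributes, and
  \<open>f\<close> has the same value there as at \<open>x\<close>.\<close>

lemma kop_delta:
  assumes "tsys G Ks Ts" "f \<in> RL G Ks"
  shows "kop G (length Ks) Ts (delta Ks) f = f"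
proof (rule ext, clarify)
  fix i x
  show "kop G (length Ks) Ts (delta Ks) f (i, x) = f (i, x)"
  proof (cases "i < length Ks \<and> x \<in> carrier G")
    case True
    then have i: "i < length Ks" and x: "x \<in> carrier G" by auto
    note T = tsysD[OF assms(1) i]
    interpret K: subgroup "Ks ! i" G by (rule T(1))
    have "\<exists>!t. t \<in> Ts ! i \<and> inv t \<otimes> x \<in> Ks ! i"
      using T(2) x by (simp add: transversal_def)
    then obtain t where t': "t \<in> Ts ! i \<and> inv t \<otimes> x \<in> Ks ! i"
        and uniq': "\<forall>s. s \<in> Ts ! i \<and> inv s \<otimes> x \<in> Ks ! i \<longrightarrow> s = t"
      by (rule ex1E)
    have t: "t \<in> Ts ! i" "inv t \<otimes> x \<in> Ks ! i" using t' by auto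
    have uniq: "s = t" if "s \<in> Ts ! i" "inv s \<otimes> x \<in> Ks ! i" for s using uniq' that by simp
    have inv_iff: "inv x \<otimes> s \<in> Ks ! i \<longleftrightarrow> s = t" if "s \<in> Ts ! i" for s
    proof -
      have c: "s \<in> carrier G" using T(3) that by simp
      have e: "inv (inv x \<otimes> s) = inv s \<otimes> x" "inv (inv s \<otimes> x) = inv x \<otimes> s" using c x by (auto simp: inv_mult_group)
      show ?thesis
      proof
        assume "inv x \<otimes> s \<in> Ks ! i"
        from K.m_inv_closed[OF this] show "s = t" using uniq[OF that] e(1) by simp
      next
        assume "s = t"
        then show "inv x \<otimes> s \<in> Ks ! i" using K.m_inv_closed[OF t(2)] e(2) by simp
      qed
    qed
    have "kop G (length Ks) Ts (delta Ks) f (i, x)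
        = (\<Sum>j<length Ks. \<Sum>s\<in>Ts ! j. delta Ks i j (inv x \<otimes> s) * f (j, s))"
      using i x tsys_length[OF assms(1)] by (simp add: kop_def)
    also have "\<dots> = (\<Sum>j<length Ks. if j = i then (\<Sum>s\<in>Ts ! j. of_bool (inv x \<otimes> s \<in> Ks ! j) * f (j, s)) else 0)"
      by (rule sum.cong[OF refl]) (auto simp: delta_def)
    also have "\<dots> = (\<Sum>s\<in>Ts ! i. of_bool (inv x \<otimes> s \<in> Ks ! i) * f (i, s))" using i by simp
    also have "\<dots> = (\<Sum>s\<in>Ts ! i. if s = t then f (i, s) else 0)"
      using inv_iff by (intro sum.cong) auto
    also have "\<dots> = f (i, t)" using t(1) T(4) by simp
    also have "\<dots> = f (i, t \<otimes> (inv t \<otimes> x))"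
      using RL_right[OF assms(2) i T(3)[OF t(1)] t(2)] by simp
    also have "t \<otimes> (inv t \<otimes> x) = x" using T(3)[OF t(1)] x by (simp add: m_assoc[symmetric])
    finally show ?thesis .
  qed (use RL_zero[OF assms(2)] in \<open>auto simp: kop_def\<close>)
qed

text \<open>The values on the representatives can be prescribed freely and determine the function,
  so coset representatives count the rank.\<close>

lemma zbasis_RL:
  assumes "tsys G Ks Ts"
  shows "\<exists>bs. zbasis (RL G Ks) bs \<and> length bs = (\<Sum>j<length Ks. card (Ts ! j))"
proof -
  define S where "S = Sigma {..<length Ks} (\<lambda>j. Ts ! j)"
  have fin: "finite S" using tsysD(4)[OF assms] by (auto simp: S_def)
  have card: "card S = (\<Sum>j<length Ks. card (Ts ! j))"
    unfolding S_def using tsysD(4)[OF assms] by (subst card_SigmaI) auto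
  \<comment> \<open>\<open>E\<close> spreads values on representatives over their cosets, and
    \<open>R\<close> restricts to the representatives again.\<close>
  define E where "E f = (\<lambda>(j, x). if j < length Ks \<and> x \<in> carrier G
      then f (j, THE t. t \<in> Ts ! j \<and> inv t \<otimes> x \<in> Ks ! j) else 0)" for f :: "nat \<times> 'a \<Rightarrow> int"
  define R where "R f = (\<lambda>p. if p \<in> S then f p else 0)" for f :: "nat \<times> 'a \<Rightarrow> int"
  let ?M = "{f :: nat \<times> 'a \<Rightarrow> int. \<forall>x. x \<notin> S \<longrightarrow> f x = 0}"
  have the: "(THE t. t \<in> Ts ! j \<and> inv t \<otimes> x \<in> Ks ! j) = s"
    if "j < length Ks" "x \<in> carrier G" "s \<in> Ts ! j" "inv s \<otimes> x \<in> Ks ! j" for j x s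
    using tsysD(2)[OF assms that(1)] that by (intro the1_equality) (auto simp: transversal_def)
  have ex: "\<exists>s. s \<in> Ts ! j \<and> inv s \<otimes> x \<in> Ks ! j" if "j < length Ks" "x \<in> carrier G" for j x
    using tsysD(2)[OF assms that(1)] that by (auto simp: transversal_def)
  have "bij_betw E ?M (RL G Ks)"
  proof (rule bij_betw_byWitness[of _ R])
    show "\<forall>f\<in>?M. R (E f) = f"
    proof (intro ballI ext)
      fix f :: "nat \<times> 'a \<Rightarrow> int" and p assume f: "f \<in> ?M"
      show "R (E f) p = f p"
      proof (cases "p \<in> S")
        case True
        obtain j t where p: "p = (j, t)" by (cases p)
        have j: "j < length Ks" "t \<in> Ts ! j" using True by (auto simp: p S_def)
        have "inv t \<otimes> t \<in> Ks ! j"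
          using tsysD(3)[OF assms j] subgroup.one_closed[OF tsysD(1)[OF assms j(1)]] by simp
        then show ?thesis using True the[OF j(1) tsysD(3)[OF assms j] j(2)] j tsysD(3)[OF assms j]
          by (simp add: R_def E_def p)
      next
        case False
        then show ?thesis using f by (simp add: R_def del: split_paired_All)
      qed
    qed
    show "\<forall>f\<in>RL G Ks. E (R f) = f"
    proof (intro ballI ext, clarify)
      fix f j x assume f: "f \<in> RL G Ks"
      show "E (R f) (j, x) = f (j, x)"
      proof (cases "j < length Ks \<and> x \<in> carrier G")
        case True
        then obtain s where s: "s \<in> Ts ! j" "inv s \<otimes> x \<in> Ks ! j" using ex by blast
        have sc: "s \<in> carrier G" using tsysD(3)[OF assms _ s(1)] True by simp
        have "E (R f) (j, x) = f (j, s)"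
          using True the[OF _ _ s] s(1) by (simp add: E_def R_def S_def)
        also have "\<dots> = f (j, s \<otimes> (inv s \<otimes> x))" using RL_right[OF f _ sc s(2)] True by simp
        finally show ?thesis using sc True by (simp add: m_assoc[symmetric])
      qed (use RL_zero[OF f] in \<open>auto simp: E_def\<close>)
    qed
    show "E ` ?M \<subseteq> RL G Ks"
    proof (clarsimp simp: RL_def, intro conjI allI impI ballI)
      fix f :: "nat \<times> 'a \<Rightarrow> int" and j x k
      assume a: "j < length Ks" "x \<in> carrier G" "k \<in> Ks ! j"
      obtain s where s: "s \<in> Ts ! j" "inv s \<otimes> x \<in> Ks ! j" using ex a by blast
      have c: "s \<in> carrier G" "k \<in> carrier G" using tsysD(3,5)[OF assms a(1)] s(1) a(3) by auto
      have "inv s \<otimes> (x \<otimes> k) \<in> Ks ! j"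
        using subgroup.m_closed[OF tsysD(1)[OF assms a(1)] s(2) a(3)] c a(2) by (simp add: m_assoc)
      then show "E f (j, x \<otimes> k) = E f (j, x)"
        using the[OF a(1) _ s(1)] s(2) a c by (simp add: E_def)
    qed (auto simp: E_def)
    show "R ` RL G Ks \<subseteq> ?M" by (auto simp: R_def)
  qed
  moreover have "additive_on ?M E" by (auto simp: additive_on_def E_def fun_eq_iff)
  moreover obtain bs :: "(nat \<times> 'a \<Rightarrow> int) list" where "zbasis ?M bs" "length bs = card S"
    using zbasis_supported[OF fin] by blast
  ultimately have "zbasis (RL G Ks) (map E bs)" "length (map E bs) = card S"
    by (auto intro: zbasis_image)
  then show ?thesis using card by metis
qed

end

section \<open>Permutation lattices as lattices of invariant functions\<close>

abbreviation RLat :: "('a,'b) monoid_scheme \<Rightarrow> 'a set list \<Rightarrow> ('a, nat \<times> 'a \<Rightarrow> int) glat" where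
  "RLat G Ks \<equiv> (RL G Ks, lt G)"

context group
begin

lemma is_glat_RLat:
  assumes "finite (carrier G)" "\<forall>K\<in>set Ks. K \<subseteq> carrier G"
  shows "is_glat G (RLat G Ks)"
proof -
  have "\<exists>bs. zbasis (RL G Ks) bs"
    by (rule zbasis_subgroup_exists[of "{..<length Ks} \<times> carrier G"])
       (use assms(1) in \<open>auto simp: add_subgroup_RL RL_zero\<close>)
  then show ?thesis by (auto simp: is_glat_def lt_RL assms(2) lt_add lt_one lt_mult)
qed

lemma glat_ok_RLat: "\<forall>K\<in>set Ks. K \<subseteq> carrier G \<Longrightarrow> glat_ok G (RLat G Ks)"
  by (auto simp: glat_ok_def add_subgroup_RL lt_RL)

lemma l_coset_right:
  assumes "subgroup K G" "x \<in> carrier G" "k \<in> K"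
  shows "(x \<otimes> k) <# K = x <# K"
  using assms by (metis l_repr_independence lcos_self l_coset_def UN_I insertI1)

lemma coset_some:
  assumes "subgroup K G" "C \<in> LCOSETS G K"
  shows "(SOME x. x \<in> C) \<in> C" "(SOME x. x \<in> C) \<in> carrier G" "(SOME x. x \<in> C) <# K = C"
proof -
  obtain a where a: "a \<in> carrier G" "C = a <# K" using assms(2) by (auto simp: LCOSETS_def)
  then have "a \<in> C" using lcos_self[OF a(1) assms(1)] by simp
  then show s: "(SOME x. x \<in> C) \<in> C" by (rule someI)
  then obtain k where k: "k \<in> K" "(SOME x. x \<in> C) = a \<otimes> k" unfolding a(2) by (auto simp: l_coset_def)
  have "k \<in> carrier G" using subgroup.mem_carrier[OF assms(1) k(1)] .
  then show "(SOME x. x \<in> C) \<in> carrier G" using k a(1) by simp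
  show "(SOME x. x \<in> C) <# K = C" unfolding k(2) using l_coset_right[OF assms(1) a(1) k(1)] a(2) by simp
qed

lemma RL_some:
  assumes "f \<in> RL G Ks" "j < length Ks" "subgroup (Ks ! j) G" "x \<in> carrier G"
  shows "f (j, SOME y. y \<in> x <# (Ks ! j)) = f (j, x)"
proof -
  have "x <# (Ks ! j) \<in> LCOSETS G (Ks ! j)" using assms(4) by (auto simp: LCOSETS_def)
  from coset_some(1)[OF assms(3) this]
  obtain k where "k \<in> Ks ! j" "(SOME y. y \<in> x <# (Ks ! j)) = x \<otimes> k" by (auto simp: l_coset_def)
  then show ?thesis using RL_right[OF assms(1,2,4)] by simp
qed

lemma l_coset_LCOSETS: "x \<in> carrier G \<Longrightarrow> x <# K \<in> LCOSETS G K"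
  by (auto simp: LCOSETS_def)

lemma l_coset_mult:
  "g \<in> carrier G \<Longrightarrow> x \<in> carrier G \<Longrightarrow> K \<subseteq> carrier G \<Longrightarrow> g <# (x <# K) = (g \<otimes> x) <# K"
  by (simp add: lcos_m_assoc)

lemma act_LCOSETS: "g \<in> carrier G \<Longrightarrow> K \<subseteq> carrier G \<Longrightarrow> C \<in> LCOSETS G K \<Longrightarrow> g <# C \<in> LCOSETS G K"
  by (auto simp: LCOSETS_def l_coset_mult)

text \<open>A function on cosets is pulled back to the group; conversely an invariant function is
  read at an element picked from each coset.\<close>

lemma perm_sum_RLat:
  assumes "\<forall>H\<in>set Hs. subgroup H G"
  obtains f k where "ghom G (RLat G Hs) (perm_sum G Hs) f" "ghom G (perm_sum G Hs) (RLat G Hs) k"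
    "\<And>x. x \<in> RL G Hs \<Longrightarrow> k (f x) = x" "\<And>y. y \<in> fst (perm_sum G Hs) \<Longrightarrow> f (k y) = y"
proof -
  have sub: "subgroup (Hs ! i) G" "Hs ! i \<subseteq> carrier G" if "i < length Hs" for i
    using assms that subgroup.subset[of "Hs ! i" G] by simp_all
  define f where "f h = (\<lambda>(C, i). if i < length Hs \<and> C \<in> LCOSETS G (Hs ! i) then h (i, SOME x. x \<in> C) else 0)"
    for h :: "nat \<times> 'a \<Rightarrow> int"
  define k where "k h = (\<lambda>(j, x). if j < length Hs \<and> x \<in> carrier G then h (x <# (Hs ! j), j) else 0)"
    for h :: "'a set \<times> nat \<Rightarrow> int"
  have kf: "k (f x) = x" if x: "x \<in> RL G Hs" for x
    using RL_some[OF x] RL_zero[OF x] sub l_coset_LCOSETS by (auto simp: k_def f_def fun_eq_iff)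
  have fk: "f (k y) = y" if y: "y \<in> fst (perm_sum G Hs)" for y
  proof -
    have "(SOME x. x \<in> C) \<in> carrier G \<and> (SOME x. x \<in> C) <# (Hs ! i) = C"
      if "i < length Hs" "C \<in> LCOSETS G (Hs ! i)" for C i
      using coset_some[OF sub(1)[OF that(1)] that(2)] by simp
    then show ?thesis using y by (auto simp: k_def f_def fun_eq_iff perm_sum_def)
  qed
  have k_RL: "k h \<in> RL G Hs" for h
    using sub l_coset_right subgroup.mem_carrier[OF sub(1)] by (auto simp: RL_def k_def)
  have k_act: "k (snd (perm_sum G Hs) g h) = lt G g (k h)" if "g \<in> carrier G" for g h
    using that sub l_coset_LCOSETS by (auto simp: k_def lt_def perm_sum_def fun_eq_iff l_coset_mult)
  have "ghom G (perm_sum G Hs) (RLat G Hs) k"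
    using k_RL k_act by (auto simp: ghom_def) (auto simp: k_def fun_eq_iff)
  moreover have "ghom G (RLat G Hs) (perm_sum G Hs) f"
    unfolding ghom_def fst_conv snd_conv
  proof (intro conjI ballI)
    fix g x assume a: "g \<in> carrier G" "x \<in> RL G Hs"
    have fx: "f x \<in> fst (perm_sum G Hs)" by (auto simp: f_def perm_sum_def)
    have "k (snd (perm_sum G Hs) g (f x)) = lt G g x" using k_act[OF a(1)] kf[OF a(2)] by simp
    moreover have "snd (perm_sum G Hs) g (f x) \<in> fst (perm_sum G Hs)"
      by (auto simp: perm_sum_def)
    ultimately show "f (lt G g x) = snd (perm_sum G Hs) g (f x)" using fk by metis
  qed (auto simp: f_def perm_sum_def fun_eq_iff)
  ultimately show thesis using that kf fk by blast
qed

lemma glat_ok_perm_sum: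
  assumes "\<forall>H\<in>set Hs. subgroup H G"
  shows "glat_ok G (perm_sum G Hs)"
  by (auto simp: glat_ok_def perm_sum_def add_subgroup_def)

lemma coset_RLat:
  assumes K: "subgroup K G"
  shows "glat_iso G (coset_lat G K) (RLat G [K])"
proof -
  note KG = subgroup.subset[OF K]
  define f where "f h = (\<lambda>C. if C \<in> LCOSETS G K then h (0, SOME x. x \<in> C) else 0)"
    for h :: "nat \<times> 'a \<Rightarrow> int"
  define k where "k h = (\<lambda>(j, x). if j = (0::nat) \<and> x \<in> carrier G then h (x <# K) else 0)"
    for h :: "'a set \<Rightarrow> int"
  have kf: "k (f x) = x" if x: "x \<in> RL G [K]" for x
    using RL_some[OF x, of 0] RL_zero[OF x] K l_coset_LCOSETS by (auto simp: k_def f_def fun_eq_iff)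
  have fk: "f (k y) = y" if y: "y \<in> fst (coset_lat G K)" for y
    using y coset_some[OF K] by (auto simp: k_def f_def fun_eq_iff coset_lat_def)
  have k_RL: "k h \<in> RL G [K]" for h
    using l_coset_right[OF K] KG by (auto simp: RL_def k_def)
  have k_act: "k (snd (coset_lat G K) g h) = lt G g (k h)" if "g \<in> carrier G" for g h
    using that KG l_coset_LCOSETS by (auto simp: k_def lt_def coset_lat_def fun_eq_iff l_coset_mult)
  have gk: "ghom G (coset_lat G K) (RLat G [K]) k"
    using k_RL k_act by (auto simp: ghom_def) (auto simp: k_def fun_eq_iff)
  have bij: "bij_betw k (fst (coset_lat G K)) (RL G [K])"
    by (rule bij_betw_byWitness[of _ f]) (use kf fk k_RL in \<open>auto simp: f_def coset_lat_def\<close>)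
  show ?thesis unfolding glat_iso_def using gk bij by auto
qed

lemma glat_ok_coset: "glat_ok G (coset_lat G K)"
  by (auto simp: glat_ok_def coset_lat_def add_subgroup_def)

text \<open>Right translation by \<open>d\<close> commutes with the action from the left and turns
  invariance under the conjugate into invariance under \<open>K\<close>. So a coset lattice depends
  only on the conjugacy class of its subgroup.\<close>

lemma conj_RLat:
  assumes K: "subgroup K G" and d: "d \<in> carrier G" and K': "K' = (\<lambda>k. d \<otimes> k \<otimes> inv d) ` K"
  shows "glat_iso G (RLat G [K']) (RLat G [K])"
proof -
  note KG = subgroup.subset[OF K]
  define m where "m e h = (\<lambda>(j, x). if x \<in> carrier G then h (j, x \<otimes> e) else 0)"
    for e and h :: "nat \<times> 'a \<Rightarrow> int"
  have 1: "m (inv d) h \<in> RL G [K]" if h: "h \<in> RL G [K']" for h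
  proof -
    have "h (0, x \<otimes> k \<otimes> inv d) = h (0, x \<otimes> inv d)" if "x \<in> carrier G" "k \<in> K" for x k
    proof -
      have "k \<in> carrier G" using that KG by auto
      then have "x \<otimes> k \<otimes> inv d = x \<otimes> inv d \<otimes> (d \<otimes> k \<otimes> inv d)"
        using that d by (simp add: m_assoc)
      then show ?thesis using RL_right[OF h, of 0 "x \<otimes> inv d" "d \<otimes> k \<otimes> inv d"] that d K' by simp
    qed
    then show ?thesis using RL_zero[OF h] KG d by (auto simp: RL_def m_def)
  qed
  have 2: "m d h \<in> RL G [K']" if h: "h \<in> RL G [K]" for h
  proof -
    have "h (0, x \<otimes> (d \<otimes> k \<otimes> inv d) \<otimes> d) = h (0, x \<otimes> d)" if "x \<in> carrier G" "k \<in> K" for x k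
    proof -
      have "k \<in> carrier G" using that KG by auto
      then have "x \<otimes> (d \<otimes> k \<otimes> inv d) \<otimes> d = x \<otimes> d \<otimes> k"
        using that d by (simp add: m_assoc)
      then show ?thesis using RL_right[OF h, of 0 "x \<otimes> d" k] that d by simp
    qed
    moreover have "x \<otimes> (d \<otimes> k \<otimes> inv d) \<in> carrier G" if "x \<in> carrier G" "k \<in> K" for x k
      using that d KG by auto
    ultimately show ?thesis using RL_zero[OF h] d by (auto simp: RL_def m_def K')
  qed
  have mm: "m d (m (inv d) h) = h" if h: "h \<in> RL G [K']" for h
    using RL_zero[OF h] d by (auto simp: m_def fun_eq_iff m_assoc)
  have mm': "m (inv d) (m d h) = h" if h: "h \<in> RL G [K]" for h
    using RL_zero[OF h] d by (auto simp: m_def fun_eq_iff m_assoc)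
  have act: "m e (lt G g h) = lt G g (m e h)" if "g \<in> carrier G" "e \<in> carrier G" for e g h
    using that by (auto simp: m_def lt_def fun_eq_iff m_assoc)
  have add: "m e (h + h') = m e h + m e h'" for e h h'
    by (auto simp: m_def fun_eq_iff)
  show ?thesis
    by (rule glat_isoI[of _ _ _ "m (inv d)" "m d"]) (use 1 2 mm mm' act add d in \<open>auto simp: ghom_def\<close>)
qed

lemma append_RLat:
  assumes "\<forall>K\<in>set (Ks @ Ls). K \<subseteq> carrier G"
  shows "glat_iso G (RLat G Ks \<oplus>\<^sub>L RLat G Ls) (RLat G (Ks @ Ls))"
proof -
  define n where "n = length Ks"
  define f where "f p = (\<lambda>(j, x). if j < n then fst p (j, x) else snd p (j - n, x))"
    for p :: "(nat \<times> 'a \<Rightarrow> int) \<times> (nat \<times> 'a \<Rightarrow> int)"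
  define k where "k h = ((\<lambda>(j, x). if j < n then h (j, x) else 0), (\<lambda>(j, x). h (j + n, x)))"
    for h :: "nat \<times> 'a \<Rightarrow> int"
  have 1: "f (a, b) \<in> RL G (Ks @ Ls)" if "a \<in> RL G Ks" "b \<in> RL G Ls" for a b
    using that by (auto simp: RL_def f_def n_def nth_append)
  have 2: "fst (k h) \<in> RL G Ks" "snd (k h) \<in> RL G Ls" if h: "h \<in> RL G (Ks @ Ls)" for h
  proof -
    have r: "h (j, x \<otimes> l) = h (j, x)" if "j < length Ks + length Ls" "x \<in> carrier G" "l \<in> (Ks @ Ls) ! j" for j x l
      using RL_right[OF h, of j x l] that by simp
    show "fst (k h) \<in> RL G Ks"
      using r RL_zero[OF h] by (auto simp: RL_def k_def n_def nth_append)
    have "h (j + n, x \<otimes> l) = h (j + n, x)" if "j < length Ls" "x \<in> carrier G" "l \<in> Ls ! j" for j x l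
      using r[of "j + n" x l] that by (simp add: nth_append n_def)
    then show "snd (k h) \<in> RL G Ls"
      using RL_zero[OF h] by (auto simp: RL_def k_def n_def)
  qed
  have kf: "k (f (a, b)) = (a, b)" if "a \<in> RL G Ks" "b \<in> RL G Ls" for a b
    using RL_zero[OF that(1)] by (auto simp: k_def f_def fun_eq_iff n_def)
  have fk: "f (k h) = h" for h by (auto simp: k_def f_def fun_eq_iff)
  have gf: "ghom G (RLat G Ks \<oplus>\<^sub>L RLat G Ls) (RLat G (Ks @ Ls)) f"
    using 1 by (auto simp: ghom_def dsum_def) (auto simp: f_def lt_def fun_eq_iff)
  have bij: "bij_betw f (fst (RLat G Ks \<oplus>\<^sub>L RLat G Ls)) (RL G (Ks @ Ls))"
  proof (rule bij_betw_byWitness[of _ k])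
    show "k ` RL G (Ks @ Ls) \<subseteq> fst (RLat G Ks \<oplus>\<^sub>L RLat G Ls)"
      using 2 by (simp add: dsum_def image_subset_iff mem_Times_iff)
  qed (use 1 kf fk in \<open>auto simp: dsum_def\<close>)
  show ?thesis unfolding glat_iso_def using gf bij by auto
qed

text \<open>A function invariant under all of G is constant, and translation does not change it.
  This is how the summand Z of R fits into the same format as the others.\<close>

lemma trivial_RLat: "glat_iso G (RLat G [carrier G]) trivial_lat"
proof -
  define f where "f h = h (0, \<one>)" for h :: "nat \<times> 'a \<Rightarrow> int"
  define k where "k c = (\<lambda>(j, x). if j = (0::nat) \<and> x \<in> carrier G then c else 0)" for c :: int
  have c: "h (0, x) = h (0, \<one>)" if "h \<in> RL G [carrier G]" "x \<in> carrier G" for h x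
    using RL_right[OF that(1), of 0 \<one> x] that(2) by simp
  have kf: "k (f h) = h" if h: "h \<in> RL G [carrier G]" for h
  proof (rule ext, clarify)
    fix j x
    show "k (f h) (j, x) = h (j, x)"
      using c[OF h, of x] RL_zero[OF h, of j x] by (cases "j = 0 \<and> x \<in> carrier G") (auto simp: f_def k_def)
  qed
  have f_lt: "f (lt G g h) = f h" if "h \<in> RL G [carrier G]" "g \<in> carrier G" for g h
    using c[OF that(1), of "inv g"] that(2) by (simp add: f_def lt_def)
  have fk: "f (k y) = y" for y by (simp add: f_def k_def)
  have k_lt: "lt G g (k y) = k y" if "g \<in> carrier G" for g y
    using that by (auto simp: k_def lt_def fun_eq_iff)
  have f_add: "f (h + h') = f h + f h'" for h h' by (simp add: f_def)
  have k_add: "k (y + y') = k y + k y'" for y y' by (auto simp: k_def fun_eq_iff)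
  have k_RL: "k y \<in> RL G [carrier G]" for y by (simp add: RL_def k_def)
  show ?thesis
    by (rule glat_isoI[of _ _ _ f k]) (simp_all add: ghom_def trivial_lat_def kf f_lt fk k_lt f_add k_add k_RL)
qed

lemma flabby_RLat:
  assumes "finite (carrier G)" "\<forall>H\<in>set Hs. subgroup H G"
  shows "flabby G (RLat G Hs)"
proof -
  obtain f k where fk: "ghom G (RLat G Hs) (perm_sum G Hs) f" "ghom G (perm_sum G Hs) (RLat G Hs) k"
    "\<And>x. x \<in> RL G Hs \<Longrightarrow> k (f x) = x"
    using perm_sum_RLat[OF assms(2)] by metis
  define \<Omega> where "\<Omega> = {(C, i). i < length Hs \<and> C \<in> LCOSETS G (Hs ! i)}"
  define \<sigma> where "\<sigma> g p = (g <# fst p, snd p)" for g and p :: "'a set \<times> nat"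
  have sub: "Hs ! i \<subseteq> carrier G" "subgroup (Hs ! i) G" if "i < length Hs" for i
    using assms(2) that subgroup.subset[of "Hs ! i" G] by simp_all
  have C_sub: "C \<subseteq> carrier G" if "(C, i) \<in> \<Omega>" for C i
  proof -
    have "i < length Hs" "C \<in> LCOSETS G (Hs ! i)" using that by (auto simp: \<Omega>_def)
    then show ?thesis using lcosets_subset_PowG[OF sub(2)] by blast
  qed
  have "\<Omega> \<subseteq> Pow (carrier G) \<times> {..<length Hs}" using C_sub by (auto simp: \<Omega>_def)
  then have fin: "finite \<Omega>" using assms(1) finite_subset by blast
  have perm: "perm_sum G Hs = ({f. \<forall>x. x \<notin> \<Omega> \<longrightarrow> f x = 0},
      \<lambda>g f x. if x \<in> \<Omega> then f (\<sigma> (inv g) x) else 0)"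
    unfolding perm_sum_def \<Omega>_def \<sigma>_def by (auto simp: fun_eq_iff)
  have "flabby G (perm_sum G Hs)"
    unfolding perm
  proof (rule flabby_permutation[OF is_group assms(1) fin])
    show "\<sigma> g x \<in> \<Omega>" if "g \<in> carrier G" "x \<in> \<Omega>" for g x
      using that act_LCOSETS sub by (auto simp: \<sigma>_def \<Omega>_def)
    show "\<sigma> \<one> x = x" if "x \<in> \<Omega>" for x
      using that C_sub[of "fst x" "snd x"] by (simp add: \<sigma>_def lcos_mult_one)
    show "\<sigma> (g \<otimes> h) x = \<sigma> g (\<sigma> h x)" if "g \<in> carrier G" "h \<in> carrier G" "x \<in> \<Omega>" for g h x
      using that C_sub[of "fst x" "snd x"] by (simp add: \<sigma>_def lcos_m_assoc)
  qed
  then show ?thesis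
    using flabby_retract[OF fk(1,2)] fk(3) glat_ok_RLat glat_ok_perm_sum[OF assms(2)] assms(2)
    by (simp add: subgroup.subset)
qed

end

text \<open>The theorem asks for lattices of functions on \<open>nat\<close>, whereas the
  constructions use \<open>nat \<times> mat\<close> as index type. Indices are relabelled by the
  injection \<open>to_nat\<close>, with value 0 off its range.\<close>

definition tonat :: "('i::countable \<Rightarrow> int) \<Rightarrow> nat \<Rightarrow> int" where
  "tonat f n = (if n \<in> range (to_nat :: 'i \<Rightarrow> nat) then f (from_nat n) else 0)"

definition natlat :: "('g, 'i::countable \<Rightarrow> int) glat \<Rightarrow> ('g, nat \<Rightarrow> int) glat" where
  "natlat L = (tonat ` fst L, \<lambda>g y. tonat (snd L g (\<lambda>i. y (to_nat i))))"

lemma tonat_inverse: "(\<lambda>i. tonat f (to_nat i)) = f"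
  by (auto simp: tonat_def)

lemma ghom_natlat:
  "ghom G L (natlat L) tonat" "ghom G (natlat L) L (\<lambda>y i. y (to_nat i))"
  by (auto simp: ghom_def natlat_def tonat_inverse) (auto simp: tonat_def fun_eq_iff)

lemma natlat_iso: "bij_betw tonat (fst L) (fst (natlat L))"
  by (rule bij_betw_byWitness[of _ "\<lambda>y i. y (to_nat i)"]) (auto simp: natlat_def tonat_inverse)

subsection \<open>Computations over the field with eight elements\<close>

text \<open>In binary the index lists the coefficients of a polynomial in z, where z^3 = z + 1:
  \<open>F2\<close> is z and \<open>F4\<close> is z^2, and addition is bitwise exclusive or.\<close>

datatype gf8 = F0 | F1 | F2 | F3 | F4 | F5 | F6 | F7

instantiation gf8 :: field
begin

definition "zero_gf8 = F0"

definition "one_gf8 = F1"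

fun plus_gf8 :: "gf8 \<Rightarrow> gf8 \<Rightarrow> gf8" where
  "F0 + F0 = F0" | "F0 + F1 = F1" | "F0 + F2 = F2" | "F0 + F3 = F3" | "F0 + F4 = F4" | "F0 + F5 = F5" | "F0 + F6 = F6" | "F0 + F7 = F7"
| "F1 + F0 = F1" | "F1 + F1 = F0" | "F1 + F2 = F3" | "F1 + F3 = F2" | "F1 + F4 = F5" | "F1 + F5 = F4" | "F1 + F6 = F7" | "F1 + F7 = F6"
| "F2 + F0 = F2" | "F2 + F1 = F3" | "F2 + F2 = F0" | "F2 + F3 = F1" | "F2 + F4 = F6" | "F2 + F5 = F7" | "F2 + F6 = F4" | "F2 + F7 = F5"
| "F3 + F0 = F3" | "F3 + F1 = F2" | "F3 + F2 = F1" | "F3 + F3 = F0" | "F3 + F4 = F7" | "F3 + F5 = F6" | "F3 + F6 = F5" | "F3 + F7 = F4"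
| "F4 + F0 = F4" | "F4 + F1 = F5" | "F4 + F2 = F6" | "F4 + F3 = F7" | "F4 + F4 = F0" | "F4 + F5 = F1" | "F4 + F6 = F2" | "F4 + F7 = F3"
| "F5 + F0 = F5" | "F5 + F1 = F4" | "F5 + F2 = F7" | "F5 + F3 = F6" | "F5 + F4 = F1" | "F5 + F5 = F0" | "F5 + F6 = F3" | "F5 + F7 = F2"
| "F6 + F0 = F6" | "F6 + F1 = F7" | "F6 + F2 = F4" | "F6 + F3 = F5" | "F6 + F4 = F2" | "F6 + F5 = F3" | "F6 + F6 = F0" | "F6 + F7 = F1"
| "F7 + F0 = F7" | "F7 + F1 = F6" | "F7 + F2 = F5" | "F7 + F3 = F4" | "F7 + F4 = F3" | "F7 + F5 = F2" | "F7 + F6 = F1" | "F7 + F7 = F0"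

fun times_gf8 :: "gf8 \<Rightarrow> gf8 \<Rightarrow> gf8" where
  "F0 * F0 = F0" | "F0 * F1 = F0" | "F0 * F2 = F0" | "F0 * F3 = F0" | "F0 * F4 = F0" | "F0 * F5 = F0" | "F0 * F6 = F0" | "F0 * F7 = F0"
| "F1 * F0 = F0" | "F1 * F1 = F1" | "F1 * F2 = F2" | "F1 * F3 = F3" | "F1 * F4 = F4" | "F1 * F5 = F5" | "F1 * F6 = F6" | "F1 * F7 = F7"
| "F2 * F0 = F0" | "F2 * F1 = F2" | "F2 * F2 = F4" | "F2 * F3 = F6" | "F2 * F4 = F3" | "F2 * F5 = F1" | "F2 * F6 = F7" | "F2 * F7 = F5"
| "F3 * F0 = F0" | "F3 * F1 = F3" | "F3 * F2 = F6" | "F3 * F3 = F5" | "F3 * F4 = F7" | "F3 * F5 = F4" | "F3 * F6 = F1" | "F3 * F7 = F2"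
| "F4 * F0 = F0" | "F4 * F1 = F4" | "F4 * F2 = F3" | "F4 * F3 = F7" | "F4 * F4 = F6" | "F4 * F5 = F2" | "F4 * F6 = F5" | "F4 * F7 = F1"
| "F5 * F0 = F0" | "F5 * F1 = F5" | "F5 * F2 = F1" | "F5 * F3 = F4" | "F5 * F4 = F2" | "F5 * F5 = F7" | "F5 * F6 = F3" | "F5 * F7 = F6"
| "F6 * F0 = F0" | "F6 * F1 = F6" | "F6 * F2 = F7" | "F6 * F3 = F1" | "F6 * F4 = F5" | "F6 * F5 = F3" | "F6 * F6 = F2" | "F6 * F7 = F4"
| "F7 * F0 = F0" | "F7 * F1 = F7" | "F7 * F2 = F5" | "F7 * F3 = F2" | "F7 * F4 = F1" | "F7 * F5 = F6" | "F7 * F6 = F4" | "F7 * F7 = F3"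

fun inverse_gf8 :: "gf8 \<Rightarrow> gf8" where
  "inverse F0 = F0" | "inverse F1 = F1" | "inverse F2 = F5" | "inverse F3 = F6" | "inverse F4 = F7" | "inverse F5 = F2" | "inverse F6 = F3" | "inverse F7 = F4"

definition "uminus_gf8 (x :: gf8) = x"

definition "minus_gf8 (x :: gf8) y = x + y"

definition "divide_gf8 (x :: gf8) y = x * inverse y"

instance
proof
  fix a b c :: gf8
  show "a + b + c = a + (b + c)" by (cases a; cases b; cases c; simp)
  show "a + b = b + a" by (cases a; cases b; simp)
  show "0 + a = a" by (cases a; simp add: zero_gf8_def)
  show "- a + a = 0" by (cases a; simp add: zero_gf8_def uminus_gf8_def)
  show "a - b = a + - b" by (simp add: uminus_gf8_def minus_gf8_def)
  show "a * b * c = a * (b * c)" by (cases a; cases b; cases c; simp)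
  show "a * b = b * a" by (cases a; cases b; simp)
  show "1 * a = a" by (cases a; simp add: one_gf8_def)
  show "(a + b) * c = a * c + b * c" by (cases a; cases b; cases c; simp)
  show "(0 :: gf8) \<noteq> 1" by (simp add: zero_gf8_def one_gf8_def)
  show "a \<noteq> 0 \<Longrightarrow> inverse a * a = 1" by (cases a; simp add: zero_gf8_def one_gf8_def)
  show "a div b = a * inverse b" by (simp add: divide_gf8_def)
  show "inverse (0 :: gf8) = 0" by (simp add: zero_gf8_def)
qed

end

section \<open>The concrete matrix group: subgroups, transversals and tables\<close>

type_synonym mat = "gf8 mat2"

fun mm :: "mat \<Rightarrow> mat \<Rightarrow> mat" where
  "mm (a, b, c, d) (e, f, g, h) = (a * e + b * g, a * f + b * h, c * e + d * g, c * f + d * h)"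

fun mi :: "mat \<Rightarrow> mat" where
  "mi (a, b, c, d) = (d, b, c, a)"

definition els :: "gf8 list" where "els = [F0, F1, F2, F3, F4, F5, F6, F7]"

definition units :: "gf8 list" where "units = [F1, F2, F3, F4, F5, F6, F7]"

fun row :: "int \<Rightarrow> int \<Rightarrow> int \<Rightarrow> int \<Rightarrow> int \<Rightarrow> int \<Rightarrow> int \<Rightarrow> int \<Rightarrow> gf8 \<Rightarrow> int" where
  "row a b c d e f g h F0 = a" | "row a b c d e f g h F1 = b"
| "row a b c d e f g h F2 = c" | "row a b c d e f g h F3 = d"
| "row a b c d e f g h F4 = e" | "row a b c d e f g h F5 = f"
| "row a b c d e f g h F6 = g" | "row a b c d e f g h F7 = h"

text \<open>The constant coefficient, which flips when 1 is added. It tells apart the two solutions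
  of an equation s^2 + s = q, since they differ by 1.\<close>

fun lowbit :: "gf8 \<Rightarrow> bool" where
  "lowbit F0 = False" | "lowbit F1 = True" | "lowbit F2 = False" | "lowbit F3 = True"
| "lowbit F4 = False" | "lowbit F5 = True" | "lowbit F6 = False" | "lowbit F7 = True"

fun inU :: "mat \<Rightarrow> bool" where "inU (a, b, c, d) \<longleftrightarrow> a = F1 \<and> c = F0"
fun inT :: "mat \<Rightarrow> bool" where "inT (a, b, c, d) \<longleftrightarrow> b = F0 \<and> c = F0"
text \<open>These are the matrices a + b y with y = \<open>(F0, F1, F1, F1)\<close> and y^2 = y + 1.
  They span a field with 64 elements, in which determinant 1 means norm 1.\<close>

fun inC :: "mat \<Rightarrow> bool" where "inC (a, b, c, d) \<longleftrightarrow> b = c \<and> d = a + b"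
fun inB :: "mat \<Rightarrow> bool" where "inB (a, b, c, d) \<longleftrightarrow> c = F0"
fun inS :: "mat \<Rightarrow> bool" where
  "inS (a, b, c, d) \<longleftrightarrow> (a = F0 \<or> a = F1) \<and> (b = F0 \<or> b = F1) \<and> (c = F0 \<or> c = F1) \<and> (d = F0 \<or> d = F1)"

text \<open>Right multiplication by U fixes the first column, so the cosets are the 63 nonzero
  columns (a, c).\<close>

definition TU :: "mat list" where
  "TU = [(a, F0, c, inverse a). a \<leftarrow> units, c \<leftarrow> els] @ [(F0, inverse c, c, F0). c \<leftarrow> units]"
text \<open>The torus scales the two columns, so a coset is an ordered pair of distinct points of
  the projective line. The first column is normalized to (1, x) or (0, 1), which gives 9 * 8 = 72
  pairs.\<close>

definition TT :: "mat list" where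
  "TT = [(F1, s, x, x * s + F1). x \<leftarrow> els, s \<leftarrow> els] @ [(F0, F1, F1, s). s \<leftarrow> els]"
text \<open>The Borel subgroup itself: it meets C only in the identity, and 56 * 9 = 504.\<close>

definition TC :: "mat list" where
  "TC = [(a, b, F0, inverse a). a \<leftarrow> units, b \<leftarrow> els]"
text \<open>The nine points of the projective line, as first columns.\<close>

definition TB :: "mat list" where
  "TB = [(F1, F0, x, F1). x \<leftarrow> els] @ [(F0, F1, F1, F0)]"
definition TG :: "mat list" where "TG = [(F1, F0, F0, F1)]"
text \<open>All 504 = 63 * 8 group elements are visited as a representative times a unipotent
  matrix.\<close>

definition forall_elems :: "(mat \<Rightarrow> bool) \<Rightarrow> bool" where
  "forall_elems P \<longleftrightarrow> list_all (\<lambda>t. list_all (\<lambda>s. P (mm t (F1, s, F0, F1))) els) TU"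

definition TS :: "mat list" where
  "TS = [(F0, F1, F1, F0), (F0, F1, F1, F2), (F0, F1, F1, F4), (F0, F1, F1, F6), (F0, F2, F5, F0),
    (F0, F2, F5, F1), (F0, F2, F5, F2), (F0, F2, F5, F3), (F0, F3, F6, F0), (F0, F3, F6, F1),
    (F0, F3, F6, F2), (F0, F3, F6, F3), (F0, F4, F7, F0), (F0, F4, F7, F1), (F0, F4, F7, F2),
    (F0, F4, F7, F3), (F0, F5, F2, F0), (F0, F5, F2, F1), (F0, F5, F2, F4), (F0, F5, F2, F5),
    (F0, F6, F3, F0), (F0, F6, F3, F1), (F0, F6, F3, F4), (F0, F6, F3, F5), (F0, F7, F4, F0),
    (F0, F7, F4, F1), (F0, F7, F4, F2), (F0, F7, F4, F3), (F1, F2, F0, F1), (F1, F2, F1, F3),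
    (F1, F2, F2, F5), (F1, F2, F3, F7), (F1, F2, F4, F2), (F1, F2, F5, F0), (F1, F2, F6, F6),
    (F1, F2, F7, F4), (F1, F4, F0, F1), (F1, F4, F1, F5), (F1, F4, F2, F2), (F1, F4, F3, F6),
    (F1, F4, F4, F7), (F1, F4, F5, F3), (F1, F4, F6, F4), (F1, F4, F7, F0), (F1, F6, F0, F1),
    (F1, F6, F1, F7), (F1, F6, F2, F6), (F1, F6, F3, F0), (F1, F6, F4, F4), (F1, F6, F5, F2),
    (F1, F6, F6, F3), (F1, F6, F7, F5), (F2, F4, F0, F5), (F2, F4, F1, F7), (F2, F4, F2, F1),
    (F2, F4, F3, F3), (F2, F4, F4, F6), (F2, F4, F5, F4), (F2, F4, F6, F2), (F2, F4, F7, F0),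
    (F2, F5, F0, F5), (F2, F5, F1, F2), (F2, F5, F2, F0), (F2, F5, F3, F7), (F2, F5, F4, F4),
    (F2, F5, F5, F3), (F2, F5, F6, F1), (F2, F5, F7, F6), (F3, F4, F0, F6), (F3, F4, F1, F3),
    (F3, F4, F2, F7), (F3, F4, F3, F2), (F3, F4, F4, F4), (F3, F4, F5, F1), (F3, F4, F6, F5),
    (F3, F4, F7, F0), (F3, F5, F0, F6), (F3, F5, F1, F5), (F3, F5, F2, F0), (F3, F5, F3, F3),
    (F3, F5, F4, F1), (F3, F5, F5, F2), (F3, F5, F6, F7), (F3, F5, F7, F4)]"

text \<open>The integral matrices of the maps were found by computer; each is a bi-invariant function on the
  group, tabulated in coordinates that are invariant on one side. The letters \<open>al\<close>, \<open>ga\<close>, \<open>be\<close>, \<open>io\<close>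
  stand for \<open>\<alpha>\<close>, \<open>\<gamma>\<close>, \<open>\<beta>\<close>, \<open>\<iota>\<close>, and \<open>si\<close>, \<open>ta\<close> for the homotopy \<open>\<iota> \<sigma> + \<tau> \<alpha> = 1071\<close>; the
  capitals name the components, so \<open>alCU\<close> gives \<open>\<int>[G/U] \<rightarrow> \<int>[G/C]\<close>. The functions \<open>y\<^sub>i\<close> are preimages
  under \<open>\<alpha>\<close> of the generators of the kernel of \<open>\<gamma>\<close>.\<close>

definition alCU_tab :: "gf8 \<Rightarrow> int" where "alCU_tab = row 0 0 0 1 1 (-1) 0 0"
text \<open>The argument is the norm of the first column, viewed as an element of the field with 64
  elements. C acts on columns by multiplication with elements of norm 1, and U leaves the first
  column alone.\<close>

fun alCU :: "mat \<Rightarrow> int" where "alCU (a, b, c, d) = alCU_tab (a * a + a * c + c * c)"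
text \<open>The expression is bilinear in the two columns and preserved by C; the torus scales the
  columns by mutually inverse factors.\<close>

fun alCT :: "mat \<Rightarrow> int" where "alCT (a, b, c, d) = of_bool (a * b + b * c + c * d = F3)"
fun alBU :: "mat \<Rightarrow> int" where "alBU (a, b, c, d) = of_bool (c = F0)"
fun alBT :: "mat \<Rightarrow> int" where "alBT (a, b, c, d) = of_bool (d = F0)"
fun alST_tab :: "bool \<Rightarrow> gf8 \<Rightarrow> gf8 \<Rightarrow> int" where
  "alST_tab False F3 = row 0 0 0 0 0 (-1) 0 1"
| "alST_tab False F5 = row 0 0 0 1 0 0 0 (-1)"
| "alST_tab False F7 = row 0 0 0 (-1) 0 1 0 0"
| "alST_tab True F3 = row 0 0 0 0 0 1 0 (-1)"
| "alST_tab True F5 = row 0 0 0 (-1) 0 0 0 1"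
| "alST_tab True F7 = row 0 0 0 1 0 (-1) 0 0"
| "alST_tab _ _ = (\<lambda>_. 0)"
text \<open>Each of ab, cd and ad is invariant under the torus on the right. From (ad)(bc) =
  (ab)(cd) and ad + bc = 1 the first two leave two values for ad, which differ by 1; the low bit
  decides.\<close>

fun alST :: "mat \<Rightarrow> int" where "alST (a, b, c, d) = alST_tab (lowbit (a * d)) (a * b) (c * d)"

fun gaSC_tab :: "bool \<Rightarrow> gf8 \<Rightarrow> gf8 \<Rightarrow> int" where
  "gaSC_tab False F1 = row 0 (-1) 0 (-1) 0 (-1) 0 (-1)"
| "gaSC_tab False F2 = row 0 0 0 0 (-2) (-1) (-1) (-2)"
| "gaSC_tab False F3 = row 0 (-1) 0 (-1) (-1) 0 (-1) 0"
| "gaSC_tab False F4 = row 0 0 0 (-1) 0 0 (-1) 0"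
| "gaSC_tab False F5 = row 0 (-1) (-1) 0 0 (-1) (-1) 0"
| "gaSC_tab False F6 = row 0 0 (-1) (-1) (-1) (-1) 0 0"
| "gaSC_tab False F7 = row 0 (-1) 0 0 (-2) 0 0 (-1)"
| "gaSC_tab True F1 = row 0 (-1) 0 (-1) 0 (-1) 0 (-1)"
| "gaSC_tab True F2 = row 0 0 0 0 0 (-1) (-1) 0"
| "gaSC_tab True F3 = row 0 (-1) 0 (-1) (-1) 0 (-1) 0"
| "gaSC_tab True F4 = row 0 0 (-2) (-1) 0 0 (-1) (-2)"
| "gaSC_tab True F5 = row 0 (-1) (-1) 0 0 (-1) (-1) 0"
| "gaSC_tab True F6 = row 0 0 (-1) (-1) (-1) (-1) 0 0"
| "gaSC_tab True F7 = row 0 (-1) (-2) 0 0 0 0 (-1)"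
| "gaSC_tab _ _ = (\<lambda>_. 0)"
text \<open>C on the right preserves the norms of both rows and s = bd + ac + bc. The product of the
  norms is s^2 + s + 1, so they determine s up to adding 1, and one bit settles the rest.\<close>

fun gaSC :: "mat \<Rightarrow> int" where "gaSC (a, b, c, d) = gaSC_tab (lowbit (b * d + a * c + b * c)) (a * a + a * b + b * b) (c * c + c * d + d * d)"
fun gaSS_tab :: "gf8 \<Rightarrow> gf8 \<Rightarrow> gf8 \<Rightarrow> int" where
  "gaSS_tab F0 F1 = row 0 0 1 1 (-1) (-1) (-1) (-1)"
| "gaSS_tab F0 F7 = row 0 1 1 0 0 1 1 0"
| "gaSS_tab F1 F0 = row 0 0 1 1 (-1) (-1) (-1) (-1)"
| "gaSS_tab F1 F1 = row 0 0 1 1 (-1) (-1) (-1) (-1)"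
| "gaSS_tab F1 F2 = row 1 1 0 0 0 0 0 0"
| "gaSS_tab F1 F3 = row 1 1 0 0 0 0 0 0"
| "gaSS_tab F1 F4 = row (-1) (-1) 0 0 0 0 1 1"
| "gaSS_tab F1 F5 = row (-1) (-1) 0 0 0 0 1 1"
| "gaSS_tab F1 F6 = row (-1) (-1) 0 0 0 0 0 0"
| "gaSS_tab F1 F7 = row (-1) (-1) 0 0 0 0 0 0"
| "gaSS_tab F2 F1 = row 0 1 0 1 0 0 0 0"
| "gaSS_tab F2 F3 = row 0 1 0 1 0 0 0 0"
| "gaSS_tab F2 F4 = row 0 0 0 0 1 1 1 1"
| "gaSS_tab F2 F6 = row 0 0 0 0 1 1 1 1"
| "gaSS_tab F3 F1 = row 0 1 1 0 0 0 0 0"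
| "gaSS_tab F3 F2 = row 0 1 1 0 0 0 0 0"
| "gaSS_tab F4 F1 = row 1 (-1) 0 0 1 (-1) 0 0"
| "gaSS_tab F4 F2 = row 1 0 1 0 1 0 1 0"
| "gaSS_tab F4 F5 = row 1 (-1) 0 0 1 (-1) 0 0"
| "gaSS_tab F4 F6 = row 1 0 1 0 1 0 1 0"
| "gaSS_tab F5 F1 = row 0 (-1) 1 0 (-1) 0 0 1"
| "gaSS_tab F5 F4 = row 0 (-1) 1 0 (-1) 0 0 1"
| "gaSS_tab F6 F1 = row 0 (-1) 0 0 0 0 0 (-1)"
| "gaSS_tab F6 F2 = row 0 1 1 0 1 0 0 1"
| "gaSS_tab F6 F4 = row 0 1 1 0 1 0 0 1"
| "gaSS_tab F6 F7 = row 0 (-1) 0 0 0 0 0 (-1)"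
| "gaSS_tab F7 F0 = row 0 1 1 0 0 1 1 0"
| "gaSS_tab F7 F1 = row 0 (-1) 0 0 0 0 (-1) 0"
| "gaSS_tab F7 F6 = row 0 (-1) 0 0 0 0 (-1) 0"
| "gaSS_tab F7 F7 = row 0 1 1 0 0 1 1 0"
| "gaSS_tab _ _ = (\<lambda>_. 0)"
text \<open>Here the table lists the matrix itself: for nonzero a the entries a, b, c determine d,
  and for a = 0 the entry b determines c.\<close>

fun gaSS :: "mat \<Rightarrow> int" where "gaSS (a, b, c, d) = gaSS_tab a b (if a = F0 then d else c)"
fun beCS_tab :: "bool \<Rightarrow> gf8 \<Rightarrow> gf8 \<Rightarrow> int" where
  "beCS_tab False F1 = row 0 (-1) 0 (-1) 0 0 0 0"
| "beCS_tab False F2 = row 0 0 0 0 (-1) 0 0 (-1)"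
| "beCS_tab False F3 = row 0 (-1) 0 (-1) 0 0 (-1) 0"
| "beCS_tab False F4 = row 0 0 0 (-1) 0 0 (-1) 0"
| "beCS_tab False F7 = row 0 0 0 0 (-1) 0 0 0"
| "beCS_tab True F1 = row 0 (-1) 0 (-1) 0 0 0 0"
| "beCS_tab True F3 = row 0 (-1) 0 (-1) (-1) 0 0 0"
| "beCS_tab True F4 = row 0 0 (-1) 0 0 0 0 (-1)"
| "beCS_tab True F6 = row 0 0 0 (-1) (-1) 0 0 0"
| "beCS_tab True F7 = row 0 0 (-1) 0 0 0 0 0"
| "beCS_tab _ _ = (\<lambda>_. 0)"
text \<open>The arguments are those of \<open>gaSC\<close> at the inverse matrix, which exchanges
  invariance on the right for invariance on the left.\<close>

fun beCS :: "mat \<Rightarrow> int" where "beCS (a, b, c, d) = beCS_tab (lowbit (b * a + d * c + b * c)) (d * d + d * b + b * b) (c * c + c * a + a * a)"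
text \<open>B on the left only scales the bottom row. The condition says that this row is a point of
  the projective line over the field with two elements, and SL_2(2) preserves these three
  points.\<close>

fun beBS :: "mat \<Rightarrow> int" where "beBS (a, b, c, d) = (if c = F0 \<or> d = F0 \<or> c = d then -1 else 0)"
fun beSS_tab :: "gf8 \<Rightarrow> gf8 \<Rightarrow> gf8 \<Rightarrow> int" where
  "beSS_tab F0 F1 = row (-3) (-3) 0 0 0 0 0 0"
| "beSS_tab F0 F2 = row 1 1 1 1 1 1 1 1"
| "beSS_tab F0 F3 = row 1 0 0 1 0 1 1 0"
| "beSS_tab F0 F4 = row 0 (-1) (-1) 0 0 (-1) (-1) 0"
| "beSS_tab F0 F5 = row 1 1 1 1 1 1 1 1"
| "beSS_tab F0 F6 = row 1 (-1) (-1) 1 (-1) 1 1 (-1)"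
| "beSS_tab F1 F0 = row (-3) (-3) 0 0 0 0 0 0"
| "beSS_tab F1 F1 = row (-3) (-3) 0 0 0 0 0 0"
| "beSS_tab F1 F2 = row 0 0 1 1 1 1 (-1) (-1)"
| "beSS_tab F1 F3 = row 0 0 1 1 1 1 (-1) (-1)"
| "beSS_tab F1 F4 = row 0 0 1 1 0 0 0 0"
| "beSS_tab F1 F5 = row 0 0 1 1 0 0 0 0"
| "beSS_tab F1 F6 = row 0 0 0 0 (-1) (-1) 0 0"
| "beSS_tab F1 F7 = row 0 0 0 0 (-1) (-1) 0 0"
| "beSS_tab F2 F0 = row 1 1 1 1 1 1 1 1"
| "beSS_tab F2 F1 = row 1 0 1 0 (-1) 1 (-1) 1"
| "beSS_tab F2 F2 = row 1 1 1 1 1 1 1 1"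
| "beSS_tab F2 F3 = row 1 0 1 0 (-1) 1 (-1) 1"
| "beSS_tab F2 F4 = row 1 0 1 0 1 0 1 0"
| "beSS_tab F2 F5 = row 1 1 1 1 (-1) 0 (-1) 0"
| "beSS_tab F2 F6 = row 1 0 1 0 1 0 1 0"
| "beSS_tab F2 F7 = row 1 1 1 1 (-1) 0 (-1) 0"
| "beSS_tab F3 F0 = row 1 0 0 1 0 1 1 0"
| "beSS_tab F3 F1 = row (-1) 0 0 (-1) 1 1 1 1"
| "beSS_tab F3 F2 = row (-1) 0 0 (-1) 1 1 1 1"
| "beSS_tab F3 F3 = row 1 0 0 1 0 1 1 0"
| "beSS_tab F3 F4 = row (-1) 1 1 (-1) 0 0 0 0"
| "beSS_tab F3 F5 = row 1 1 1 1 0 0 0 0"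
| "beSS_tab F3 F6 = row 1 1 1 1 0 0 0 0"
| "beSS_tab F3 F7 = row (-1) 1 1 (-1) 0 0 0 0"
| "beSS_tab F4 F0 = row 0 (-1) (-1) 0 0 (-1) (-1) 0"
| "beSS_tab F4 F1 = row 0 0 1 0 0 0 1 0"
| "beSS_tab F4 F2 = row 0 1 1 0 0 1 1 0"
| "beSS_tab F4 F3 = row 0 0 (-1) 1 0 0 (-1) 1"
| "beSS_tab F4 F4 = row 0 (-1) (-1) 0 0 (-1) (-1) 0"
| "beSS_tab F4 F5 = row 0 0 1 0 0 0 1 0"
| "beSS_tab F4 F6 = row 0 1 1 0 0 1 1 0"
| "beSS_tab F4 F7 = row 0 0 (-1) 1 0 0 (-1) 1"
| "beSS_tab F5 F0 = row 1 1 1 1 1 1 1 1"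
| "beSS_tab F5 F1 = row 1 0 0 0 0 1 0 0"
| "beSS_tab F5 F2 = row 1 (-1) 1 0 (-1) 1 0 1"
| "beSS_tab F5 F3 = row 1 0 0 1 0 1 1 0"
| "beSS_tab F5 F4 = row 1 0 0 0 0 1 0 0"
| "beSS_tab F5 F5 = row 1 1 1 1 1 1 1 1"
| "beSS_tab F5 F6 = row 1 0 0 1 0 1 1 0"
| "beSS_tab F5 F7 = row 1 (-1) 1 0 (-1) 1 0 1"
| "beSS_tab F6 F0 = row 1 (-1) (-1) 1 (-1) 1 1 (-1)"
| "beSS_tab F6 F1 = row 0 0 (-1) 0 (-1) 0 0 0"
| "beSS_tab F6 F2 = row 0 0 1 1 1 1 0 0"
| "beSS_tab F6 F3 = row 1 0 1 0 1 0 1 0"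
| "beSS_tab F6 F4 = row 0 0 1 1 1 1 0 0"
| "beSS_tab F6 F5 = row 1 0 1 0 1 0 1 0"
| "beSS_tab F6 F6 = row 1 (-1) (-1) 1 (-1) 1 1 (-1)"
| "beSS_tab F6 F7 = row 0 0 (-1) 0 (-1) 0 0 0"
| "beSS_tab F7 F1 = row (-1) 0 0 0 0 0 0 (-1)"
| "beSS_tab F7 F2 = row (-1) 0 1 1 1 1 0 (-1)"
| "beSS_tab F7 F3 = row 0 (-1) 1 0 0 1 (-1) 0"
| "beSS_tab F7 F4 = row 0 (-1) 1 0 0 1 (-1) 0"
| "beSS_tab F7 F5 = row (-1) 0 1 1 1 1 0 (-1)"
| "beSS_tab F7 F6 = row (-1) 0 0 0 0 0 0 (-1)"
| "beSS_tab _ _ = (\<lambda>_. 0)"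
fun beSS :: "mat \<Rightarrow> int" where "beSS (a, b, c, d) = beSS_tab a b (if a = F0 then d else c)"

text \<open>The coset of 1 minus the coset of the diagonal matrix with entries z and 1/z. The first
  component of \<open>\<iota> \<psi>\<close> is thus the difference of \<open>\<psi>\<close> and its
  right translate by that matrix.\<close>

fun ioU :: "mat \<Rightarrow> int" where "ioU (a, b, c, d) = of_bool (a = F1 \<and> c = F0) - of_bool (a = F2 \<and> c = F0)"
text \<open>The torus on the left preserves the product ac. Seven cosets of U satisfy ac = 1 and
  seven satisfy c = 0, so the total weight is 0 and constants are killed.\<close>

fun ioT :: "mat \<Rightarrow> int" where "ioT (a, b, c, d) = of_bool (a * c = F1) - of_bool (c = F0)"
definition siUU1 :: "gf8 \<Rightarrow> int" where "siUU1 = row 0 130 9 (-1) 48 (-124) (-50) (-3)"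
definition siUU2 :: "gf8 \<Rightarrow> int" where "siUU2 = row 0 (-76) 48 16 108 (-160) 80 (-28)"
fun siUU :: "mat \<Rightarrow> int" where "siUU (a, b, c, d) = (if c = F0 then siUU1 a else siUU2 c)"
definition siUT1 :: "gf8 \<Rightarrow> int" where "siUT1 = row 0 85 (-11) (-22) (-2) (-11) (-23) (-2)"
fun siUT :: "mat \<Rightarrow> int" where "siUT (a, b, c, d) = (if c = F0 then (-15) else if d = F0 then 2 else siUT1 (c * d))"
definition taUC_tab :: "gf8 \<Rightarrow> int" where "taUC_tab = row 0 0 (-74) 67 68 47 (-75) 2"
fun taUC :: "mat \<Rightarrow> int" where "taUC (a, b, c, d) = taUC_tab (c * c + c * d + d * d)"
fun taUB1 :: "mat \<Rightarrow> int" where "taUB1 (a, b, c, d) = (if c = F0 then 113 else (-40))"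
definition taTC_tab :: "gf8 \<Rightarrow> int" where "taTC_tab = row 28 (-56) (-82) 37 44 58 12 (-16)"
fun taTC :: "mat \<Rightarrow> int" where "taTC (a, b, c, d) = taTC_tab (b * d + a * c + b * c)"
fun taTB1 :: "mat \<Rightarrow> int" where "taTB1 (a, b, c, d) = (if c = F0 then (-4) else if a = F0 then (-25) else (-28))"
fun taTB2 :: "mat \<Rightarrow> int" where "taTB2 (a, b, c, d) = (if c = F0 then (-7) else if a = F0 then 112 else (-24))"

fun y0U_tab :: "gf8 \<Rightarrow> gf8 \<Rightarrow> int" where
  "y0U_tab F0 = row 0 (-2) (-3) (-3) (-2) (-3) (-2) (-2)"
| "y0U_tab F1 = row (-3) (-2) (-2) (-2) (-2) (-2) (-2) (-1)"
| "y0U_tab F2 = row (-2) (-3) (-2) (-3) (-3) (-3) (-3) (-3)"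
| "y0U_tab F3 = row (-3) (-3) (-2) (-2) (-3) (-3) (-2) (-3)"
| "y0U_tab F4 = row (-2) (-3) (-2) (-2) (-3) (-2) (-2) (-2)"
| "y0U_tab F5 = row (-2) (-2) (-2) (-3) (-2) (-3) (-3) (-3)"
| "y0U_tab F6 = row (-2) (-2) (-2) (-2) (-2) (-3) (-3) (-3)"
| "y0U_tab F7 = row (-3) (-2) (-3) (-3) (-2) (-3) (-2) (-2)"
fun y0U :: "mat \<Rightarrow> int" where "y0U (a, b, c, d) = y0U_tab a c"
fun y0T_tab :: "bool \<Rightarrow> gf8 \<Rightarrow> gf8 \<Rightarrow> int" where
  "y0T_tab False F0 = row 3 2 1 4 3 2 3 4"
| "y0T_tab False F1 = row 2 0 4 0 5 0 2 0"
| "y0T_tab False F2 = row 2 4 2 4 0 0 0 0"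
| "y0T_tab False F3 = row 4 0 3 0 0 2 0 2"
| "y0T_tab False F4 = row 4 3 0 0 3 3 0 0"
| "y0T_tab False F5 = row 2 0 0 3 2 0 0 3"
| "y0T_tab False F6 = row 2 1 0 0 0 0 3 4"
| "y0T_tab False F7 = row 4 0 0 2 0 3 3 0"
| "y0T_tab True F0 = row 4 1 3 2 1 4 5 3"
| "y0T_tab True F1 = row 2 0 2 0 3 0 4 0"
| "y0T_tab True F2 = row 4 2 3 2 0 0 0 0"
| "y0T_tab True F3 = row 2 0 2 0 0 3 0 3"
| "y0T_tab True F4 = row 2 1 0 0 5 4 0 0"
| "y0T_tab True F5 = row 4 0 0 4 4 0 0 3"
| "y0T_tab True F6 = row 4 3 0 0 0 0 2 2"
| "y0T_tab True F7 = row 3 0 0 3 0 3 2 0"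
fun y0T :: "mat \<Rightarrow> int" where "y0T (a, b, c, d) = y0T_tab (lowbit (a * d)) (a * b) (c * d)"
definition y1U_tab1 :: "gf8 \<Rightarrow> int" where "y1U_tab1 = row 0 19 20 20 19 20 19 20"
definition y1U_tab2 :: "gf8 \<Rightarrow> int" where "y1U_tab2 = row 0 19 19 19 20 20 20 19"
fun y1U :: "mat \<Rightarrow> int" where "y1U (a, b, c, d) = (if c = F0 then y1U_tab1 a else y1U_tab2 c)"
definition y1T_tab :: "gf8 \<Rightarrow> int" where "y1T_tab = row (-23) (-24) (-23) (-23) (-23) (-22) (-24) (-22)"
fun y1T :: "mat \<Rightarrow> int" where "y1T (a, b, c, d) = y1T_tab (c * d)"
fun y2T :: "mat \<Rightarrow> int" where "y2T (a, b, c, d) = (if c = F0 then -21 else -20)"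
fun y3U_tab :: "gf8 \<Rightarrow> gf8 \<Rightarrow> int" where
  "y3U_tab F0 = row 0 0 0 0 0 0 0 1"
| "y3U_tab F1 = row 0 0 0 0 1 1 0 0"
| "y3U_tab F2 = row 0 0 0 0 1 (-1) 1 (-1)"
| "y3U_tab F3 = row 0 0 0 0 0 0 0 0"
| "y3U_tab F4 = row 0 1 1 0 0 1 1 0"
| "y3U_tab F5 = row 0 1 (-1) 0 1 0 0 (-1)"
| "y3U_tab F6 = row 0 0 1 0 1 0 0 0"
| "y3U_tab F7 = row 1 0 (-1) 0 0 (-1) 0 1"
fun y3U :: "mat \<Rightarrow> int" where "y3U (a, b, c, d) = y3U_tab a c"
fun y3T_tab :: "bool \<Rightarrow> gf8 \<Rightarrow> gf8 \<Rightarrow> int" where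
  "y3T_tab False F0 = row (-1) (-1) 0 0 0 0 (-1) (-1)"
| "y3T_tab False F1 = row (-1) 0 1 0 (-1) 0 1 0"
| "y3T_tab False F2 = row (-1) 1 1 (-1) 0 0 0 0"
| "y3T_tab False F3 = row (-1) 0 0 0 0 (-1) 0 0"
| "y3T_tab False F4 = row 1 (-1) 0 0 (-1) 1 0 0"
| "y3T_tab False F5 = row 1 0 0 0 0 0 0 (-1)"
| "y3T_tab False F6 = row 0 1 0 0 0 0 1 0"
| "y3T_tab False F7 = row 0 0 0 (-1) 0 0 (-1) 0"
| "y3T_tab True F0 = row (-1) (-1) (-1) (-1) 1 1 0 0"
| "y3T_tab True F1 = row (-1) 0 1 0 (-1) 0 1 0"
| "y3T_tab True F2 = row 0 1 1 0 0 0 0 0"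
| "y3T_tab True F3 = row 0 0 (-1) 0 0 0 0 (-1)"
| "y3T_tab True F4 = row 0 (-1) 0 0 (-1) 0 0 0"
| "y3T_tab True F5 = row 0 0 0 (-1) 1 0 0 0"
| "y3T_tab True F6 = row (-1) 1 0 0 0 0 1 (-1)"
| "y3T_tab True F7 = row (-1) 0 0 0 0 (-1) 0 0"
fun y3T :: "mat \<Rightarrow> int" where "y3T (a, b, c, d) = y3T_tab (lowbit (a * d)) (a * b) (c * d)"
text \<open>\<open>ceU\<close> and \<open>ceT\<close> define a map from P to Z[G] that recovers
  \<open>\<psi> (x w) - \<psi> (x)\<close> from \<open>\<iota> \<psi>\<close>, where w is the Weyl
  element \<open>(F0, F1, F1, F0)\<close>.\<close>

fun ceU_tab :: "gf8 \<Rightarrow> gf8 \<Rightarrow> int" where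
  "ceU_tab F2 = row 0 0 0 0 0 0 0 1"
| "ceU_tab F3 = row 0 1 0 0 (-1) 1 1 (-1)"
| "ceU_tab F4 = row 0 0 0 1 0 1 0 0"
| "ceU_tab F6 = row 0 1 1 (-1) 0 0 0 1"
| "ceU_tab F7 = row 0 0 0 1 1 0 (-1) 0"
| "ceU_tab _ = (\<lambda>_. 0)"
fun ceU :: "mat \<Rightarrow> int" where "ceU (a, b, c, d) = ceU_tab a c"
fun ceT :: "mat \<Rightarrow> int" where
  "ceT (a, b, c, d) = of_bool (a * b = F1 \<and> c * d = F0 \<and> \<not> lowbit (a * d)) - of_bool (a * b = F0 \<and> c * d = F1 \<and> lowbit (a * d))"

definition cst :: "int \<Rightarrow> mat \<Rightarrow> int" where "cst k g = k"

text \<open>The contribution of one middle summand to \<open>conv\<close>, as a sum over a list so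
  that it can be evaluated.\<close>

definition cv :: "mat list \<Rightarrow> (mat \<Rightarrow> int) \<Rightarrow> (mat \<Rightarrow> int) \<Rightarrow> mat \<Rightarrow> int" where
  "cv T v w g = (\<Sum>t\<leftarrow>T. v t * w (mm (mi t) g))"

text \<open>Counts the representatives that lie in the coset of \<open>x\<close>; the value 1 at
  every \<open>x\<close> is the transversal property.\<close>

definition tr1 :: "(mat \<Rightarrow> bool) \<Rightarrow> mat list \<Rightarrow> mat \<Rightarrow> int" where
  "tr1 K T x = (\<Sum>t\<leftarrow>T. of_bool (K (mm (mi t) x)))"
definition linv :: "mat list \<Rightarrow> (mat \<Rightarrow> int) \<Rightarrow> bool" where
  "linv K w \<longleftrightarrow> forall_elems (\<lambda>g. list_all (\<lambda>k. w (mm k g) = w g) K)"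
definition rinv :: "mat list \<Rightarrow> (mat \<Rightarrow> int) \<Rightarrow> bool" where
  "rinv K w \<longleftrightarrow> forall_elems (\<lambda>g. list_all (\<lambda>k. w (mm g k) = w g) K)"
definition KU :: "mat list" where "KU = [(F1, s, F0, F1). s \<leftarrow> els]"
definition KT :: "mat list" where "KT = [(a, F0, F0, inverse a). a \<leftarrow> units]"
definition KC :: "mat list" where
  "KC = [(F1, F0, F0, F1), (F0, F1, F1, F1), (F1, F1, F1, F0),
    (F2, F4, F4, F6), (F4, F6, F6, F2), (F6, F2, F2, F4), (F2, F6, F6, F4), (F4, F2, F2, F6), (F6, F4, F4, F2)]"
definition KB :: "mat list" where "KB = [(a, s, F0, inverse a). a \<leftarrow> units, s \<leftarrow> els]"
definition KS :: "mat list" where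
  "KS = [(F1, F0, F0, F1), (F0, F1, F1, F1), (F1, F1, F1, F0), (F0, F1, F1, F0), (F1, F1, F0, F1), (F1, F0, F1, F1)]"
text \<open>Value at \<open>r\<close> of the operator with kernel \<open>w\<close> applied to
  \<open>f\<close>, for one summand of the source.\<close>

definition ap :: "mat list \<Rightarrow> (mat \<Rightarrow> int) \<Rightarrow> (mat \<Rightarrow> int) \<Rightarrow> mat \<Rightarrow> int" where
  "ap T w f r = (\<Sum>t\<leftarrow>T. w (mm (mi r) t) * f t)"

section \<open>Finite verifications by evaluation\<close>

lemma transversal_checks:
  "forall_elems (\<lambda>x. tr1 inU TU x = 1)" "forall_elems (\<lambda>x. tr1 inT TT x = 1)"
  "forall_elems (\<lambda>x. tr1 inC TC x = 1)" "forall_elems (\<lambda>x. tr1 inB TB x = 1)"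
  "forall_elems (\<lambda>x. tr1 inS TS x = 1)"
  by code_simp+

lemma transversal_distinct: "distinct TU" "distinct TT" "distinct TC" "distinct TB" "distinct TS"
  by code_simp+

definition inSL :: "mat \<Rightarrow> bool" where
  "inSL x \<longleftrightarrow> (case x of (a, b, c, d) \<Rightarrow> a * d + b * c = F1)"

lemma transversal_carrier:
  "list_all inSL TU" "list_all inSL TT" "list_all inSL TC" "list_all inSL TB" "list_all inSL TS"
  by code_simp+

text \<open>The entries of the matrix product \<open>\<gamma> \<alpha>\<close>, first the row of
  Z[G/S], then that of Z. Terms in which the entry of \<open>\<alpha>\<close> is zero are left
  out.\<close>

lemma gamma_alpha_checks:
  "list_all (\<lambda>g. cv TC gaSC alCU g + cv TB (cst 8) alBU g = 0) TU"
  "list_all (\<lambda>g. cv TC gaSC alCT g + cv TB (cst 7) alBT g + cv TS gaSS alST g = 0) TT"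
  "list_all (\<lambda>g. cv TC (cst 17) alCU g + cv TB (cst (-136)) alBU g = 0) TU"
  "list_all (\<lambda>g. cv TC (cst 17) alCT g + cv TB (cst (-119)) alBT g + cv TS (cst (-1)) alST g = 0) TT"
  by code_simp+

lemma gamma_beta_checks:
  "list_all (\<lambda>g. cv TC gaSC beCS g + cv TB (cst 7) beBS g + cv TS gaSS beSS g = of_bool (inS g)) TS"
  "list_all (\<lambda>g. cv TC gaSC (cst (-2)) g + cv TB (cst 8) (cst 1) g + cv TB (cst 7) (cst (-3)) g + cv TS gaSS (cst 1) g = 0) TG"
  "list_all (\<lambda>g. cv TC (cst 17) beCS g + cv TB (cst (-119)) beBS g + cv TS (cst (-1)) beSS g = 0) TS"
  "list_all (\<lambda>g. cv TC (cst 17) (cst (-2)) g + cv TB (cst (-136)) (cst 1) g + cv TB (cst (-119)) (cst (-3)) g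
     + cv TS (cst (-1)) (cst 1) g = 1) TG"
  by code_simp+

lemma alpha_iota_checks:
  "list_all (\<lambda>g. cv TU alCU ioU g + cv TT alCT ioT g = 0) TU"
  "list_all (\<lambda>g. cv TU alBU ioU g = 0) TU"
  "list_all (\<lambda>g. cv TT alBT ioT g = 0) TU"
  "list_all (\<lambda>g. cv TT alST ioT g = 0) TU"
  by code_simp+

text \<open>No sum over \<open>TS\<close> occurs since the components of \<open>\<tau>\<close> on
  Z[G/S] are zero.\<close>

lemma homotopy_checks:
  "list_all (\<lambda>g. cv TU ioU siUU g + (cv TC taUC alCU g + cv TB taUB1 alBU g) = 1071 * of_bool (inU g)) TU"
  "list_all (\<lambda>g. cv TU ioU siUT g + (cv TC taUC alCT g + cv TB (cst (-35)) alBT g) = 0) TT"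
  "list_all (\<lambda>g. cv TU ioT siUU g + (cv TC taTC alCU g + cv TB taTB1 alBU g) = 0) TU"
  "list_all (\<lambda>g. cv TU ioT siUT g + (cv TC taTC alCT g + cv TB taTB2 alBT g) = 1071 * of_bool (inT g)) TT"
  by code_simp+

lemma generation_check:
  "list_all (\<lambda>g. cv TU ceU ioU g + cv TT ceT ioT g = of_bool (inU (mm (F0, F1, F1, F0) g)) - of_bool (inU g)) TU"
  by code_simp

text \<open>The coordinates of \<open>\<alpha> y = (1 - \<beta> \<gamma>) \<epsilon>\<close> for the
  four generators \<open>\<epsilon>\<close> of X. The integer at the end of each right-hand side is
  what the trivial summand of R contributes to \<open>- \<beta> \<gamma>\<close>; for instance 34 =
  - (-2) * 17.\<close>

lemma preimage_checks:
  "list_all (\<lambda>r. ap TU alCU y0U r + ap TT alCT y0T r = of_bool (inC r) - cv TS beCS gaSC (mi r) + 34) TC"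
  "list_all (\<lambda>r. ap TU alCU y1U r + ap TT alCT y1T r = 0 - cv TS beCS (cst 8) (mi r) - 272) TC"
  "list_all (\<lambda>r. ap TU alCU (cst 17) r + ap TT alCT y2T r = 0 - cv TS beCS (cst 7) (mi r) - 238) TC"
  "list_all (\<lambda>r. ap TU alCU y3U r + ap TT alCT y3T r = 0 - cv TS beCS gaSS (mi r) - 2) TC"
  "list_all (\<lambda>r. ap TU alBU y0U r = 0 - 17) TB"
  "list_all (\<lambda>r. ap TU alBU y1U r = of_bool (inB r) + 136) TB"
  "list_all (\<lambda>r. ap TU alBU (cst 17) r = 0 + 119) TB"
  "list_all (\<lambda>r. ap TU alBU y3U r = 0 + 1) TB"
  "list_all (\<lambda>r. ap TT alBT y0T r = 0 - cv TS beBS gaSC (mi r) + 51) TB"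
  "list_all (\<lambda>r. ap TT alBT y1T r = 0 - cv TS beBS (cst 8) (mi r) - 408) TB"
  "list_all (\<lambda>r. ap TT alBT y2T r = of_bool (inB r) - cv TS beBS (cst 7) (mi r) - 357) TB"
  "list_all (\<lambda>r. ap TT alBT y3T r = 0 - cv TS beBS gaSS (mi r) - 3) TB"
  "list_all (\<lambda>r. ap TT alST y0T r = 0 - cv TS beSS gaSC (mi r) - 17) TS"
  "list_all (\<lambda>r. ap TT alST y1T r = 0 - cv TS beSS (cst 8) (mi r) + 136) TS"
  "list_all (\<lambda>r. ap TT alST y2T r = 0 - cv TS beSS (cst 7) (mi r) + 119) TS"
  "list_all (\<lambda>r. ap TT alST y3T r = of_bool (inS r) - cv TS beSS gaSS (mi r) + 1) TS"
  by code_simp+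

lemma left_invariance:
  "linv KC alCU" "linv KC alCT" "linv KB alBU" "linv KB alBT" "linv KS alST" "linv KS gaSC"
  "linv KS gaSS" "linv KC beCS" "linv KB beBS" "linv KS beSS" "linv KU ioU" "linv KT ioT" "linv KU siUU"
  "linv KU siUT" "linv KU taUC" "linv KU taUB1" "linv KT taTC" "linv KT taTB1" "linv KT taTB2"
  by code_simp+

lemma right_invariance:
  "rinv KU alCU" "rinv KT alCT" "rinv KU alBU" "rinv KT alBT" "rinv KT alST" "rinv KC gaSC"
  "rinv KS gaSS" "rinv KS beCS" "rinv KS beBS" "rinv KS beSS" "rinv KU ioU" "rinv KU ioT" "rinv KU siUU"
  "rinv KT siUT" "rinv KC taUC" "rinv KB taUB1" "rinv KC taTC" "rinv KB taTB1" "rinv KB taTB2"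
  "rinv KU y0U" "rinv KT y0T" "rinv KU y1U" "rinv KT y1T" "rinv KT y2T" "rinv KU y3U" "rinv KT y3T"
  "rinv KU ceU" "rinv KT ceT"
  by code_simp+

subsection \<open>The special linear group\<close>

lemma mat2_mult_simp: "mat2_mult (a, b, c, d) (e, f, g, h) = (a*e + b*g, a*f + b*h, c*e + d*g, c*f + d*h)"
  by (simp add: mat2_mult_def)

lemma carrier_SL2: "(a, b, c, d) \<in> carrier SL2 \<longleftrightarrow> a * d - b * c = 1"
  by (simp add: SL2_def)

lemma mult_SL2: "A \<otimes>\<^bsub>SL2\<^esub> B = mat2_mult A B"
  by (simp add: SL2_def)

lemma one_SL2: "\<one>\<^bsub>SL2\<^esub> = (1, 0, 0, 1)"
  by (simp add: SL2_def)

lemma inv_left_SL2: "a * d - b * c = 1 \<Longrightarrow> (d, - b, - c, a) \<otimes>\<^bsub>SL2\<^esub> (a, b, c, d) = \<one>\<^bsub>SL2\<^esub>"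
  by (simp add: mult_SL2 one_SL2 mat2_mult_simp algebra_simps)

lemma group_SL2: "group (SL2 :: 'k::field mat2 monoid)"
proof (rule groupI)
  fix x y :: "'k mat2" assume xy: "x \<in> carrier SL2" "y \<in> carrier SL2"
  obtain a b c d where x: "x = (a, b, c, d)" by (cases x)
  obtain e f g h where y: "y = (e, f, g, h)" by (cases y)
  have "(a * e + b * g) * (c * f + d * h) - (a * f + b * h) * (c * e + d * g) = (a * d - b * c) * (e * h - f * g)"
    by (simp add: algebra_simps)
  then show "x \<otimes>\<^bsub>SL2\<^esub> y \<in> carrier SL2"
    using xy by (simp add: x y mult_SL2 mat2_mult_simp carrier_SL2)
next
  fix x y z :: "'k mat2"
  show "x \<otimes>\<^bsub>SL2\<^esub> y \<otimes>\<^bsub>SL2\<^esub> z = x \<otimes>\<^bsub>SL2\<^esub> (y \<otimes>\<^bsub>SL2\<^esub> z)"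
    by (cases x; cases y; cases z) (simp add: mult_SL2 mat2_mult_simp algebra_simps)
next
  fix x :: "'k mat2" assume "x \<in> carrier SL2"
  moreover obtain a b c d where "x = (a, b, c, d)" by (cases x)
  ultimately show "\<exists>y\<in>carrier SL2. y \<otimes>\<^bsub>SL2\<^esub> x = \<one>\<^bsub>SL2\<^esub>"
    using inv_left_SL2[of a d b c] by (intro bexI[of _ "(d, - b, - c, a)"]) (auto simp: carrier_SL2 mult.commute)
qed (auto simp: one_SL2 mult_SL2 mat2_mult_simp carrier_SL2)

lemma inv_SL2: "(a, b, c, d) \<in> carrier SL2 \<Longrightarrow> inv\<^bsub>SL2\<^esub> (a, b, c, d) = (d, - b, - c, a)"
  by (rule group.inv_equality[OF group_SL2]) (auto simp: carrier_SL2 inv_left_SL2 mult.commute)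

lemma uminus_gf8 [simp]: "- (x :: gf8) = x"
  by (simp add: uminus_gf8_def)

lemma minus_gf8 [simp]: "(x :: gf8) - y = x + y"
  by (simp add: minus_gf8_def)

lemma add_self_gf8 [simp]: "(x :: gf8) + x = 0"
  by (cases x) (simp_all add: zero_gf8_def)

lemma set_els: "x \<in> set els"
  by (cases x) (simp_all add: els_def)

lemma UNIV_gf8: "UNIV = set els"
  using set_els by auto

instance gf8 :: finite
  by standard (simp add: UNIV_gf8)

lemma card_gf8: "card (UNIV :: gf8 set) = 8"
  by (simp add: UNIV_gf8 els_def)

abbreviation Gam :: "mat monoid" where "Gam \<equiv> SL2"

interpretation Gam: group Gam by (rule group_SL2)

lemma mult_Gam: "A \<otimes>\<^bsub>Gam\<^esub> B = mm A B"
  by (cases A; cases B) (simp add: mult_SL2 mat2_mult_simp)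

lemma one_Gam: "\<one>\<^bsub>Gam\<^esub> = (F1, F0, F0, F1)"
  by (simp add: one_SL2 zero_gf8_def one_gf8_def)

lemma carrier_Gam: "A \<in> carrier Gam \<longleftrightarrow> inSL A"
  by (cases A) (simp add: carrier_SL2 inSL_def one_gf8_def)

lemma inv_Gam: "A \<in> carrier Gam \<Longrightarrow> inv\<^bsub>Gam\<^esub> A = mi A"
  by (cases A) (simp add: inv_SL2)

lemma gf8_simps: "F0 = 0" "F1 = 1"
  by (simp_all add: zero_gf8_def one_gf8_def)

lemma set_units: "x \<noteq> F0 \<Longrightarrow> x \<in> set units"
  by (cases x) (simp_all add: units_def)

text \<open>The first column selects the representative in \<open>TU\<close>, and what remains is a
  unipotent factor.\<close>

lemma forall_elemsD:
  assumes "forall_elems P" "x \<in> carrier Gam"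
  shows "P x"
proof -
  obtain a b c d where x: "x = (a, b, c, d)" by (cases x)
  have det: "a * d + b * c = 1" using assms(2) by (simp add: x carrier_SL2)
  have "\<exists>t\<in>set TU. \<exists>s. x = mm t (F1, s, F0, F1)"
  proof (cases "a = F0")
    case True
    then have "b * c = 1" "c \<noteq> 0" using det by (auto simp: gf8_simps)
    then have "b = inverse c" by (metis inverse_unique mult.commute)
    moreover have "(F0, inverse c, c, F0) \<in> set TU" using set_units[of c] \<open>c \<noteq> 0\<close> by (auto simp: TU_def gf8_simps)
    ultimately show ?thesis using True \<open>c \<noteq> 0\<close>
      by (intro bexI[of _ "(F0, inverse c, c, F0)"] exI[of _ "d * inverse c"]) (auto simp: x gf8_simps)
  next
    case False
    then have "(a, F0, c, inverse a) \<in> set TU" using set_units set_els by (auto simp: TU_def)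
    moreover have "d = c * (b * inverse a) + inverse a"
    proof -
      have "inverse a * (a * d + b * c) = inverse a * a * d + c * (b * inverse a)"
        by (simp add: algebra_simps)
      then have "d + c * (b * inverse a) = inverse a"
        using False by (simp add: det gf8_simps)
      then have "c * (b * inverse a) + (d + c * (b * inverse a)) = c * (b * inverse a) + inverse a" by simp
      then show ?thesis by (metis add.left_commute add.right_neutral add_self_gf8)
    qed
    ultimately show ?thesis using False
      by (intro bexI[of _ "(a, F0, c, inverse a)"] exI[of _ "b * inverse a"]) (auto simp: x gf8_simps algebra_simps)
  qed
  then show ?thesis
    using assms(1) set_els unfolding forall_elems_def list_all_iff by blast
qed

lemma finite_Gam: "finite (carrier Gam)"
  by simp

section \<open>Fields with eight elements and the isomorphism onto PSL_2\<close>

lemma char2_card8: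
  fixes x :: "'k::{field,finite}"
  assumes "card (UNIV :: 'k set) = 8"
  shows "x + x = 0"
proof -
  \<comment> \<open>Translation by 1 permutes the field; comparing the sums of all elements gives 8
    = 0.\<close>
  have "(\<Sum>y\<in>UNIV. y + 1) = (\<Sum>y\<in>(UNIV :: 'k set). y)"
    by (rule sum.reindex_bij_witness[of _ "\<lambda>y. y - 1" "\<lambda>y. y + 1"]) auto
  then have "of_nat (card (UNIV :: 'k set)) = (0 :: 'k)" by (simp add: sum.distrib)
  then have "(2 :: 'k) ^ 3 = 0" using assms by simp
  then have "(2 :: 'k) = 0" by (simp only: power_eq_0_iff)
  then show ?thesis by (metis mult_2 mult_zero_left)
qed

lemma power7_card8:
  fixes x :: "'k::{field,finite}"
  assumes "card (UNIV :: 'k set) = 8" "x \<noteq> 0"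
  shows "x ^ 7 = 1"
proof -
  \<comment> \<open>Multiplication by \<open>x\<close> permutes the nonzero elements; their product
    can be cancelled.\<close>
  have "(\<Prod>y\<in>UNIV - {0}. x * y) = (\<Prod>y\<in>UNIV - {0 :: 'k}. y)"
    by (rule prod.reindex_bij_witness[of _ "\<lambda>y. y / x" "\<lambda>y. x * y"]) (use assms(2) in auto)
  then have "x ^ card (UNIV - {0 :: 'k}) * (\<Prod>y\<in>UNIV - {0}. y) = (\<Prod>y\<in>UNIV - {0 :: 'k}. y)"
    by (simp add: prod.distrib)
  moreover have "(\<Prod>y\<in>UNIV - {0 :: 'k}. y) \<noteq> 0" by simp
  moreover have "card (UNIV - {0 :: 'k}) = 7" using assms(1) by (simp add: card_Diff_singleton)
  ultimately show ?thesis by simp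
qed

lemma cubic_root_card8:
  assumes "card (UNIV :: 'k::{field,finite} set) = 8"
  obtains z :: "'k::{field,finite}" where "z * z * z = z + 1"
proof -
  note c2 = char2_card8[OF assms]
  have c2': "x + (x + y) = y" for x y :: 'k using c2[of x] by (simp add: add.assoc[symmetric])
  have "\<exists>b :: 'k. b \<notin> {0, 1}"
  proof (rule ccontr)
    assume "\<not> ?thesis"
    then have "(UNIV :: 'k set) \<subseteq> {0, 1}" by blast
    then have "card (UNIV :: 'k set) \<le> card {0, 1 :: 'k}" by (intro card_mono) auto
    then show False using assms by simp
  qed
  then obtain b :: 'k where b: "b \<noteq> 0" "b \<noteq> 1" by auto
  \<comment> \<open>The factorization of X^7 - 1 over the field with two elements. Since
    \<open>b\<close> is not 1, it is a root of one of the two cubics.\<close>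
  have "(b + 1) * ((b * b * b + b + 1) * (b * b * b + b * b + 1)) = b ^ 7 + 1"
    by (simp add: algebra_simps power_numeral_reduce c2 c2')
  also have "\<dots> = 0" unfolding power7_card8[OF assms b(1)] by (rule c2)
  finally have "b + 1 = 0 \<or> b * b * b + b + 1 = 0 \<or> b * b * b + b * b + 1 = 0" by simp
  moreover have "b + 1 \<noteq> 0" using b(2) c2[of 1] by (metis add_right_cancel)
  moreover have eq: "x = y" if "x + y = 0" for x y :: 'k using that c2[of y] by (metis add_right_cancel)
  ultimately consider "b * b * b = b + 1" | "b * b * b = b * b + 1" by (metis add.assoc)
  then show thesis
  proof cases
    case 1
    then show ?thesis by (rule that)
  next
    case 2
    \<comment> \<open>Adding 1 carries roots of the cubic X^3 + X^2 + 1 to roots of X^3 + X +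
      1.\<close>
    have "(b + 1) * (b + 1) * (b + 1) = b * b * b + b * b + b + 1"
      by (simp add: algebra_simps c2 c2')
    also have "\<dots> = (b + 1) + 1" unfolding 2 by (simp add: ac_simps c2 c2')
    finally show ?thesis by (rule that)
  qed
qed

lemma gf8_iso_exists:
  assumes "card (UNIV :: 'k::{field,finite} set) = 8"
  obtains \<psi> :: "gf8 \<Rightarrow> 'k::{field,finite}" where "bij \<psi>" "\<And>x y. \<psi> (x + y) = \<psi> x + \<psi> y" "\<And>x y. \<psi> (x * y) = \<psi> x * \<psi> y"
proof -
  note c2 = char2_card8[OF assms]
  have c2': "x + (x + y) = y" for x y :: 'k using c2[of x] by (simp add: add.assoc[symmetric])
  obtain z :: 'k where z: "z * z * z = z + 1" using cubic_root_card8[OF assms] by blast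
  define s where "s = z * z"
  have two: "(2 :: 'k) = 0" using c2[of 1] by simp
  have four: "(4 :: 'k) = 0" using arg_cong[OF two, of "\<lambda>x. x * 2"] by simp
  have mult: "z * z = s" "z * s = z + 1" "s * z = z + 1" "s * s = s + z"
    using z by (simp_all add: s_def algebra_simps)
  define \<psi> :: "gf8 \<Rightarrow> 'k" where "\<psi> x = (case x of F0 \<Rightarrow> 0 | F1 \<Rightarrow> 1 | F2 \<Rightarrow> z | F3 \<Rightarrow> z + 1
    | F4 \<Rightarrow> s | F5 \<Rightarrow> s + 1 | F6 \<Rightarrow> s + z | F7 \<Rightarrow> s + z + 1)" for x
  have add: "\<psi> (x + y) = \<psi> x + \<psi> y" for x y
    by (cases x; cases y; simp add: \<psi>_def ac_simps c2 c2' zero_gf8_def)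
  have prod: "\<psi> (x * y) = \<psi> x * \<psi> y" for x y
    by (cases x; cases y; simp add: \<psi>_def distrib_left distrib_right mult; simp add: ac_simps c2 c2' two four)
  have zero: "x = 0" if "\<psi> x = 0" for x
  proof (rule ccontr)
    assume "x \<noteq> 0"
    then have "\<psi> x * \<psi> (inverse x) = \<psi> 1" by (simp flip: prod)
    then show False using that by (simp add: \<psi>_def one_gf8_def)
  qed
  have inj: "inj \<psi>"
  proof (rule injI)
    fix x y assume "\<psi> x = \<psi> y"
    then have "\<psi> (x + y) = 0" by (simp add: add c2)
    then have "x + y = 0" by (rule zero)
    then show "x = y" by (metis add_self_gf8 add_right_cancel)
  qed
  have "card (range \<psi>) = card (UNIV :: 'k set)" using inj card_image[of \<psi> UNIV] card_gf8 assms by simp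
  then have "range \<psi> = UNIV" by (intro card_subset_eq) auto
  then show thesis using that inj add prod by (auto simp: bij_def)
qed

text \<open>In characteristic 2 the only square root of 1 is 1, so the centre that is factored out
  is trivial. Entrywise application of the field isomorphism gives the rest.\<close>

lemma PSL2_iso_exists:
  assumes "card (UNIV :: 'k::{field,finite} set) = 8"
  obtains \<Theta> where "\<Theta> \<in> iso Gam (PSL2 :: 'k::{field,finite} mat2 set monoid)" "group (PSL2 :: 'k mat2 set monoid)"
proof -
  obtain \<psi> :: "gf8 \<Rightarrow> 'k" where \<psi>: "bij \<psi>" "\<And>x y. \<psi> (x + y) = \<psi> x + \<psi> y" "\<And>x y. \<psi> (x * y) = \<psi> x * \<psi> y"
    using gf8_iso_exists[OF assms] by blast
  interpret S: group "SL2 :: 'k mat2 monoid" by (rule group_SL2)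
  have \<psi>0: "\<psi> 0 = 0" using \<psi>(2)[of 0 0] char2_card8[OF assms, of "\<psi> 0"] by (metis add_0)
  have \<psi>1: "\<psi> 1 = 1"
  proof -
    have "\<psi> 1 \<noteq> \<psi> 0" using \<psi>(1) by (metis bij_def inj_eq zero_neq_one)
    then show ?thesis using \<psi>(3)[of 1 1] \<psi>0 by simp
  qed
  have neg: "- x = x" for x :: 'k using char2_card8[OF assms, of x] by (metis neg_eq_iff_add_eq_0)
  have inj: "\<psi> x = \<psi> y \<longleftrightarrow> x = y" for x y using \<psi>(1) by (metis bij_def inj_eq)
  define \<Psi> where "\<Psi> = (\<lambda>(a, b, c, d). (\<psi> a, \<psi> b, \<psi> c, \<psi> d))"
  have carr: "\<Psi> A \<in> carrier SL2 \<longleftrightarrow> A \<in> carrier Gam" for A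
  proof (cases A)
    case (fields a b c d)
    have "\<psi> a * \<psi> d - \<psi> b * \<psi> c = \<psi> (a * d + b * c)"
      using neg[of "\<psi> b * \<psi> c"] \<psi>(2,3) by (metis diff_conv_add_uminus)
    then show ?thesis using inj[of "a * d + b * c" 1] \<psi>1 by (simp add: fields \<Psi>_def carrier_SL2)
  qed
  have "\<Psi> \<in> iso Gam (SL2 :: 'k mat2 monoid)"
  proof (rule isoI)
    show "\<Psi> \<in> hom Gam SL2"
      by (rule homI) (use carr in \<open>auto simp: \<Psi>_def mult_SL2 mat2_mult_simp \<psi>\<close>)
    have "inj \<Psi>" by (auto simp: inj_def \<Psi>_def inj)
    have "\<exists>A. B = \<Psi> A" for B :: "'k mat2"
    proof (cases B)
      case (fields a b c d)
      obtain a' b' c' d' where "a = \<psi> a'" "b = \<psi> b'" "c = \<psi> c'" "d = \<psi> d'"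
        using \<psi>(1) by (metis bij_pointE)
      then show ?thesis using fields by (intro exI[of _ "(a', b', c', d')"]) (simp add: \<Psi>_def)
    qed
    then show "bij_betw \<Psi> (carrier Gam) (carrier SL2)"
    proof (intro bij_betw_imageI inj_on_subset[OF \<open>inj \<Psi>\<close> subset_UNIV] equalityI subsetI)
      fix B :: "'k mat2" assume "B \<in> carrier SL2"
      moreover obtain A where "B = \<Psi> A" using \<open>\<And>B. \<exists>A. B = \<Psi> A\<close> by blast
      ultimately show "B \<in> \<Psi> ` carrier Gam" using carr by simp
    qed (use carr in auto)
  qed
  moreover have "SL2_center = {\<one>\<^bsub>SL2 :: 'k mat2 monoid\<^esub>}"
  proof -
    have sq: "s = 1" if "s * s = 1" for s :: 'k
    proof -
      have "(s + 1) * (s + 1) = 0" using that char2_card8[OF assms, of s] char2_card8[OF assms, of 1]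
        by (simp add: distrib_left distrib_right add.assoc)
      then show ?thesis using neg[of 1] by (metis add_eq_0_iff2 mult_eq_0_iff)
    qed
    have "SL2_center \<subseteq> {(1, 0, 0, 1 :: 'k)}" unfolding SL2_center_def using sq by blast
    moreover have "(1, 0, 0, 1 :: 'k) \<in> SL2_center" unfolding SL2_center_def by auto
    ultimately show ?thesis unfolding one_SL2 by blast
  qed
  then have "the_elem \<in> iso PSL2 (SL2 :: 'k mat2 monoid)"
    using S.trivial_factor_iso by (simp add: PSL2_def)
  moreover have "group (PSL2 :: 'k mat2 set monoid)"
    using \<open>SL2_center = _\<close> S.one_is_normal normal.factorgroup_is_group unfolding PSL2_def by fastforce
  ultimately show thesis
    using that group.iso_set_sym[of PSL2 the_elem SL2] iso_set_trans by blast
qed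

section \<open>Arithmetic of kernels and generators of invariant functions\<close>

lemma kop_zero [simp]: "kop G n Ts w 0 = 0"
  by (auto simp: kop_def fun_eq_iff)

lemma kop_add_kernel: "kop G n Ts w f + kop G n Ts v f = kop G n Ts (\<lambda>i j g. w i j g + v i j g) f"
  by (auto simp: kop_def fun_eq_iff algebra_simps sum.distrib)

lemma kop_scale_kernel: "kop G n Ts (\<lambda>i j g. c * w i j g) f = zsc c (kop G n Ts w f)"
  by (auto simp: kop_def fun_eq_iff algebra_simps sum_distrib_left)

lemma kop_zero_kernel: "kop G n Ts (\<lambda>i j g. 0) f = 0"
  by (auto simp: kop_def fun_eq_iff)

text \<open>The trivial coset as a basis element of the summand with index \<open>i\<close>; its
  translates are the standard basis of that summand.\<close>

definition eps :: "('a,'b) monoid_scheme \<Rightarrow> 'a set list \<Rightarrow> nat \<Rightarrow> nat \<times> 'a \<Rightarrow> int" where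
  "eps G Ks i = (\<lambda>(j, x). if j < length Ks \<and> x \<in> carrier G then delta Ks j i x else 0)"

context group
begin

lemma delta_inv:
  assumes "tsys G Ks Ts" "k < length Ks" "x \<in> carrier G" "y \<in> carrier G"
  shows "delta Ks i k (inv x \<otimes> y) = delta Ks i k (inv y \<otimes> x)"
proof -
  interpret subgroup "Ks ! k" G by (rule tsysD(1)[OF assms(1,2)])
  have "inv b \<otimes> a \<in> Ks ! k" if "inv a \<otimes> b \<in> Ks ! k" "a \<in> carrier G" "b \<in> carrier G" for a b
    using m_inv_closed[OF that(1)] that(2,3) by (simp add: inv_mult_group)
  then show ?thesis using assms(3,4) by (auto simp: delta_def)
qed

lemma eps_RL:
  assumes "tsys G Ks Ts" "i < length Ks"
  shows "eps G Ks i \<in> RL G Ks"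
proof -
  have "delta Ks j i (x \<otimes> k) = delta Ks j i x" if "j < length Ks" "x \<in> carrier G" "k \<in> Ks ! j" for j x k
    using delta_right[OF assms that(2), of k j] that(3) by (cases "j = i") (auto simp: delta_def)
  then show ?thesis using tsysD(5)[OF assms(1)] by (auto simp: RL_def eps_def)
qed

lemma RL_expand:
  assumes "tsys G Ks Ts" "f \<in> RL G Ks"
  shows "f = (\<Sum>i<length Ks. \<Sum>t\<in>Ts ! i. zsc (f (i, t)) (lt G t (eps G Ks i)))"
proof (rule ext, clarify)
  fix j x
  show "f (j, x) = (\<Sum>i<length Ks. \<Sum>t\<in>Ts ! i. zsc (f (i, t)) (lt G t (eps G Ks i))) (j, x)"
  proof (cases "j < length Ks \<and> x \<in> carrier G")
    case True
    have "f (j, x) = kop G (length Ks) Ts (delta Ks) f (j, x)"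
      by (simp add: kop_delta[OF assms])
    also have "\<dots> = (\<Sum>i<length Ks. \<Sum>t\<in>Ts ! i. delta Ks j i (inv x \<otimes> t) * f (i, t))"
      using True tsys_length[OF assms(1)] by (simp add: kop_def)
    also have "\<dots> = (\<Sum>i<length Ks. \<Sum>t\<in>Ts ! i. f (i, t) * lt G t (eps G Ks i) (j, x))"
    proof (rule sum.cong[OF refl], rule sum.cong[OF refl])
      fix i t assume "i \<in> {..<length Ks}" "t \<in> Ts ! i"
      then have "i < length Ks" "t \<in> carrier G" using tsysD(3)[OF assms(1)] by auto
      then show "delta Ks j i (inv x \<otimes> t) * f (i, t) = f (i, t) * lt G t (eps G Ks i) (j, x)"
        using True delta_inv[OF assms(1), of i x t j] by (simp add: lt_def eps_def)
    qed
    finally show ?thesis by (simp add: sum_fun_apply)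
  next
    case False
    then show ?thesis
      using RL_zero[OF assms(2) False] tsysD(3)[OF assms(1)]
      by (auto simp: sum_fun_apply lt_def eps_def intro!: sum.neutral)
  qed
qed

text \<open>Only the representative of the trivial coset contributes to the sum. The inverse comes
  from the convention that kernels are evaluated at \<open>inv x \<otimes> t\<close>.\<close>

lemma kop_eps:
  assumes "tsys G Ls Ts" "i < length Ls" "j < n" "x \<in> carrier G"
    and "\<And>g l. g \<in> carrier G \<Longrightarrow> l \<in> Ls ! i \<Longrightarrow> w j i (g \<otimes> l) = w j i g"
  shows "kop G n Ts w (eps G Ls i) (j, x) = w j i (inv x)"
proof -
  note T = tsysD[OF assms(1,2)]
  interpret L: subgroup "Ls ! i" G by (rule T(1))
  have "\<exists>!t. t \<in> Ts ! i \<and> inv t \<otimes> \<one> \<in> Ls ! i" using T(2) by (simp add: transversal_def)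
  then obtain s where s: "s \<in> Ts ! i \<and> inv s \<otimes> \<one> \<in> Ls ! i"
      and u: "\<forall>t. t \<in> Ts ! i \<and> inv t \<otimes> \<one> \<in> Ls ! i \<longrightarrow> t = s" by (rule ex1E)
  have mem: "t \<in> Ls ! i \<longleftrightarrow> t = s" if "t \<in> Ts ! i" for t
  proof -
    have t: "t \<in> carrier G" "s \<in> carrier G" using that s T(3) by auto
    show ?thesis
    proof
      assume "t \<in> Ls ! i"
      then show "t = s" using u that t by simp
    next
      assume "t = s"
      then show "t \<in> Ls ! i" using s t L.m_inv_closed[of "inv s"] by simp
    qed
  qed
  have "kop G n Ts w (eps G Ls i) (j, x)
      = (\<Sum>k<length Ls. \<Sum>t\<in>Ts ! k. w j k (inv x \<otimes> t) * delta Ls k i t)"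
    unfolding kop_def using assms(3,4) tsys_length[OF assms(1)] tsysD(3)[OF assms(1)]
    by (auto simp: eps_def intro!: sum.cong)
  also have "\<dots> = (\<Sum>k<length Ls. if k = i then \<Sum>t\<in>Ts ! k. w j k (inv x \<otimes> t) * of_bool (t \<in> Ls ! i) else 0)"
    by (rule sum.cong[OF refl]) (auto simp: delta_def)
  also have "\<dots> = (\<Sum>t\<in>Ts ! i. w j i (inv x \<otimes> t) * of_bool (t \<in> Ls ! i))" using assms(2) by simp
  also have "\<dots> = (\<Sum>t\<in>Ts ! i. if t = s then w j i (inv x \<otimes> t) else 0)"
    using mem by (intro sum.cong) auto
  also have "\<dots> = w j i (inv x \<otimes> s)" using s T(4) by simp
  also have "\<dots> = w j i (inv x)" using assms(5)[of "inv x" s] mem s assms(4) by simp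
  finally show ?thesis .
qed

end

lemma kop_sum: "kop G n Ts w (sum f A) = (\<Sum>i\<in>A. kop G n Ts w (f i))"
  by (rule additive_on_sum[OF additive_on_kop[of UNIV]]) (auto simp: add_subgroup_def)

subsection \<open>The subgroups\<close>

definition sU :: "mat set" where "sU = {g \<in> carrier Gam. inU g}"
definition sT :: "mat set" where "sT = {g \<in> carrier Gam. inT g}"
definition sC :: "mat set" where "sC = {g \<in> carrier Gam. inC g}"
definition sB :: "mat set" where "sB = {g \<in> carrier Gam. inB g}"
definition sS :: "mat set" where "sS = {g \<in> carrier Gam. inS g}"

lemma subgroup_GamI:
  assumes "K = {g \<in> carrier Gam. P g}" "P \<one>\<^bsub>Gam\<^esub>"
    and "\<And>x y. inSL x \<Longrightarrow> inSL y \<Longrightarrow> P x \<Longrightarrow> P y \<Longrightarrow> P (mm x y)" "\<And>x. inSL x \<Longrightarrow> P x \<Longrightarrow> P (mi x)"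
  shows "subgroup K Gam"
proof
  fix x assume "x \<in> K"
  then have x: "x \<in> carrier Gam" "P x" by (simp_all add: assms(1))
  have "P (inv\<^bsub>Gam\<^esub> x)" using x assms(4) inv_Gam by (simp add: carrier_Gam)
  then show "inv\<^bsub>Gam\<^esub> x \<in> K" using Gam.inv_closed[OF x(1)] by (simp add: assms(1))
qed (use assms in \<open>auto simp: mult_Gam carrier_Gam[symmetric] simp flip: mult_Gam\<close>)

lemma subgroup_sU: "subgroup sU Gam"
  by (rule subgroup_GamI[OF sU_def]) (auto simp: one_Gam inSL_def gf8_simps)

lemma subgroup_sT: "subgroup sT Gam"
  by (rule subgroup_GamI[OF sT_def]) (auto simp: one_Gam inSL_def gf8_simps)

lemma subgroup_sB: "subgroup sB Gam"
  by (rule subgroup_GamI[OF sB_def]) (auto simp: one_Gam inSL_def gf8_simps)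

lemma subgroup_sC: "subgroup sC Gam"
proof (rule subgroup_GamI[OF sC_def])
  show "inC (mm x y)" if "inC x" "inC y" for x y
    using that by (cases x; cases y) (simp add: algebra_simps)
  show "inC (mi x)" if "inC x" for x
    using that by (cases x) (simp add: add.assoc)
qed (simp add: one_Gam gf8_simps)

lemma F2_closed:
  "a = F0 \<or> a = F1 \<Longrightarrow> b = F0 \<or> b = F1 \<Longrightarrow> a + b = F0 \<or> a + b = F1"
  "a = F0 \<or> a = F1 \<Longrightarrow> b = F0 \<or> b = F1 \<Longrightarrow> a * b = F0 \<or> a * b = F1"
  by (auto simp: zero_gf8_def)

lemma subgroup_sS: "subgroup sS Gam"
proof (rule subgroup_GamI[OF sS_def])
  show "inS (mm x y)" if "inS x" "inS y" for x y
    using that by (cases x; cases y) (simp only: inS.simps mm.simps, intro conjI F2_closed; simp)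
  show "inS (mi x)" if "inS x" for x
    using that by (cases x) simp
qed (simp add: one_Gam)

lemma members:
  "forall_elems (\<lambda>x. inU x \<longrightarrow> List.member KU x)" "forall_elems (\<lambda>x. inT x \<longrightarrow> List.member KT x)"
  "forall_elems (\<lambda>x. inC x \<longrightarrow> List.member KC x)" "forall_elems (\<lambda>x. inB x \<longrightarrow> List.member KB x)"
  "forall_elems (\<lambda>x. inS x \<longrightarrow> List.member KS x)"
  by code_simp+

lemma member_lists:
  "g \<in> sU \<Longrightarrow> g \<in> set KU" "g \<in> sT \<Longrightarrow> g \<in> set KT" "g \<in> sC \<Longrightarrow> g \<in> set KC"
  "g \<in> sB \<Longrightarrow> g \<in> set KB" "g \<in> sS \<Longrightarrow> g \<in> set KS"
  using forall_elemsD[OF members(1), of g] forall_elemsD[OF members(2), of g] forall_elemsD[OF members(3), of g]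
    forall_elemsD[OF members(4), of g] forall_elemsD[OF members(5), of g]
  by (simp_all add: sU_def sT_def sC_def sB_def sS_def)

lemma transversal_GamI:
  assumes "K = {g \<in> carrier Gam. P g}" "forall_elems (\<lambda>x. tr1 P T x = 1)" "distinct T" "list_all inSL T"
  shows "transversal Gam K (set T)"
  unfolding transversal_def
proof (intro conjI ballI)
  show T: "set T \<subseteq> carrier Gam" using assms(4) by (auto simp: list_all_iff carrier_Gam)
  fix x assume x: "x \<in> carrier Gam"
  have "tr1 P T x = (\<Sum>t\<in>set T. of_bool (P (mm (mi t) x)))"
    using assms(3) by (simp add: tr1_def sum_list_distinct_conv_sum_set)
  also have "\<dots> = int (card {t \<in> set T. P (mm (mi t) x)})"
    by (simp add: of_bool_def sum.If_cases Int_def)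
  finally have "card {t \<in> set T. P (mm (mi t) x)} = 1" using forall_elemsD[OF assms(2) x] by simp
  then obtain t where t: "{t \<in> set T. P (mm (mi t) x)} = {t}" by (auto simp: card_1_singleton_iff)
  have "s \<in> set T \<and> inv\<^bsub>Gam\<^esub> s \<otimes>\<^bsub>Gam\<^esub> x \<in> K \<longleftrightarrow> s = t" for s
  proof -
    have "inv\<^bsub>Gam\<^esub> s \<otimes>\<^bsub>Gam\<^esub> x \<in> K \<longleftrightarrow> P (mm (mi s) x)" if "s \<in> set T"
    proof -
      have s: "s \<in> carrier Gam" using that T by auto
      then have "inv\<^bsub>Gam\<^esub> s \<otimes>\<^bsub>Gam\<^esub> x \<in> carrier Gam" using x by simp
      then show ?thesis using inv_Gam[OF s] by (simp add: assms(1) mult_Gam)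
    qed
    then show ?thesis using t by blast
  qed
  then show "\<exists>!t. t \<in> set T \<and> inv\<^bsub>Gam\<^esub> t \<otimes>\<^bsub>Gam\<^esub> x \<in> K" by auto
qed simp

definition KP :: "mat set list" where "KP = [sU, sT]"
definition KX :: "mat set list" where "KX = [sC, sB, sB, sS]"
definition KR :: "mat set list" where "KR = [sS, carrier Gam]"
definition KV :: "mat set list" where "KV = [sU]"
definition TP :: "mat set list" where "TP = [set TU, set TT]"
definition TX :: "mat set list" where "TX = [set TC, set TB, set TB, set TS]"
definition TR :: "mat set list" where "TR = [set TS, set TG]"
definition TV :: "mat set list" where "TV = [set TU]"

lemma transversals:
  "transversal Gam sU (set TU)" "transversal Gam sT (set TT)" "transversal Gam sC (set TC)"
  "transversal Gam sB (set TB)" "transversal Gam sS (set TS)"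
  by (rule transversal_GamI[OF sU_def transversal_checks(1) transversal_distinct(1) transversal_carrier(1)]
      transversal_GamI[OF sT_def transversal_checks(2) transversal_distinct(2) transversal_carrier(2)]
      transversal_GamI[OF sC_def transversal_checks(3) transversal_distinct(3) transversal_carrier(3)]
      transversal_GamI[OF sB_def transversal_checks(4) transversal_distinct(4) transversal_carrier(4)]
      transversal_GamI[OF sS_def transversal_checks(5) transversal_distinct(5) transversal_carrier(5)])+

lemma transversal_TG: "transversal Gam (carrier Gam) (set TG)"
proof -
  have "set TG = {\<one>\<^bsub>Gam\<^esub>}" by (simp add: TG_def one_Gam)
  moreover have "\<exists>!t. t \<in> {\<one>\<^bsub>Gam\<^esub>} \<and> inv\<^bsub>Gam\<^esub> t \<otimes>\<^bsub>Gam\<^esub> x \<in> carrier Gam" if "x \<in> carrier Gam" for x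
    by (rule ex1I[of _ "\<one>\<^bsub>Gam\<^esub>"]) (use that in simp_all)
  ultimately show ?thesis by (simp add: transversal_def)
qed

lemma less_simps: "(i::nat) < 2 \<longleftrightarrow> i = 0 \<or> i = 1" "i < 4 \<longleftrightarrow> i = 0 \<or> i = 1 \<or> i = 2 \<or> i = 3" "i < 1 \<longleftrightarrow> i = 0"
  by auto

lemma tsys_all: "tsys Gam KP TP" "tsys Gam KX TX" "tsys Gam KR TR" "tsys Gam KV TV"
  using subgroup_sU subgroup_sT subgroup_sC subgroup_sB subgroup_sS Gam.subgroup_self transversals transversal_TG
  by (auto simp: tsys_def KP_def KX_def KR_def KV_def TP_def TX_def TR_def TV_def less_Suc_eq nth_Cons')

lemma lengths: "length KP = 2" "length KX = 4" "length KR = 2" "length KV = 1"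
    "length TP = 2" "length TX = 4" "length TR = 2" "length TV = 1"
  by (simp_all add: KP_def KX_def KR_def KV_def TP_def TX_def TR_def TV_def)

lemma subgroups_all:
  "\<forall>K\<in>set KP. subgroup K Gam" "\<forall>K\<in>set KX. subgroup K Gam" "\<forall>K\<in>set KR. subgroup K Gam" "\<forall>K\<in>set KV. subgroup K Gam"
  using subgroup_sU subgroup_sT subgroup_sC subgroup_sB subgroup_sS Gam.subgroup_self
  by (auto simp: KP_def KX_def KR_def KV_def)

subsection \<open>The kernels\<close>

definition al :: "nat \<Rightarrow> nat \<Rightarrow> mat \<Rightarrow> int" where
  "al i j = [[alCU, alCT], [alBU, cst 0], [cst 0, alBT], [cst 0, alST]] ! i ! j"
definition ga :: "nat \<Rightarrow> nat \<Rightarrow> mat \<Rightarrow> int" where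
  "ga i j = [[gaSC, cst 8, cst 7, gaSS], [cst 17, cst (-136), cst (-119), cst (-1)]] ! i ! j"
definition be :: "nat \<Rightarrow> nat \<Rightarrow> mat \<Rightarrow> int" where
  "be i j = [[beCS, cst (-2)], [cst 0, cst 1], [beBS, cst (-3)], [beSS, cst 1]] ! i ! j"
definition io :: "nat \<Rightarrow> nat \<Rightarrow> mat \<Rightarrow> int" where
  "io i j = [ioU, ioT] ! i"
definition si :: "nat \<Rightarrow> nat \<Rightarrow> mat \<Rightarrow> int" where
  "si i j = [siUU, siUT] ! j"
definition ta :: "nat \<Rightarrow> nat \<Rightarrow> mat \<Rightarrow> int" where
  "ta i j = [[taUC, taUB1, cst (-35), cst 0], [taTC, taTB1, taTB2, cst 0]] ! i ! j"
definition ce :: "nat \<Rightarrow> nat \<Rightarrow> mat \<Rightarrow> int" where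
  "ce i j = [ceU, ceT] ! j"

definition li :: "mat set \<Rightarrow> (mat \<Rightarrow> int) \<Rightarrow> bool" where
  "li K w \<longleftrightarrow> (\<forall>x\<in>carrier Gam. \<forall>k\<in>K. w (k \<otimes>\<^bsub>Gam\<^esub> x) = w x)"
definition ri :: "mat set \<Rightarrow> (mat \<Rightarrow> int) \<Rightarrow> bool" where
  "ri K w \<longleftrightarrow> (\<forall>x\<in>carrier Gam. \<forall>k\<in>K. w (x \<otimes>\<^bsub>Gam\<^esub> k) = w x)"

lemma liI: "linv L w \<Longrightarrow> (\<And>k. k \<in> K \<Longrightarrow> k \<in> set L) \<Longrightarrow> li K w"
  unfolding linv_def li_def by (auto dest!: forall_elemsD simp: list_all_iff mult_Gam)

lemma riI: "rinv L w \<Longrightarrow> (\<And>k. k \<in> K \<Longrightarrow> k \<in> set L) \<Longrightarrow> ri K w"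
  unfolding rinv_def ri_def by (auto dest!: forall_elemsD simp: list_all_iff mult_Gam)

lemma li_cst [simp]: "li K (cst c)" and ri_cst [simp]: "ri K (cst c)"
  by (simp_all add: li_def ri_def cst_def)

lemma li_kernels:
  "li sC alCU" "li sC alCT" "li sB alBU" "li sB alBT" "li sS alST" "li sS gaSC" "li sS gaSS" "li sC beCS"
  "li sB beBS" "li sS beSS" "li sU ioU" "li sT ioT" "li sU siUU" "li sU siUT" "li sU taUC" "li sU taUB1"
  "li sT taTC" "li sT taTB1" "li sT taTB2"
  by (rule liI, rule left_invariance, erule member_lists)+

lemma ri_kernels:
  "ri sU alCU" "ri sT alCT" "ri sU alBU" "ri sT alBT" "ri sT alST" "ri sC gaSC" "ri sS gaSS" "ri sS beCS"
  "ri sS beBS" "ri sS beSS" "ri sU ioU" "ri sU ioT" "ri sU siUU" "ri sT siUT" "ri sC taUC" "ri sB taUB1"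
  "ri sC taTC" "ri sB taTB1" "ri sB taTB2" "ri sU y0U" "ri sT y0T" "ri sU y1U" "ri sT y1T" "ri sT y2T"
  "ri sU y3U" "ri sT y3T" "ri sU ceU" "ri sT ceT"
  by (rule riI, rule right_invariance, erule member_lists)+

lemma binvI:
  assumes "\<And>i j. i < length Ks \<Longrightarrow> j < length Ls \<Longrightarrow> li (Ks ! i) (w i j) \<and> ri (Ls ! j) (w i j)"
  shows "binv Gam Ks Ls w"
  using assms by (simp add: binv_def li_def ri_def)

lemma binv_al: "binv Gam KX KP al"
  by (rule binvI) (auto simp: KX_def KP_def al_def less_Suc_eq li_kernels ri_kernels)

lemma binv_ga: "binv Gam KR KX ga"
  by (rule binvI) (auto simp: KX_def KR_def ga_def less_Suc_eq li_kernels ri_kernels)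

lemma binv_be: "binv Gam KX KR be"
  by (rule binvI) (auto simp: KX_def KR_def be_def less_Suc_eq li_kernels ri_kernels)

lemma binv_io: "binv Gam KP KV io"
  by (rule binvI) (auto simp: KP_def KV_def io_def less_Suc_eq li_kernels ri_kernels)

lemma binv_si: "binv Gam KV KP si"
  by (rule binvI) (auto simp: KP_def KV_def si_def less_Suc_eq li_kernels ri_kernels)

lemma binv_ta: "binv Gam KP KX ta"
  by (rule binvI) (auto simp: KP_def KX_def ta_def less_Suc_eq li_kernels ri_kernels)

text \<open>Taking the trivial subgroup, that is Z[G] as target, makes the condition on the left
  void; only right invariance has content.\<close>

lemma binv_ce: "binv Gam [{\<one>\<^bsub>Gam\<^esub>}] KP ce"
  by (rule binvI) (auto simp: KP_def ce_def less_Suc_eq li_def ri_kernels)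

lemma cv_set:
  assumes "distinct T" "list_all inSL T"
  shows "(\<Sum>t\<in>set T. v t * w (inv\<^bsub>Gam\<^esub> t \<otimes>\<^bsub>Gam\<^esub> g)) = cv T v w g"
proof -
  have "(\<Sum>t\<in>set T. v t * w (inv\<^bsub>Gam\<^esub> t \<otimes>\<^bsub>Gam\<^esub> g)) = (\<Sum>t\<in>set T. v t * w (mm (mi t) g))"
    using assms(2) by (intro sum.cong) (auto simp: mult_Gam inv_Gam carrier_Gam list_all_iff)
  then show ?thesis using assms(1) by (simp add: cv_def sum_list_distinct_conv_sum_set)
qed

lemmas cv_sets =
  cv_set[OF transversal_distinct(1) transversal_carrier(1)] cv_set[OF transversal_distinct(2) transversal_carrier(2)]
  cv_set[OF transversal_distinct(3) transversal_carrier(3)] cv_set[OF transversal_distinct(4) transversal_carrier(4)]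
  cv_set[OF transversal_distinct(5) transversal_carrier(5)]

lemma cv_TG: "(\<Sum>t\<in>set TG. v t * w (inv\<^bsub>Gam\<^esub> t \<otimes>\<^bsub>Gam\<^esub> g)) = v (F1, F0, F0, F1) * w (mm (F1, F0, F0, F1) g)"
  by (simp add: TG_def inv_Gam carrier_Gam inSL_def mult_Gam)

lemma cv_cst0 [simp]: "cv T (cst 0) w g = 0" "cv T v (cst 0) g = 0"
  by (simp_all add: cv_def cst_def)

lemma sum_small: "(\<Sum>j<2. f j) = f 0 + f (1::nat)" "(\<Sum>j<4. f j) = f 0 + f 1 + f 2 + f (3::nat)" "(\<Sum>j<1. f j) = f (0::nat)"
  for f :: "nat \<Rightarrow> int"
  by (simp_all add: numeral_2_eq_2 numeral_eq_Suc)

lemma conv_TP: "conv Gam TP w v i k g = cv TU (w i 0) (v 0 k) g + cv TT (w i 1) (v 1 k) g"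
  by (simp add: conv_def lengths sum_small) (simp add: TP_def cv_sets)

lemma conv_TX: "conv Gam TX w v i k g
    = cv TC (w i 0) (v 0 k) g + cv TB (w i 1) (v 1 k) g + cv TB (w i 2) (v 2 k) g + cv TS (w i 3) (v 3 k) g"
  by (simp add: conv_def lengths sum_small) (simp add: TX_def cv_sets)

lemma conv_TV: "conv Gam TV w v i k g = cv TU (w i 0) (v 0 k) g"
  by (simp add: conv_def lengths sum_small) (simp add: TV_def cv_sets)

lemma conv_TR: "conv Gam TR w v i k g = cv TS (w i 0) (v 0 k) g + w i 1 (F1, F0, F0, F1) * v 1 k (mm (F1, F0, F0, F1) g)"
  by (simp add: conv_def lengths sum_small) (simp add: TR_def cv_sets cv_TG)

lemma list_allD: "list_all P xs \<Longrightarrow> x \<in> set xs \<Longrightarrow> P x"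
  by (simp add: list_all_iff)

lemma conv_al_io: "i < 4 \<Longrightarrow> k < 1 \<Longrightarrow> g \<in> TV ! k \<Longrightarrow> conv Gam TP al io i k g = 0"
  unfolding conv_TP
  by (auto simp: less_simps al_def io_def TV_def dest: alpha_iota_checks[THEN list_allD])

lemma conv_ga_al: "i < 2 \<Longrightarrow> k < 2 \<Longrightarrow> g \<in> TP ! k \<Longrightarrow> conv Gam TX ga al i k g = 0"
  unfolding conv_TX
  by (auto simp: less_simps al_def ga_def TP_def dest: gamma_alpha_checks[THEN list_allD])

lemma inG_carrier: "g \<in> carrier Gam \<Longrightarrow> delta KR 1 1 g = 1" "delta KR 0 1 g = 0" "delta KR 1 0 g = 0"
  by (simp_all add: delta_def KR_def)

lemma delta_in:
  "g \<in> carrier Gam \<Longrightarrow> delta KR 0 0 g = of_bool (inS g)"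
  "g \<in> carrier Gam \<Longrightarrow> delta KP i 0 g = of_bool (i = 0 \<and> inU g)"
  "g \<in> carrier Gam \<Longrightarrow> delta KP i 1 g = of_bool (i = 1 \<and> inT g)"
  "g \<in> carrier Gam \<Longrightarrow> delta KV i 0 g = of_bool (i = 0 \<and> inU g)"
  "g \<in> carrier Gam \<Longrightarrow> delta KX i 0 g = of_bool (i = 0 \<and> inC g)"
  "g \<in> carrier Gam \<Longrightarrow> delta KX i 1 g = of_bool (i = 1 \<and> inB g)"
  "g \<in> carrier Gam \<Longrightarrow> delta KX i 2 g = of_bool (i = 2 \<and> inB g)"
  "g \<in> carrier Gam \<Longrightarrow> delta KX i 3 g = of_bool (i = 3 \<and> inS g)"
  by (simp_all add: delta_def KR_def KP_def KV_def KX_def sU_def sT_def sC_def sB_def sS_def)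

lemma TT_carrier: "g \<in> set TU \<Longrightarrow> g \<in> carrier Gam" "g \<in> set TT \<Longrightarrow> g \<in> carrier Gam"
    "g \<in> set TC \<Longrightarrow> g \<in> carrier Gam" "g \<in> set TB \<Longrightarrow> g \<in> carrier Gam" "g \<in> set TS \<Longrightarrow> g \<in> carrier Gam"
    "g \<in> set TG \<Longrightarrow> g \<in> carrier Gam"
  using transversals transversal_TG by (auto simp: transversal_def)

lemma conv_ga_be: "i < 2 \<Longrightarrow> k < 2 \<Longrightarrow> g \<in> TR ! k \<Longrightarrow> conv Gam TX ga be i k g = delta KR i k g"
  unfolding conv_TX
  using gamma_beta_checks[THEN list_allD, of g]
  by (auto simp: less_simps be_def ga_def TR_def inG_carrier[unfolded One_nat_def] delta_in[unfolded One_nat_def] TT_carrier)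

lemma conv_homotopy: "i < 2 \<Longrightarrow> k < 2 \<Longrightarrow> g \<in> TP ! k
    \<Longrightarrow> conv Gam TV io si i k g + conv Gam TX ta al i k g = 1071 * delta KP i k g"
  unfolding conv_TX conv_TV
  using homotopy_checks[THEN list_allD, of g]
  by (auto simp: less_simps al_def io_def si_def ta_def TP_def delta_in[unfolded One_nat_def] TT_carrier)

subsection \<open>Exactness\<close>

abbreviation kal where "kal \<equiv> kop Gam 4 TP al"
abbreviation kga where "kga \<equiv> kop Gam 2 TX ga"
abbreviation kbe where "kbe \<equiv> kop Gam 4 TR be"
abbreviation kio where "kio \<equiv> kop Gam 2 TV io"

lemmas kop_RLs =
  Gam.kop_RL[OF binv_al tsys_all(1) subgroups_all(2), unfolded lengths]
  Gam.kop_RL[OF binv_ga tsys_all(2) subgroups_all(3), unfolded lengths]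
  Gam.kop_RL[OF binv_be tsys_all(3) subgroups_all(2), unfolded lengths]
  Gam.kop_RL[OF binv_io tsys_all(4) subgroups_all(1), unfolded lengths]
  Gam.kop_RL[OF binv_si tsys_all(1) subgroups_all(4), unfolded lengths]

lemmas kop_lts =
  Gam.kop_lt[OF binv_al tsys_all(1), unfolded lengths]
  Gam.kop_lt[OF binv_ga tsys_all(2), unfolded lengths]
  Gam.kop_lt[OF binv_be tsys_all(3), unfolded lengths]
  Gam.kop_lt[OF binv_io tsys_all(4), unfolded lengths]

lemma al_io: "kal (kio f) = 0"
  using Gam.kop_conv_eq[OF binv_al binv_io tsys_all(1) tsys_all(4), of "\<lambda>i k g. 0" f]
  by (simp add: lengths conv_al_io kop_zero_kernel)

lemma ga_al: "kga (kal f) = 0"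
  using Gam.kop_conv_eq[OF binv_ga binv_al tsys_all(2) tsys_all(1), of "\<lambda>i k g. 0" f]
  by (simp add: lengths conv_ga_al kop_zero_kernel)

lemma ga_be:
  assumes "f \<in> RL Gam KR"
  shows "kga (kbe f) = f"
  using Gam.kop_conv_eq[OF binv_ga binv_be tsys_all(2) tsys_all(3), of "delta KR" f]
    Gam.kop_delta[OF tsys_all(3) assms] Gam.delta_right[OF tsys_all(3)]
  by (simp add: lengths conv_ga_be)

lemma homotopy:
  assumes "f \<in> RL Gam KP"
  shows "kio (kop Gam 1 TP si f) + kop Gam 2 TX ta (kal f) = zsc 1071 f"
proof -
  have "kio (kop Gam 1 TP si f) + kop Gam 2 TX ta (kal f)
      = kop Gam 2 TP (\<lambda>i k g. conv Gam TV io si i k g + conv Gam TX ta al i k g) f"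
    using Gam.kop_comp[OF binv_io binv_si tsys_all(4,1), of f] Gam.kop_comp[OF binv_ta binv_al tsys_all(2,1), of f]
    by (simp add: lengths kop_add_kernel)
  also have "\<dots> = kop Gam 2 TP (\<lambda>i k g. 1071 * delta KP i k g) f"
  proof (rule Gam.kop_cong_transversal[OF tsys_all(1)])
    fix i k g l assume "k < length KP" "g \<in> carrier Gam" "l \<in> KP ! k"
    moreover from this have "l \<in> carrier Gam" using Gam.tsysD(5)[OF tsys_all(1)] by blast
    ultimately show "conv Gam TV io si i k (g \<otimes>\<^bsub>Gam\<^esub> l) + conv Gam TX ta al i k (g \<otimes>\<^bsub>Gam\<^esub> l)
        = conv Gam TV io si i k g + conv Gam TX ta al i k g"
      "1071 * delta KP i k (g \<otimes>\<^bsub>Gam\<^esub> l) = 1071 * delta KP i k g"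
      using Gam.conv_right[OF binv_si tsys_all(4)] Gam.conv_right[OF binv_al tsys_all(2)]
        Gam.delta_right[OF tsys_all(1)] by simp_all
  qed (simp add: lengths conv_homotopy)
  also have "\<dots> = zsc 1071 f"
    using Gam.kop_delta[OF tsys_all(1) assms] by (simp add: kop_scale_kernel lengths)
  finally show ?thesis .
qed

definition pre :: "nat \<Rightarrow> nat \<times> mat \<Rightarrow> int" where
  "pre i = (\<lambda>(j, x). if j < 2 \<and> x \<in> carrier Gam
     then ([[y0U, y0T], [y1U, y1T], [cst 17, y2T], [y3U, y3T]] ! i ! j) x else 0)"

lemma pre_RL: "i < 4 \<Longrightarrow> pre i \<in> RL Gam KP"
  using ri_kernels subgroup.mem_carrier[OF subgroup_sU] subgroup.mem_carrier[OF subgroup_sT]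
  by (auto simp: RL_def pre_def KP_def less_simps less_Suc_eq ri_def cst_def)

lemma ap_set:
  assumes "distinct T" "list_all inSL T" "r \<in> carrier Gam"
  shows "(\<Sum>t\<in>set T. w (inv\<^bsub>Gam\<^esub> r \<otimes>\<^bsub>Gam\<^esub> t) * f t) = ap T w f r"
  using assms by (simp add: ap_def sum_list_distinct_conv_sum_set inv_Gam mult_Gam)

lemma ap_cst0: "ap T (cst 0) f r = 0"
  by (simp add: ap_def cst_def)

lemma al_pre_value:
  assumes "i < 4" "j < 4" "r \<in> carrier Gam"
  shows "kal (pre i) (j, r) = ap TU (al j 0) ([y0U, y1U, cst 17, y3U] ! i) r + ap TT (al j 1) ([y0T, y1T, y2T, y3T] ! i) r"
proof -
  have "(\<Sum>t\<in>set TU. al j 0 (inv\<^bsub>Gam\<^esub> r \<otimes>\<^bsub>Gam\<^esub> t) * pre i (0, t))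
      = (\<Sum>t\<in>set TU. al j 0 (inv\<^bsub>Gam\<^esub> r \<otimes>\<^bsub>Gam\<^esub> t) * ([y0U, y1U, cst 17, y3U] ! i) t)"
    using assms(1) TT_carrier by (intro sum.cong) (auto simp: pre_def less_simps)
  moreover have "(\<Sum>t\<in>set TT. al j 1 (inv\<^bsub>Gam\<^esub> r \<otimes>\<^bsub>Gam\<^esub> t) * pre i (1, t))
      = (\<Sum>t\<in>set TT. al j 1 (inv\<^bsub>Gam\<^esub> r \<otimes>\<^bsub>Gam\<^esub> t) * ([y0T, y1T, y2T, y3T] ! i) t)"
    using assms(1) TT_carrier by (intro sum.cong) (auto simp: pre_def less_simps)
  ultimately show ?thesis
    using assms(2,3) ap_set[OF transversal_distinct(1) transversal_carrier(1)]
      ap_set[OF transversal_distinct(2) transversal_carrier(2)]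
    by (simp add: kop_def lengths sum_small) (simp add: TP_def)
qed

lemma conv_be_ga:
  "conv Gam TR be ga j i g = cv TS (be j 0) (ga 0 i) g + be j 1 (F1, F0, F0, F1) * ga 1 i (mm (F1, F0, F0, F1) g)"
  by (rule conv_TR)

text \<open>Both sides are invariant functions, so it is enough to compare them at coset
  representatives, where the evaluated identities apply.\<close>

lemma al_pre:
  assumes "i < 4"
  shows "kal (pre i) = eps Gam KX i - kbe (kga (eps Gam KX i))" (is "?l = ?r")
proof -
  have comp: "kbe (kga f) = kop Gam 4 TX (conv Gam TR be ga) f" for f
    using Gam.kop_comp[OF binv_be binv_ga tsys_all(3,2), of f] by (simp add: lengths)
  have R: "?l \<in> RL Gam KX" "?r \<in> RL Gam KX"
    using kop_RLs(1,3) Gam.eps_RL[OF tsys_all(2), of i] assms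
    by (auto simp: lengths intro!: add_subgroupD(2)[OF add_subgroup_RL])
  have val: "?l (j, r) = ?r (j, r)" if j: "j < 4" and r: "r \<in> TX ! j" for j r
  proof -
    have rc: "r \<in> carrier Gam" using Gam.tsysD(3)[OF tsys_all(2), of j r] j r by (simp add: lengths)
    \<comment> \<open>The kernel of \<open>\<beta> \<gamma>\<close> is read at the inverse of
      \<open>r\<close>, hence the occurrences of \<open>mi r\<close> in the evaluated
      identities.\<close>
    have "kbe (kga (eps Gam KX i)) (j, r) = conv Gam TR be ga j i (inv\<^bsub>Gam\<^esub> r)"
      unfolding comp
    proof (rule Gam.kop_eps[OF tsys_all(2)])
      fix g l assume "g \<in> carrier Gam" "l \<in> KX ! i"
      moreover from this have "l \<in> carrier Gam" using Gam.tsysD(5)[OF tsys_all(2), of i l] assms by (simp add: lengths)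
      ultimately show "conv Gam TR be ga j i (g \<otimes>\<^bsub>Gam\<^esub> l) = conv Gam TR be ga j i g"
        using Gam.conv_right[OF binv_ga tsys_all(3)] assms by (simp add: lengths)
    qed (use assms j rc in \<open>auto simp: lengths\<close>)
    then have "?r (j, r) = delta KX j i r - conv Gam TR be ga j i (mi r)"
      using j rc by (simp add: eps_def lengths inv_Gam)
    moreover have "ap TU (al j 0) ([y0U, y1U, cst 17, y3U] ! i) r + ap TT (al j 1) ([y0T, y1T, y2T, y3T] ! i) r
        = delta KX j i r - conv Gam TR be ga j i (mi r)"
      using preimage_checks[THEN list_allD, of r] assms j r rc unfolding conv_be_ga
      by (auto simp: less_simps al_def be_def ga_def TX_def delta_in[unfolded One_nat_def] ap_cst0 cst_def[of _ "mm _ _"] cst_def[of _ "(_, _)"])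
    ultimately show ?thesis using al_pre_value[OF assms j rc] by simp
  qed
  show ?thesis
  proof (rule ext, clarify)
    fix j a b c d
    show "?l (j, a, b, c, d) = ?r (j, a, b, c, d)"
    proof (cases "j < 4 \<and> (a, b, c, d) \<in> carrier Gam")
      case True
      define x where "x = (a, b, c, d)"
      have x: "x \<in> carrier Gam" using True by (simp add: x_def)
      obtain t where t: "t \<in> TX ! j" "inv\<^bsub>Gam\<^esub> t \<otimes>\<^bsub>Gam\<^esub> x \<in> KX ! j"
        using Gam.tsysD(2)[OF tsys_all(2), of j] True x by (auto simp: transversal_def lengths)
      have tc: "t \<in> carrier Gam" using Gam.tsysD(3)[OF tsys_all(2), of j t] True t by (simp add: lengths)
      have "h (j, x) = h (j, t)" if "h \<in> RL Gam KX" for h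
        using RL_right[OF that _ tc t(2)] True tc x by (simp add: lengths)
      then show ?thesis using R val[OF _ t(1)] True unfolding x_def by metis
    next
      case False
      then show ?thesis using RL_zero[OF R(1)] RL_zero[OF R(2)] by (simp only: lengths not_False_eq_True simp_thms)
    qed
  qed
qed

text \<open>\<open>id - \<beta>\<gamma>\<close> maps the generators into the image of \<open>\<alpha>\<close>, hence everything.\<close>

lemma ker_ga:
  assumes f: "f \<in> RL Gam KX" and "kga f = 0"
  shows "\<exists>p\<in>RL Gam KP. kal p = f"
proof -
  define D where "D h = h - kbe (kga h)" for h
  have D_lt: "D (lt Gam t h) = lt Gam t (D h)" if "h \<in> RL Gam KX" "t \<in> carrier Gam" for t h
    using that kop_lts(2)[OF that] kop_lts(3)[OF kop_RLs(2) that(2)]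
      additive_onD(4)[of UNIV "lt Gam t" h "kbe (kga h)"]
    by (simp add: D_def additive_on_def add_subgroup_def lt_add)
  have D_add: "additive_on UNIV D"
    by (simp add: additive_on_def D_def kop_add algebra_simps)
  have D_sum: "D (sum g A) = (\<Sum>i\<in>A. D (g i))" "D (sum g' A') = (\<Sum>i\<in>A'. D (g' i))"
    for g :: "nat \<Rightarrow> _" and g' :: "mat \<Rightarrow> _" and A A'
    by (rule additive_on_sum[OF D_add]; simp add: add_subgroup_def)+
  have D_zsc: "D (zsc k h) = zsc k (D h)" for k h
    by (rule zsc_hom[OF D_add]) (simp_all add: add_subgroup_def)
  define p where "p = (\<Sum>i<4. \<Sum>t\<in>TX ! i. zsc (f (i, t)) (lt Gam t (pre i)))"
  have Tc: "t \<in> carrier Gam" if "i < 4" "t \<in> TX ! i" for i t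
    using that Gam.tsysD(3)[OF tsys_all(2), of i t] by (simp add: lengths)
  have sub: "\<forall>K\<in>set KP. K \<subseteq> carrier Gam" using subgroups_all(1) subgroup.subset by blast
  have "p \<in> RL Gam KP"
    unfolding p_def
    by (intro add_subgroup_sum add_subgroup_RL zsc_mem Gam.lt_RL pre_RL sub) (auto intro: Tc)
  moreover have "kal p = f"
  proof -
    have eps: "eps Gam KX i \<in> RL Gam KX" if "i < 4" for i
      using that Gam.eps_RL[OF tsys_all(2)] by (simp add: lengths)
    have "f = D f" using assms(2) by (simp add: D_def)
    also have "\<dots> = D (\<Sum>i<4. \<Sum>t\<in>TX ! i. zsc (f (i, t)) (lt Gam t (eps Gam KX i)))"
      using Gam.RL_expand[OF tsys_all(2) f] by (simp add: lengths)
    also have "\<dots> = (\<Sum>i<4. \<Sum>t\<in>TX ! i. zsc (f (i, t)) (D (lt Gam t (eps Gam KX i))))"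
      by (simp add: D_sum D_zsc)
    also have "\<dots> = (\<Sum>i<4. \<Sum>t\<in>TX ! i. zsc (f (i, t)) (kal (lt Gam t (pre i))))"
    proof (intro sum.cong refl)
      fix i t assume "i \<in> {..<4::nat}" "t \<in> TX ! i"
      then have i: "i < 4" and t: "t \<in> carrier Gam" using Tc by auto
      have "D (lt Gam t (eps Gam KX i)) = kal (lt Gam t (pre i))"
        using D_lt[OF eps[OF i] t] al_pre[OF i] kop_lts(1)[OF pre_RL[OF i] t] by (simp add: D_def)
      then show "zsc (f (i, t)) (D (lt Gam t (eps Gam KX i))) = zsc (f (i, t)) (kal (lt Gam t (pre i)))" by simp
    qed
    also have "\<dots> = kal p" by (simp add: p_def kop_sum kop_zsc)
    finally show ?thesis by simp
  qed
  ultimately show ?thesis by blast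
qed

section \<open>Kernel and divisibility of iota\<close>

lemma io_row_sums: "(\<Sum>t\<leftarrow>TU. ioU t) = 0" "(\<Sum>t\<leftarrow>TU. ioT t) = 0"
  by code_simp+

lemma kio_value:
  assumes "i < 2" "x \<in> carrier Gam"
  shows "kio f (i, x) = (\<Sum>t\<in>set TU. io i 0 (inv\<^bsub>Gam\<^esub> x \<otimes>\<^bsub>Gam\<^esub> t) * f (0, t))"
  using assms by (simp add: kop_def lengths sum_small) (simp add: TV_def)

text \<open>The row sum of the kernel is the same at every \<open>x\<close> by translation, and at
  the identity it is 0.\<close>

lemma kio_const:
  assumes "\<And>x. x \<in> carrier Gam \<Longrightarrow> f (0, x) = c"
  shows "kio f = 0"
proof (rule ext, clarify)
  fix i a1 a2 a3 a4
  define x :: mat where "x = (a1, a2, a3, a4)"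
  have "kio f (i, x) = 0"
  proof (cases "i < 2 \<and> x \<in> carrier Gam")
    case True
    then have "kio f (i, x) = (\<Sum>t\<in>set TU. io i 0 (inv\<^bsub>Gam\<^esub> x \<otimes>\<^bsub>Gam\<^esub> t) * c)"
      using assms TT_carrier(1) by (simp add: kio_value)
    also have "\<dots> = (\<Sum>t\<in>set TU. io i 0 (inv\<^bsub>Gam\<^esub> x \<otimes>\<^bsub>Gam\<^esub> t)) * c" by (simp add: sum_distrib_right)
    also have "(\<Sum>t\<in>set TU. io i 0 (inv\<^bsub>Gam\<^esub> x \<otimes>\<^bsub>Gam\<^esub> t)) = (\<Sum>t\<in>set TU. io i 0 t)"
      by (rule Gam.transversal_sum[OF subgroup_sU transversals(1)])
         (use True binv_io in \<open>auto simp: binv_def lengths KV_def\<close>)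
    also have "\<dots> = 0"
      using True io_row_sums transversal_distinct(1)
      by (auto simp: io_def less_simps sum_list_distinct_conv_sum_set)
    finally show ?thesis by simp
  qed (auto simp: kop_def)
  then show "kio f (i, a1, a2, a3, a4) = 0 (i, a1, a2, a3, a4)" by (simp add: x_def)
qed

lemma kop_delta_value:
  assumes "f \<in> RL Gam KV" "x \<in> carrier Gam"
  shows "(\<Sum>t\<in>set TU. of_bool (inU (mm (mi x) t)) * f (0, t)) = f (0, x)"
proof -
  have "f (0, x) = kop Gam 1 TV (delta KV) f (0, x)"
    using Gam.kop_delta[OF tsys_all(4) assms(1)] by (simp add: lengths)
  also have "\<dots> = (\<Sum>t\<in>set TU. delta KV 0 0 (inv\<^bsub>Gam\<^esub> x \<otimes>\<^bsub>Gam\<^esub> t) * f (0, t))"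
    using assms(2) by (simp add: kop_def lengths) (simp add: TV_def)
  also have "\<dots> = (\<Sum>t\<in>set TU. of_bool (inU (mm (mi x) t)) * f (0, t))"
  proof (rule sum.cong[OF refl])
    fix t assume "t \<in> set TU"
    then have "inv\<^bsub>Gam\<^esub> x \<otimes>\<^bsub>Gam\<^esub> t \<in> carrier Gam" using assms(2) TT_carrier(1) by simp
    from delta_in(4)[OF this, of 0]
    show "delta KV 0 0 (inv\<^bsub>Gam\<^esub> x \<otimes>\<^bsub>Gam\<^esub> t) * f (0, t) = of_bool (inU (mm (mi x) t)) * f (0, t)"
      using assms(2) by (simp add: inv_Gam mult_Gam)
  qed
  finally show ?thesis by simp
qed

abbreviation "jj \<equiv> (F0, F1, F1, F0)"
abbreviation "t2 \<equiv> (F2, F0, F0, F5)"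

lemma mm_assoc: "mm (mm x y) z = mm x (mm y z)"
  by (cases x; cases y; cases z) (simp add: algebra_simps)

lemma mi_mm: "mi (mm x y) = mm (mi y) (mi x)"
  by (cases x; cases y) (simp add: algebra_simps)

lemma mm_carrier: "x \<in> carrier Gam \<Longrightarrow> y \<in> carrier Gam \<Longrightarrow> mm x y \<in> carrier Gam"
  by (metis Gam.m_closed mult_Gam)

lemma ioU_eq: "ioU g = of_bool (inU g) - of_bool (inU (mm (mi t2) g))"
proof -
  obtain a b c d where "g = (a, b, c, d)" by (cases g)
  then show ?thesis by (cases a; cases c) (auto simp: zero_gf8_def)
qed

text \<open>Divisibility of \<open>\<iota> \<psi>\<close> forces \<open>\<psi>\<close> to be constant modulo \<open>m\<close>: the set of right translations
  preserving \<open>\<psi>\<close> modulo \<open>m\<close> is a submonoid, and it contains generators.\<close>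

lemma kio_dvd:
  assumes \<psi>: "\<psi> \<in> RL Gam KV" and dvd: "\<And>i x. m dvd kio \<psi> (i, x)"
    and xy: "x \<in> carrier Gam" "y \<in> carrier Gam"
  shows "m dvd \<psi> (0, x) - \<psi> (0, y)"
proof -
  define N where "N = {g \<in> carrier Gam. \<forall>x\<in>carrier Gam. m dvd \<psi> (0, mm x g) - \<psi> (0, x)}"
  have N_mult: "mm g h \<in> N" if "g \<in> N" "h \<in> N" for g h
  proof -
    have "m dvd \<psi> (0, mm x (mm g h)) - \<psi> (0, x)" if x: "x \<in> carrier Gam" for x
    proof -
      have "m dvd (\<psi> (0, mm (mm x g) h) - \<psi> (0, mm x g)) + (\<psi> (0, mm x g) - \<psi> (0, x))"
        using \<open>g \<in> N\<close> \<open>h \<in> N\<close> x mm_carrier by (intro dvd_add) (auto simp: N_def)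
      then show ?thesis by (simp add: mm_assoc)
    qed
    then show ?thesis using that mm_carrier by (simp add: N_def)
  qed
  have U: "(F1, s, F0, F1) \<in> N" for s
  proof -
    have "(F1, s, F0, F1) \<in> sU" by (simp add: sU_def carrier_Gam inSL_def gf8_simps)
    moreover from this have "\<psi> (0, mm x (F1, s, F0, F1)) = \<psi> (0, x)" if "x \<in> carrier Gam" for x
      using RL_right[OF \<psi>, of 0 x] that by (simp add: KV_def mult_Gam)
    ultimately show ?thesis by (simp add: N_def sU_def)
  qed
  have t2: "t2 \<in> N"
  proof -
    have c: "t2 \<in> carrier Gam" by (simp add: carrier_Gam inSL_def gf8_simps)
    have "m dvd \<psi> (0, mm x t2) - \<psi> (0, x)" if x: "x \<in> carrier Gam" for x
    proof -
      have "kio \<psi> (0, x) = (\<Sum>t\<in>set TU. (of_bool (inU (mm (mi x) t)) - of_bool (inU (mm (mi (mm x t2)) t))) * \<psi> (0, t))"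
        using x TT_carrier(1) unfolding mi_mm
        by (auto simp: kio_value io_def ioU_eq inv_Gam mult_Gam mm_assoc intro!: sum.cong)
      also have "\<dots> = \<psi> (0, x) - \<psi> (0, mm x t2)"
        using kop_delta_value[OF \<psi> x] kop_delta_value[OF \<psi> mm_carrier[OF x c]]
        by (simp add: left_diff_distrib sum_subtractf)
      finally show ?thesis using dvd[of 0 x] by (simp add: dvd_diff_commute)
    qed
    then show ?thesis using c by (simp add: N_def)
  qed
  have J: "jj \<in> N"
  proof -
    have c: "jj \<in> carrier Gam" by (simp add: carrier_Gam inSL_def gf8_simps)
    have "m dvd \<psi> (0, mm x jj) - \<psi> (0, x)" if x: "x \<in> carrier Gam" for x
    proof -
      have "kop Gam 1 TP ce (kio \<psi>) (0, x) = kop Gam 1 TV (conv Gam TP ce io) \<psi> (0, x)"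
        using Gam.kop_comp[OF binv_ce binv_io tsys_all(1,4), of \<psi>] by (simp add: lengths)
      also have "\<dots> = kop Gam 1 TV (\<lambda>i k g. of_bool (inU (mm jj g)) - of_bool (inU g)) \<psi> (0, x)"
      proof (rule fun_cong[OF Gam.kop_cong_transversal[OF tsys_all(4)]])
        fix i k g l assume k: "k < length KV" "g \<in> carrier Gam" "l \<in> KV ! k"
        then have l: "l \<in> sU" "l \<in> carrier Gam" by (auto simp: KV_def sU_def)
        show "conv Gam TP ce io i k (g \<otimes>\<^bsub>Gam\<^esub> l) = conv Gam TP ce io i k g"
          by (rule Gam.conv_right[OF binv_io tsys_all(1) k]) (rule l(2))
        have "inU (mm h l) \<longleftrightarrow> inU h" for h
          using l(1) by (cases h; cases l) (auto simp: sU_def gf8_simps)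
        then show "of_bool (inU (mm jj (g \<otimes>\<^bsub>Gam\<^esub> l))) - of_bool (inU (g \<otimes>\<^bsub>Gam\<^esub> l))
            = (of_bool (inU (mm jj g)) - of_bool (inU g) :: int)"
          by (simp only: mult_Gam mm_assoc[symmetric])
      next
        fix i k g assume "i < (1::nat)" "k < length KV" "g \<in> TV ! k"
        then show "conv Gam TP ce io i k g = of_bool (inU (mm jj g)) - of_bool (inU g)"
          using generation_check[THEN list_allD, of g]
          by (simp add: conv_TP ce_def io_def TV_def lengths)
      qed
      also have "\<dots> = (\<Sum>t\<in>set TU. (of_bool (inU (mm (mi (mm x jj)) t)) - of_bool (inU (mm (mi x) t))) * \<psi> (0, t))"
        using x unfolding mi_mm by (simp add: kop_def lengths inv_Gam mult_Gam mm_assoc) (simp add: TV_def)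
      also have "\<dots> = \<psi> (0, mm x jj) - \<psi> (0, x)"
        using kop_delta_value[OF \<psi> x] kop_delta_value[OF \<psi> mm_carrier[OF x c]]
        by (simp add: left_diff_distrib sum_subtractf)
      finally have "kop Gam 1 TP ce (kio \<psi>) (0, x) = \<psi> (0, mm x jj) - \<psi> (0, x)" .
      moreover have "m dvd kop Gam 1 TP ce (kio \<psi>) (0, x)"
        using dvd by (auto simp: kop_def intro!: dvd_sum)
      ultimately show ?thesis by simp
    qed
    then show ?thesis using c by (simp add: N_def)
  qed
  \<comment> \<open>The element z generates the multiplicative group of order 7, so powers of
    \<open>t2\<close> give all diagonal matrices.\<close>
  have diag: "(a, F0, F0, inverse a) \<in> N" if "a \<noteq> F0" for a
  proof -
    have 4: "(F4, F0, F0, F7) \<in> N" using N_mult[OF t2 t2] by (simp add: zero_gf8_def)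
    have 3: "(F3, F0, F0, F6) \<in> N" using N_mult[OF t2 4] by (simp add: zero_gf8_def)
    have 6: "(F6, F0, F0, F3) \<in> N" using N_mult[OF t2 3] by (simp add: zero_gf8_def)
    have 7: "(F7, F0, F0, F4) \<in> N" using N_mult[OF t2 6] by (simp add: zero_gf8_def)
    have 5: "(F5, F0, F0, F2) \<in> N" using N_mult[OF t2 7] by (simp add: zero_gf8_def)
    show ?thesis using that t2 3 4 5 6 7 U[of F0] by (cases a) auto
  qed
  have all: "g \<in> N" if g: "g \<in> carrier Gam" for g
  proof -
    obtain a b c d where x: "g = (a, b, c, d)" by (cases g)
    have det: "a * d + b * c = 1" using g by (simp add: x carrier_SL2)
    show ?thesis
    proof (cases "c = F0")
      case True
      then have ad: "a * d = 1" "a \<noteq> 0" using det by (auto simp: gf8_simps)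
      then have "d = inverse a" by (metis inverse_unique)
      then have "g = mm (a, F0, F0, inverse a) (F1, inverse a * b, F0, F1)"
        using True ad by (simp add: x gf8_simps mult.assoc[symmetric])
      then show ?thesis using N_mult[OF diag U] ad by (simp add: gf8_simps)
    next
      case False
      then have c: "c \<noteq> 0" by (simp add: gf8_simps)
      have "inverse c * (a * d + b * c) = inverse c" using det by simp
      then have "b + inverse c * (a * d) = inverse c" using c by (simp add: algebra_simps)
      then have "b + inverse c * (a * d) + inverse c * (a * d) = inverse c + inverse c * (a * d)" by simp
      then have b: "b = inverse c + inverse c * (a * d)" by (simp add: add.assoc)
      \<comment> \<open>The Bruhat decomposition of a matrix with nonzero lower left entry:
        unipotent, Weyl element, diagonal, unipotent.\<close>
      have "g = mm (mm (mm (F1, inverse c * a, F0, F1) jj) (c, F0, F0, inverse c)) (F1, inverse c * d, F0, F1)"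
        using c b by (simp add: x gf8_simps algebra_simps)
      then show ?thesis using N_mult N_mult[OF N_mult[OF N_mult[OF U J] diag[OF False]] U] by simp
    qed
  qed
  have "inv\<^bsub>Gam\<^esub> y \<otimes>\<^bsub>Gam\<^esub> x \<in> N" using all xy by simp
  then have "m dvd \<psi> (0, mm y (inv\<^bsub>Gam\<^esub> y \<otimes>\<^bsub>Gam\<^esub> x)) - \<psi> (0, y)" using xy(2) by (simp add: N_def)
  then show ?thesis using xy by (simp flip: mult_Gam)
qed

text \<open>The homotopy gives \<open>1071 f = \<iota> \<psi>\<close>, so \<open>\<psi>\<close> is
  constant modulo 1071. Subtracting its value at the identity does not change
  \<open>\<iota> \<psi>\<close>, and the difference can be divided by 1071.\<close>

lemma ker_al:
  assumes f: "f \<in> RL Gam KP" and "kal f = 0"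
  shows "\<exists>\<psi>\<in>RL Gam KV. kio \<psi> = f"
proof -
  define \<psi> where "\<psi> = kop Gam 1 TP si f"
  have \<psi>: "\<psi> \<in> RL Gam KV" unfolding \<psi>_def by (rule kop_RLs(5))
  have eq: "kio \<psi> = zsc 1071 f" using homotopy[OF f] assms(2) by (simp add: \<psi>_def)
  have d: "1071 dvd \<psi> (0, x) - \<psi> (0, y)" if "x \<in> carrier Gam" "y \<in> carrier Gam" for x y
    by (rule kio_dvd[OF \<psi> _ that]) (simp add: eq)
  define \<psi>1 where "\<psi>1 = (\<lambda>(j, x). if j = (0::nat) \<and> x \<in> carrier Gam then \<psi> (0, \<one>\<^bsub>Gam\<^esub>) else 0)"
  define \<phi> where "\<phi> = (\<lambda>p. (\<psi> p - \<psi>1 p) div 1071)"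
  have \<psi>1: "\<psi>1 \<in> RL Gam KV"
    using subgroup.mem_carrier[OF subgroup_sU] by (auto simp: RL_def \<psi>1_def KV_def)
  have z: "zsc 1071 \<phi> = \<psi> - \<psi>1"
  proof (rule ext, clarify)
    fix j a b c e
    show "zsc 1071 \<phi> (j, a, b, c, e) = (\<psi> - \<psi>1) (j, a, b, c, e)"
    proof (cases "j = 0 \<and> (a, b, c, e) \<in> carrier Gam")
      case True
      then show ?thesis using d[of "(a, b, c, e)" "\<one>\<^bsub>Gam\<^esub>"] by (simp add: \<phi>_def \<psi>1_def)
    next
      case False
      then show ?thesis using RL_zero[OF \<psi>, of j "(a, b, c, e)"] by (auto simp: \<phi>_def \<psi>1_def lengths)
    qed
  qed
  have "\<phi> \<in> RL Gam KV"
  proof -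
    have "\<psi> - \<psi>1 \<in> RL Gam KV" by (rule add_subgroupD(2)[OF add_subgroup_RL \<psi> \<psi>1])
    then show ?thesis by (auto simp: RL_def \<phi>_def)
  qed
  moreover have "kio \<phi> = f"
  proof -
    have "kio \<psi>1 = 0" by (rule kio_const[of _ "\<psi> (0, \<one>\<^bsub>Gam\<^esub>)"]) (simp add: \<psi>1_def)
    then have "zsc 1071 (kio \<phi>) = zsc 1071 f" by (simp add: kop_zsc[symmetric] z kop_diff eq)
    then have "1071 * kio \<phi> p = 1071 * f p" for p by (metis zsc_fun)
    then show ?thesis by (auto simp: fun_eq_iff)
  qed
  ultimately show ?thesis by blast
qed

subsection \<open>Conjugacy classes of subgroups\<close>

context group
begin

lemma transversal_card:
  assumes "subgroup K G" "transversal G K T"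
  shows "card (carrier G) = card T * card K"
proof -
  interpret K: subgroup K G by fact
  have T: "T \<subseteq> carrier G" "\<And>x. x \<in> carrier G \<Longrightarrow> \<exists>!t. t \<in> T \<and> inv t \<otimes> x \<in> K"
    using assms(2) by (auto simp: transversal_def)
  have "bij_betw (\<lambda>(t, k). t \<otimes> k) (T \<times> K) (carrier G)"
    unfolding bij_betw_def
  proof (intro conjI inj_onI equalityI subsetI)
    fix p q assume pq: "p \<in> T \<times> K" "q \<in> T \<times> K" "(\<lambda>(t, k). t \<otimes> k) p = (\<lambda>(t, k). t \<otimes> k) q"
    obtain t k s l where e: "p = (t, k)" "q = (s, l)" by (metis surj_pair)
    have a: "t \<in> T" "k \<in> K" "s \<in> T" "l \<in> K" "t \<otimes> k = s \<otimes> l" using pq by (simp_all add: e)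
    have c: "t \<in> carrier G" "s \<in> carrier G" "k \<in> carrier G" "l \<in> carrier G" using a T(1) by auto
    have "inv t \<otimes> (t \<otimes> k) = k" "inv s \<otimes> (s \<otimes> l) = l" using c by simp_all
    then have "t \<in> T \<and> inv t \<otimes> (t \<otimes> k) \<in> K" "s \<in> T \<and> inv s \<otimes> (t \<otimes> k) \<in> K" using a by auto
    moreover have "\<exists>!u. u \<in> T \<and> inv u \<otimes> (t \<otimes> k) \<in> K" using c by (intro T(2)) simp
    ultimately have "t = s" by (elim ex1E) blast
    then show "p = q" using a c by (simp add: e)
  next
    fix x assume "x \<in> (\<lambda>(t, k). t \<otimes> k) ` (T \<times> K)"
    then show "x \<in> carrier G" using T(1) by auto
  next
    fix x assume x: "x \<in> carrier G"
    obtain t where t: "t \<in> T" "inv t \<otimes> x \<in> K" using T(2)[OF x] by auto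
    then have "(\<lambda>(t, k). t \<otimes> k) (t, inv t \<otimes> x) = x" using x T(1) by auto
    then show "x \<in> (\<lambda>(t, k). t \<otimes> k) ` (T \<times> K)" using t by (metis SigmaI image_eqI)
  qed
  then have "card (carrier G) = card (T \<times> K)" by (metis bij_betw_same_card)
  then show ?thesis by (simp add: card_cartesian_product)
qed

lemma conj_inj: "d \<in> carrier G \<Longrightarrow> inj_on (\<lambda>k. d \<otimes> k \<otimes> inv d) (carrier G)"
  by (rule inj_on_inverseI[of _ "\<lambda>y. inv d \<otimes> y \<otimes> d"]) (simp add: m_assoc)

text \<open>Since the orders agree, one inclusion is enough.\<close>

lemma conj_eqI:
  assumes "finite S" "S \<subseteq> carrier G" "K \<subseteq> carrier G" "card K = card S" "d \<in> carrier G"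
    and "\<And>x. x \<in> K \<Longrightarrow> inv d \<otimes> x \<otimes> d \<in> S"
  shows "K = (\<lambda>k. d \<otimes> k \<otimes> inv d) ` S"
proof (rule card_subset_eq)
  show "K \<subseteq> (\<lambda>k. d \<otimes> k \<otimes> inv d) ` S"
  proof
    fix x assume x: "x \<in> K"
    then have "x = d \<otimes> (inv d \<otimes> x \<otimes> d) \<otimes> inv d" using assms(3,5) by (auto simp: m_assoc)
    then show "x \<in> (\<lambda>k. d \<otimes> k \<otimes> inv d) ` S" using assms(6)[OF x] by blast
  qed
  have "inj_on (\<lambda>k. d \<otimes> k \<otimes> inv d) S"
    using inj_on_subset[OF conj_inj[OF assms(5)] assms(2)] .
  then show "card K = card ((\<lambda>k. d \<otimes> k \<otimes> inv d) ` S)" using assms(4) by (simp add: card_image)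
qed (use assms(1) in simp)

lemma subgroup_pow_card:
  assumes "subgroup K G" "finite K" "x \<in> K"
  shows "x [^] card K = \<one>"
proof -
  interpret K: group "G\<lparr>carrier := K\<rparr>" using assms(1) by (rule subgroup_imp_group)
  have "x [^]\<^bsub>G\<lparr>carrier := K\<rparr>\<^esub> order (G\<lparr>carrier := K\<rparr>) = \<one>\<^bsub>G\<lparr>carrier := K\<rparr>\<^esub>"
    using K.pow_order_eq_1 assms(2,3) by simp
  then show ?thesis by (simp add: order_def nat_pow_consistent[symmetric])
qed

lemma pow_2: "x \<in> carrier G \<Longrightarrow> x [^] (2::nat) = x \<otimes> x"
  by (simp add: numeral_2_eq_2)

lemma pow_3: "x \<in> carrier G \<Longrightarrow> x [^] (3::nat) = x \<otimes> (x \<otimes> x)"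
  by (simp add: numeral_3_eq_3 m_assoc)

end

lemma set_KU: "set KU = sU" and set_KC: "set KC = sC" and set_KS: "set KS = sS"
proof -
  have "list_all (\<lambda>g. inSL g \<and> inU g) KU" "list_all (\<lambda>g. inSL g \<and> inC g) KC" "list_all (\<lambda>g. inSL g \<and> inS g) KS"
    by code_simp+
  then have "set KU \<subseteq> sU" "set KC \<subseteq> sC" "set KS \<subseteq> sS"
    unfolding list_all_iff sU_def sC_def sS_def carrier_Gam by blast+
  then show "set KU = sU" "set KC = sC" "set KS = sS" using member_lists by blast+
qed

lemma card_subgroups: "card sU = 8" "card sC = 9" "card sS = 6"
proof -
  have "distinct KU" "distinct KC" "distinct KS" "length KU = 8" "length KC = 9" "length KS = 6" by code_simp+
  then show "card sU = 8" "card sC = 9" "card sS = 6"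
    unfolding set_KU[symmetric] set_KC[symmetric] set_KS[symmetric] by (simp_all add: distinct_card)
qed

lemma card_Gam: "card (carrier Gam) = 504"
proof -
  have "length TU = 63" by code_simp
  then have "card (set TU) = 63" using transversal_distinct(1) distinct_card by metis
  then show ?thesis using Gam.transversal_card[OF subgroup_sU transversals(1)] card_subgroups by simp
qed

definition sq :: "mat \<Rightarrow> mat" where "sq x = mm x x"

abbreviation "e1 \<equiv> (F1, F0, F0, F1)"
abbreviation "u1 \<equiv> (F1, F1, F0, F1)"
abbreviation "y0 \<equiv> (F0, F1, F1, F1)"

text \<open>U is the centralizer of the involution \<open>u1\<close>, and C that of the element
  \<open>y0\<close> of order 3. As all involutions are conjugate, and all elements of order 3 too, a
  commutative subgroup containing such an element lies in a conjugate of U or of C.\<close>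

lemma class_checks:
  "forall_elems (\<lambda>x. sq (sq (sq x)) = e1 \<longrightarrow> sq x = e1)"
  "forall_elems (\<lambda>b. sq b = e1 \<longrightarrow> b = e1 \<or> list_ex (\<lambda>t. b = mm (mm t u1) (mi t)) TU)"
  "forall_elems (\<lambda>x. mm x u1 = mm u1 x \<longrightarrow> inU x)"
  "forall_elems (\<lambda>a. mm a (sq a) = e1 \<longrightarrow> a = e1 \<or> list_ex (\<lambda>t. a = mm (mm t y0) (mi t)) TC)"
  "forall_elems (\<lambda>x. mm x y0 = mm y0 x \<longrightarrow> inC x)"
  by code_simp+

text \<open>The elements of a subgroup of order 6 that contains \<open>y0\<close> and the involution
  \<open>b\<close>.\<close>

definition s3list :: "mat \<Rightarrow> mat list" where
  "s3list b = [e1, y0, sq y0, b, mm y0 b, mm (sq y0) b]"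

text \<open>Membership of the product of \<open>b\<close> and \<open>y0\<close> forces
  \<open>b\<close> to invert \<open>y0\<close>, because the centralizer C of \<open>y0\<close> has
  odd order. The nine involutions that invert \<open>y0\<close> are conjugate under C, and some of
  them lie in SL_2(2).\<close>

lemma s3_checks:
  "forall_elems (\<lambda>b. sq b = e1 \<longrightarrow> b = e1 \<or> distinct (s3list b))"
  "forall_elems (\<lambda>b. sq b = e1 \<longrightarrow> b = e1 \<or> \<not> List.member (s3list b) (mm b y0) \<or>
     list_ex (\<lambda>k. list_all (\<lambda>x. inS (mm (mm k x) (mi k))) (s3list b)) KC)"
  by code_simp+

lemma normalizer_checks:
  "forall_elems (\<lambda>g. inU (mm (mm g u1) (mi g)) \<longrightarrow> inB g)"
  "forall_elems (\<lambda>g. inB g \<longrightarrow> list_all (\<lambda>u. inU (mm (mm g u) (mi g))) KU)"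
  by code_simp+

lemma T_Gam: "t \<in> set TU \<Longrightarrow> t \<in> carrier Gam" "t \<in> set TC \<Longrightarrow> t \<in> carrier Gam"
  by (rule TT_carrier; assumption)+

lemma conj_mm: "t \<in> carrier Gam \<Longrightarrow> t \<otimes>\<^bsub>Gam\<^esub> x \<otimes>\<^bsub>Gam\<^esub> inv\<^bsub>Gam\<^esub> t = mm (mm t x) (mi t)"
  by (simp add: mult_Gam inv_Gam)

lemma centralizer_conj:
  assumes "t \<in> carrier Gam" "z \<in> carrier Gam" "b = t \<otimes>\<^bsub>Gam\<^esub> z \<otimes>\<^bsub>Gam\<^esub> inv\<^bsub>Gam\<^esub> t"
    and "x \<in> carrier Gam" "x \<otimes>\<^bsub>Gam\<^esub> b = b \<otimes>\<^bsub>Gam\<^esub> x"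
  shows "mm (inv\<^bsub>Gam\<^esub> t \<otimes>\<^bsub>Gam\<^esub> x \<otimes>\<^bsub>Gam\<^esub> t) z = mm z (inv\<^bsub>Gam\<^esub> t \<otimes>\<^bsub>Gam\<^esub> x \<otimes>\<^bsub>Gam\<^esub> t)"
proof -
  have "inv\<^bsub>Gam\<^esub> t \<otimes>\<^bsub>Gam\<^esub> (x \<otimes>\<^bsub>Gam\<^esub> b) \<otimes>\<^bsub>Gam\<^esub> t = inv\<^bsub>Gam\<^esub> t \<otimes>\<^bsub>Gam\<^esub> (b \<otimes>\<^bsub>Gam\<^esub> x) \<otimes>\<^bsub>Gam\<^esub> t"
    using assms(5) by simp
  then show ?thesis
    using assms(1,2,4) by (simp add: assms(3) Gam.m_assoc flip: mult_Gam)
qed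

text \<open>A subgroup of order 8 has exponent 2 here and is therefore commutative. So it lies in
  the centralizer of any of its involutions, which is a conjugate of U.\<close>

lemma conj_sU:
  assumes K: "subgroup K Gam" and card: "card K = 8"
  obtains d where "d \<in> carrier Gam" "K = (\<lambda>k. d \<otimes>\<^bsub>Gam\<^esub> k \<otimes>\<^bsub>Gam\<^esub> inv\<^bsub>Gam\<^esub> d) ` sU"
proof -
  interpret K: subgroup K Gam by fact
  have fin: "finite K" using card card_eq_0_iff by fastforce
  have inv2: "x \<otimes>\<^bsub>Gam\<^esub> x = \<one>\<^bsub>Gam\<^esub>" if "x \<in> K" for x
  proof -
    have x: "x \<in> carrier Gam" using that by simp
    have "x [^]\<^bsub>Gam\<^esub> (8::nat) = ((x [^]\<^bsub>Gam\<^esub> (2::nat)) [^]\<^bsub>Gam\<^esub> (2::nat)) [^]\<^bsub>Gam\<^esub> (2::nat)"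
      using x by (simp add: Gam.nat_pow_pow)
    also have "\<dots> = sq (sq (sq x))" using x Gam.m_closed by (simp add: Gam.pow_2 mult_Gam[symmetric] sq_def)
    finally have "sq (sq (sq x)) = e1"
      using Gam.subgroup_pow_card[OF K fin that] card by (simp add: one_Gam)
    then show ?thesis using forall_elemsD[OF class_checks(1) x] by (simp add: sq_def mult_Gam one_Gam)
  qed
  have comm: "x \<otimes>\<^bsub>Gam\<^esub> y = y \<otimes>\<^bsub>Gam\<^esub> x" if "x \<in> K" "y \<in> K" for x y
  proof -
    have c: "x \<in> carrier Gam" "y \<in> carrier Gam" using that by auto
    have i: "inv\<^bsub>Gam\<^esub> z = z" if "z \<in> K" for z
      using inv2[OF that] that by (intro Gam.inv_equality) auto
    have "inv\<^bsub>Gam\<^esub> (x \<otimes>\<^bsub>Gam\<^esub> y) = x \<otimes>\<^bsub>Gam\<^esub> y" using that by (intro i) auto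
    then show ?thesis using Gam.inv_mult_group[OF c] i that by simp
  qed
  have "K \<noteq> {\<one>\<^bsub>Gam\<^esub>}" using card by auto
  then obtain b where b: "b \<in> K" "b \<noteq> \<one>\<^bsub>Gam\<^esub>" using K.one_closed by blast
  have "sq b = e1" using inv2[OF b(1)] by (simp add: sq_def mult_Gam one_Gam)
  then obtain t where t: "t \<in> set TU" "b = mm (mm t u1) (mi t)"
    using forall_elemsD[OF class_checks(2), of b] b by (auto simp: one_Gam list_ex_iff)
  have tc: "t \<in> carrier Gam" using T_Gam(1)[OF t(1)] .
  have uc: "u1 \<in> carrier Gam" by (simp add: carrier_Gam inSL_def gf8_simps)
  have "inv\<^bsub>Gam\<^esub> t \<otimes>\<^bsub>Gam\<^esub> x \<otimes>\<^bsub>Gam\<^esub> t \<in> sU" if "x \<in> K" for x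
  proof -
    have x: "x \<in> carrier Gam" using that by simp
    have "inU (inv\<^bsub>Gam\<^esub> t \<otimes>\<^bsub>Gam\<^esub> x \<otimes>\<^bsub>Gam\<^esub> t)"
      using forall_elemsD[OF class_checks(3), of "inv\<^bsub>Gam\<^esub> t \<otimes>\<^bsub>Gam\<^esub> x \<otimes>\<^bsub>Gam\<^esub> t"]
        centralizer_conj[OF tc uc _ x comm[OF that b(1)]] t(2) conj_mm[OF tc] tc x by simp
    then show ?thesis using tc x by (simp add: sU_def)
  qed
  then have "K = (\<lambda>k. t \<otimes>\<^bsub>Gam\<^esub> k \<otimes>\<^bsub>Gam\<^esub> inv\<^bsub>Gam\<^esub> t) ` sU"
    using card card_subgroups(1) tc K.subset subgroup.subset[OF subgroup_sU]
    by (intro Gam.conj_eqI) (auto intro: finite_subset[OF _ finite_Gam])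
  then show thesis using that tc by blast
qed

lemma conj_sC:
  assumes K: "subgroup K Gam" and card: "card K = 9"
    and comm: "\<And>x y. x \<in> K \<Longrightarrow> y \<in> K \<Longrightarrow> x \<otimes>\<^bsub>Gam\<^esub> y = y \<otimes>\<^bsub>Gam\<^esub> x"
  obtains d where "d \<in> carrier Gam" "K = (\<lambda>k. d \<otimes>\<^bsub>Gam\<^esub> k \<otimes>\<^bsub>Gam\<^esub> inv\<^bsub>Gam\<^esub> d) ` sC"
proof -
  interpret K: subgroup K Gam by fact
  have fin: "finite K" using card card_eq_0_iff by fastforce
  have "K \<noteq> {\<one>\<^bsub>Gam\<^esub>}" using card by auto
  then obtain x where x: "x \<in> K" "x \<noteq> \<one>\<^bsub>Gam\<^esub>" using K.one_closed by blast
  have xc: "x \<in> carrier Gam" using x by simp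
  define x3 where "x3 = x [^]\<^bsub>Gam\<^esub> (3::nat)"
  have x3: "x3 \<in> K" using x(1) by (simp add: x3_def Gam.pow_3 xc)
  have "x3 [^]\<^bsub>Gam\<^esub> (3::nat) = \<one>\<^bsub>Gam\<^esub>"
    using Gam.subgroup_pow_card[OF K fin x(1)] card xc by (simp add: x3_def Gam.nat_pow_pow)
  \<comment> \<open>Take \<open>x\<close> if its cube is trivial and the cube otherwise; the ninth
    power is trivial in any case.\<close>
  then obtain b where b: "b \<in> K" "b \<noteq> \<one>\<^bsub>Gam\<^esub>" "b [^]\<^bsub>Gam\<^esub> (3::nat) = \<one>\<^bsub>Gam\<^esub>"
    using x x3 unfolding x3_def by blast
  have bc: "b \<in> carrier Gam" using b(1) by simp
  have "mm b (sq b) = e1" using b(3) bc by (simp add: Gam.pow_3 sq_def mult_Gam one_Gam)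
  then obtain t where t: "t \<in> set TC" "b = mm (mm t y0) (mi t)"
    using forall_elemsD[OF class_checks(4) bc] b by (auto simp: one_Gam list_ex_iff)
  have tc: "t \<in> carrier Gam" using T_Gam(2)[OF t(1)] .
  have yc: "y0 \<in> carrier Gam" by (simp add: carrier_Gam inSL_def gf8_simps)
  have "inv\<^bsub>Gam\<^esub> t \<otimes>\<^bsub>Gam\<^esub> x \<otimes>\<^bsub>Gam\<^esub> t \<in> sC" if "x \<in> K" for x
  proof -
    have x: "x \<in> carrier Gam" using that by simp
    have "inC (inv\<^bsub>Gam\<^esub> t \<otimes>\<^bsub>Gam\<^esub> x \<otimes>\<^bsub>Gam\<^esub> t)"
      using forall_elemsD[OF class_checks(5), of "inv\<^bsub>Gam\<^esub> t \<otimes>\<^bsub>Gam\<^esub> x \<otimes>\<^bsub>Gam\<^esub> t"]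
        centralizer_conj[OF tc yc _ x comm[OF that b(1)]] t(2) conj_mm[OF tc] tc x by simp
    then show ?thesis using tc x by (simp add: sC_def)
  qed
  then have "K = (\<lambda>k. t \<otimes>\<^bsub>Gam\<^esub> k \<otimes>\<^bsub>Gam\<^esub> inv\<^bsub>Gam\<^esub> t) ` sC"
    using card card_subgroups(2) tc K.subset subgroup.subset[OF subgroup_sC]
    by (intro Gam.conj_eqI) (auto intro: finite_subset[OF _ finite_Gam])
  then show thesis using that tc by blast
qed

text \<open>Cauchy's theorem, from the existence of a subgroup of order \<open>p ^ 1\<close> in
  Sylow's theorem.\<close>

lemma cauchy_element:
  assumes K: "subgroup K Gam" and "card K = p * m" "Factorial_Ring.prime p"
  obtains x where "x \<in> K" "x \<noteq> \<one>\<^bsub>Gam\<^esub>" "x [^]\<^bsub>Gam\<^esub> p = \<one>\<^bsub>Gam\<^esub>"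
proof -
  have fin: "finite K" using finite_subset[OF subgroup.subset[OF K] finite_Gam] .
  interpret K: group "Gam\<lparr>carrier := K\<rparr>" using K by (rule Gam.subgroup_imp_group)
  obtain L where L: "subgroup L (Gam\<lparr>carrier := K\<rparr>)" "card L = p ^ 1"
    using sylow_thm[OF assms(3) K.is_group, of 1 m] assms(2) fin by (auto simp: order_def)
  have LK: "L \<subseteq> K" using subgroup.subset[OF L(1)] by simp
  have LG: "subgroup L Gam" using Gam.incl_subgroup[OF K L(1)] .
  have "card L \<noteq> 1" using L(2) assms(3) prime_gt_1_nat by fastforce
  then have "L \<noteq> {\<one>\<^bsub>Gam\<^esub>}" by auto
  then obtain x where x: "x \<in> L" "x \<noteq> \<one>\<^bsub>Gam\<^esub>" using subgroup.one_closed[OF LG] by blast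
  then show thesis using that[of x] Gam.subgroup_pow_card[OF LG _ x(1)] L(2) LK finite_subset[OF LK fin] by auto
qed

text \<open>Conjugate an element of order 3 to \<open>y0\<close>; then conjugate by an element of C,
  which fixes \<open>y0\<close> and brings the involution into SL_2(2).\<close>

lemma conj_sS:
  assumes K: "subgroup K Gam" and card: "card K = 6"
  obtains d where "d \<in> carrier Gam" "K = (\<lambda>k. d \<otimes>\<^bsub>Gam\<^esub> k \<otimes>\<^bsub>Gam\<^esub> inv\<^bsub>Gam\<^esub> d) ` sS"
proof -
  interpret K: subgroup K Gam by fact
  have fin: "finite K" using card card_eq_0_iff by fastforce
  obtain a where a: "a \<in> K" "a \<noteq> \<one>\<^bsub>Gam\<^esub>" "a [^]\<^bsub>Gam\<^esub> (3::nat) = \<one>\<^bsub>Gam\<^esub>"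
    by (rule cauchy_element[OF K, of 3 2]) (simp_all add: card)
  obtain b0 where b0: "b0 \<in> K" "b0 \<noteq> \<one>\<^bsub>Gam\<^esub>" "b0 [^]\<^bsub>Gam\<^esub> (2::nat) = \<one>\<^bsub>Gam\<^esub>"
    by (rule cauchy_element[OF K, of 2 3]) (simp_all add: card)
  have ac: "a \<in> carrier Gam" "b0 \<in> carrier Gam" using a b0 by auto
  have "mm a (sq a) = e1" using a(3) ac by (simp add: Gam.pow_3 sq_def mult_Gam one_Gam)
  then obtain t where t: "t \<in> set TC" "a = mm (mm t y0) (mi t)"
    using forall_elemsD[OF class_checks(4) ac(1)] a by (auto simp: one_Gam list_ex_iff)
  have tc: "t \<in> carrier Gam" using T_Gam(2)[OF t(1)] .
  have yc: "y0 \<in> carrier Gam" by (simp add: carrier_Gam inSL_def gf8_simps)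
  define c where "c x = inv\<^bsub>Gam\<^esub> t \<otimes>\<^bsub>Gam\<^esub> x \<otimes>\<^bsub>Gam\<^esub> t" for x
  have c_mult: "c (x \<otimes>\<^bsub>Gam\<^esub> y) = mm (c x) (c y)" if "x \<in> K" "y \<in> K" for x y
    using that tc by (simp add: c_def Gam.m_assoc flip: mult_Gam)
  have c_inj: "inj_on c K"
    unfolding c_def using tc by (intro inj_on_inverseI[of _ "\<lambda>y. t \<otimes>\<^bsub>Gam\<^esub> y \<otimes>\<^bsub>Gam\<^esub> inv\<^bsub>Gam\<^esub> t"]) (simp add: Gam.m_assoc)
  have ca: "c a = y0"
    unfolding c_def t(2) conj_mm[OF tc, symmetric] using tc yc by (simp add: Gam.m_assoc)
  have c1: "c \<one>\<^bsub>Gam\<^esub> = e1" using tc by (simp add: c_def one_Gam[symmetric])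
  define b where "b = c b0"
  have bc: "b \<in> carrier Gam" using ac tc by (simp add: b_def c_def)
  have b2: "sq b = e1" using c_mult[OF b0(1) b0(1)] b0(3) ac c1 by (simp add: b_def sq_def Gam.pow_2)
  have b1: "b \<noteq> e1" using inj_onD[OF c_inj, of b0 "\<one>\<^bsub>Gam\<^esub>"] b0 c1 by (auto simp: b_def)
  have mem: "x \<in> c ` K \<Longrightarrow> y \<in> c ` K \<Longrightarrow> mm x y \<in> c ` K" for x y
    using c_mult[symmetric] K.m_closed by (elim imageE) simp
  have y: "y0 \<in> c ` K" "b \<in> c ` K" "e1 \<in> c ` K"
    using imageI[OF a(1), of c] imageI[OF b0(1), of c] imageI[OF K.one_closed, of c] ca c1 by (simp_all add: b_def)
  have sub: "set (s3list b) \<subseteq> c ` K" 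
    unfolding s3list_def sq_def using y mem[OF y(1,2)] mem[OF y(1,1)] mem[OF mem[OF y(1,1)] y(2)]
    by (simp only: set_simps insert_subset empty_subsetI)
  have "distinct (s3list b)" using forall_elemsD[OF s3_checks(1) bc] b1 b2 by simp
  then have "card (set (s3list b)) = 6" by (simp add: distinct_card s3list_def)
  moreover have "card (c ` K) = 6" using card c_inj by (simp add: card_image)
  ultimately have cK: "c ` K = set (s3list b)" using sub fin by (metis card_subset_eq finite_imageI)
  have "List.member (s3list b) (mm b y0)" using mem[OF y(2,1)] by (simp add: cK)
  then have "list_ex (\<lambda>k. list_all (\<lambda>x. inS (mm (mm k x) (mi k))) (s3list b)) KC"
    using forall_elemsD[OF s3_checks(2) bc] b1 b2 by argo
  then obtain k where k: "k \<in> set KC" "\<And>x. x \<in> set (s3list b) \<Longrightarrow> inS (mm (mm k x) (mi k))"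
    unfolding list_ex_iff list_all_iff by (elim bexE) (rule that, assumption, drule bspec)
  have "k \<in> sC" using k(1) by (simp only: set_KC)
  then have kc: "k \<in> carrier Gam" by (rule subgroup.mem_carrier[OF subgroup_sC])
  define d where "d = t \<otimes>\<^bsub>Gam\<^esub> inv\<^bsub>Gam\<^esub> k"
  have dc: "d \<in> carrier Gam" using tc kc by (simp add: d_def)
  have "inv\<^bsub>Gam\<^esub> d \<otimes>\<^bsub>Gam\<^esub> x \<otimes>\<^bsub>Gam\<^esub> d \<in> sS" if x: "x \<in> K" for x
  proof -
    have "inv\<^bsub>Gam\<^esub> d \<otimes>\<^bsub>Gam\<^esub> x \<otimes>\<^bsub>Gam\<^esub> d = k \<otimes>\<^bsub>Gam\<^esub> c x \<otimes>\<^bsub>Gam\<^esub> inv\<^bsub>Gam\<^esub> k"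
      using x tc kc by (simp add: d_def c_def Gam.m_assoc Gam.inv_mult_group)
    also have "\<dots> = mm (mm k (c x)) (mi k)" using conj_mm[OF kc] .
    finally have "inS (inv\<^bsub>Gam\<^esub> d \<otimes>\<^bsub>Gam\<^esub> x \<otimes>\<^bsub>Gam\<^esub> d)" using k(2)[of "c x"] cK x by auto
    then show ?thesis using dc x by (simp add: sS_def)
  qed
  then have "K = (\<lambda>k. d \<otimes>\<^bsub>Gam\<^esub> k \<otimes>\<^bsub>Gam\<^esub> inv\<^bsub>Gam\<^esub> d) ` sS"
    using card card_subgroups(3) dc K.subset subgroup.subset[OF subgroup_sS]
    by (intro Gam.conj_eqI) (auto intro: finite_subset[OF _ finite_Gam])
  then show thesis using that dc by blast
qed

text \<open>It suffices to look at the single element \<open>u1\<close>: a matrix that conjugates it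
  into U is already upper triangular.\<close>

lemma normalizer_sU:
  assumes "x \<in> carrier Gam"
  shows "(\<lambda>k. x \<otimes>\<^bsub>Gam\<^esub> k \<otimes>\<^bsub>Gam\<^esub> inv\<^bsub>Gam\<^esub> x) ` sU = sU \<longleftrightarrow> x \<in> sB"
proof
  assume eq: "(\<lambda>k. x \<otimes>\<^bsub>Gam\<^esub> k \<otimes>\<^bsub>Gam\<^esub> inv\<^bsub>Gam\<^esub> x) ` sU = sU"
  have "u1 \<in> sU" by (simp add: sU_def carrier_Gam inSL_def gf8_simps)
  then have "mm (mm x u1) (mi x) \<in> sU" using eq conj_mm[OF assms] by auto
  then show "x \<in> sB" using forall_elemsD[OF normalizer_checks(1) assms] assms by (simp add: sB_def sU_def)
next
  assume x: "x \<in> sB"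
  have "mm (mm x u) (mi x) \<in> sU" if "u \<in> sU" for u
  proof -
    have "inU (mm (mm x u) (mi x))"
      using forall_elemsD[OF normalizer_checks(2) assms] x member_lists(1)[OF that] by (auto simp: sB_def list_all_iff)
    moreover have "mm (mm x u) (mi x) \<in> carrier Gam"
      unfolding conj_mm[OF assms, symmetric] using assms that subgroup.mem_carrier[OF subgroup_sU] by simp
    ultimately show ?thesis by (simp add: sU_def)
  qed
  then have sub: "(\<lambda>k. x \<otimes>\<^bsub>Gam\<^esub> k \<otimes>\<^bsub>Gam\<^esub> inv\<^bsub>Gam\<^esub> x) ` sU \<subseteq> sU" using conj_mm[OF assms] by auto
  have "inj_on (\<lambda>k. x \<otimes>\<^bsub>Gam\<^esub> k \<otimes>\<^bsub>Gam\<^esub> inv\<^bsub>Gam\<^esub> x) sU"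
    using inj_on_subset[OF Gam.conj_inj[OF assms] subgroup.subset[OF subgroup_sU]] .
  then show "(\<lambda>k. x \<otimes>\<^bsub>Gam\<^esub> k \<otimes>\<^bsub>Gam\<^esub> inv\<^bsub>Gam\<^esub> x) ` sU = sU"
    using sub finite_subset[OF subgroup.subset[OF subgroup_sU] finite_Gam] endo_inj_surj by blast
qed

subsection \<open>Pulling back lattices\<close>

text \<open>The underlying group is kept and only the action is restricted along
  \<open>\<theta>\<close>, so maps constructed over the model are used unchanged.\<close>

definition pull :: "('g \<Rightarrow> 'h) \<Rightarrow> ('h,'v) glat \<Rightarrow> ('g,'v) glat" where
  "pull \<theta> L = (fst L, \<lambda>g. snd L (\<theta> g))"

lemma fst_pull [simp]: "fst (pull \<theta> L) = fst L" and snd_pull [simp]: "snd (pull \<theta> L) g = snd L (\<theta> g)"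
  by (simp_all add: pull_def)

lemma pull_dsum: "pull \<theta> (L \<oplus>\<^sub>L N) = pull \<theta> L \<oplus>\<^sub>L pull \<theta> N"
  by (simp add: pull_def dsum_def)

lemma ghom_pull: "\<theta> \<in> hom G G' \<Longrightarrow> ghom G' L N f \<Longrightarrow> ghom G (pull \<theta> L) (pull \<theta> N) f"
  by (simp add: ghom_def hom_in_carrier)

lemma glat_iso_pull: "\<theta> \<in> hom G G' \<Longrightarrow> glat_iso G' L N \<Longrightarrow> glat_iso G (pull \<theta> L) (pull \<theta> N)"
  unfolding glat_iso_def using ghom_pull by fastforce

lemma glat_ok_pull: "\<theta> \<in> hom G G' \<Longrightarrow> glat_ok G' L \<Longrightarrow> glat_ok G (pull \<theta> L)"
  by (simp add: glat_ok_def hom_in_carrier)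

lemma is_glat_pull:
  assumes "\<theta> \<in> hom G G'" "group G" "group G'" "is_glat G' L"
  shows "is_glat G (pull \<theta> L)"
  using assms(4) hom_in_carrier[OF assms(1)] hom_mult[OF assms(1)] hom_one[OF assms(1,2,3)]
  by (auto simp: is_glat_def pull_def)

lemma glat_iso_dsum_comm: "glat_iso G (L \<oplus>\<^sub>L N) (N \<oplus>\<^sub>L L)"
  by (rule glat_isoI[of _ _ _ prod.swap prod.swap]) (auto simp: ghom_def dsum_def)

lemma glat_iso_dsum_assoc: "glat_iso G ((L \<oplus>\<^sub>L N) \<oplus>\<^sub>L K) (L \<oplus>\<^sub>L (N \<oplus>\<^sub>L K))"
  by (rule glat_isoI[of _ _ _ "\<lambda>((x, y), z). (x, (y, z))" "\<lambda>(x, (y, z)). ((x, y), z)"])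
     (auto simp: ghom_def dsum_def)

lemma is_glat_glat_iso: "is_glat G L \<Longrightarrow> glat_iso G L N \<Longrightarrow> group G \<Longrightarrow> is_glat G N"
  by (auto simp: glat_iso_def intro: is_glat_iso)

lemma flabby_iso:
  assumes "glat_iso G L N" "glat_ok G L" "glat_ok G N" "flabby G L"
  shows "flabby G N"
proof -
  obtain f k where "ghom G L N f" "ghom G N L k" "\<And>y. y \<in> fst N \<Longrightarrow> f (k y) = y"
    using glat_isoE[OF assms(1,2)] by metis
  then show ?thesis using flabby_retract[of G N L k f] assms by simp
qed

lemma natlat_glat_iso:
  fixes L :: "('g, 'i::countable \<Rightarrow> int) glat"
  shows "glat_iso G L (natlat L)" "glat_iso G (natlat L) L"
proof -
  have tn: "tonat (\<lambda>i :: 'i. y (to_nat i)) = y" if "y \<in> fst (natlat L)" for y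
    using that by (auto simp: natlat_def tonat_inverse)
  show "glat_iso G L (natlat L)" by (rule glat_isoI[OF ghom_natlat]) (simp_all only: tonat_inverse tn)
  show "glat_iso G (natlat L) L" by (rule glat_isoI[OF ghom_natlat(2,1)]) (simp_all only: tonat_inverse tn)
qed

definition reindex :: "('a,'b) monoid_scheme \<Rightarrow> ('a \<Rightarrow> 'c) \<Rightarrow> (nat \<times> 'c \<Rightarrow> int) \<Rightarrow> nat \<times> 'a \<Rightarrow> int" where
  "reindex G \<theta> f = (\<lambda>(j, x). if x \<in> carrier G then f (j, \<theta> x) else 0)"

lemma reindex_RL:
  fixes G (structure)
  assumes "\<theta> \<in> hom G G'" "f \<in> RL G' Ks'" "length Ks' = length Ks"
    and "\<And>j. j < length Ks \<Longrightarrow> Ks ! j \<subseteq> carrier G \<and> \<theta> ` (Ks ! j) \<subseteq> Ks' ! j" "group G"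
  shows "reindex G \<theta> f \<in> RL G Ks"
proof -
  interpret group G by fact
  have "f (j, \<theta> (x \<otimes> k)) = f (j, \<theta> x)" if "j < length Ks" "x \<in> carrier G" "k \<in> Ks ! j" for j x k
  proof -
    have "k \<in> carrier G" "\<theta> k \<in> Ks' ! j" using assms(4)[OF that(1)] that(3) by auto
    then show ?thesis
      using RL_right[OF assms(2), of j "\<theta> x" "\<theta> k"] that assms(3) hom_mult[OF assms(1), of x k]
        hom_in_carrier[OF assms(1)] by simp
  qed
  moreover have "x \<otimes> k \<in> carrier G" if "j < length Ks" "x \<in> carrier G" "k \<in> Ks ! j" for j x k
    using assms(4)[OF that(1)] that by auto
  ultimately show ?thesis
    using RL_zero[OF assms(2)] assms(3) by (auto simp: RL_def reindex_def)
qed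

lemma reindex_lt:
  fixes G (structure)
  assumes "\<theta> \<in> hom G G'" "group G" "group G'" "g \<in> carrier G"
  shows "reindex G \<theta> (lt G' (\<theta> g) f) = lt G g (reindex G \<theta> f)"
proof -
  interpret group_hom G G' \<theta> by (rule group_hom.intro) (use assms in \<open>simp_all add: group_hom_axioms_def\<close>)
  show ?thesis using assms(4) by (auto simp: reindex_def lt_def fun_eq_iff)
qed

lemma reindex_add: "reindex G \<theta> (f + f') = reindex G \<theta> f + reindex G \<theta> f'"
  by (auto simp: reindex_def fun_eq_iff)

lemma reindex_inverse:
  assumes "f \<in> RL G' Ks" "\<And>y. y \<in> carrier G' \<Longrightarrow> \<Theta> y \<in> carrier G \<and> \<theta> (\<Theta> y) = y"
  shows "reindex G' \<Theta> (reindex G \<theta> f) = f"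
  using assms(2) RL_zero[OF assms(1)] by (auto simp: reindex_def fun_eq_iff)

subsection \<open>The Chevalley module\<close>

definition ind :: "'c \<Rightarrow> 'c \<Rightarrow> int" where "ind S C = of_bool (C = S)"

text \<open>The augmentation ideal is spanned by the differences xH - H, so a functional is known
  from its values there. These form the representative, vanishing at the identity, of a class of
  invariant functions modulo constants.\<close>

definition chev_fun :: "('g,'b) monoid_scheme \<Rightarrow> 'g set \<Rightarrow> (('g set \<Rightarrow> int) \<Rightarrow> int) \<Rightarrow> nat \<times> 'g \<Rightarrow> int" where
  "chev_fun G H \<phi> = (\<lambda>(j, x). if j = 0 \<and> x \<in> carrier G then \<phi> (ind (x <#\<^bsub>G\<^esub> H) - ind H) else 0)"

lemma fst_chevalley: "fst (chevalley G H) = {\<phi>. additive_on (fst (aug_lat G H)) \<phi> \<and> (\<forall>x. x \<notin> fst (aug_lat G H) \<longrightarrow> \<phi> x = 0)}"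
  by (simp add: chevalley_def dual_lat_def additive_on_def)

text \<open>One inversion comes from the dual action and one from the action on functions of
  cosets.\<close>

lemma snd_chevalley: "snd (chevalley G H) g \<phi> f =
   (if f \<in> fst (aug_lat G H) then \<phi> (\<lambda>C. if C \<in> LCOSETS G H then f (inv\<^bsub>G\<^esub> (inv\<^bsub>G\<^esub> g) <#\<^bsub>G\<^esub> C) else 0) else 0)"
  by (simp add: chevalley_def dual_lat_def) (simp add: aug_lat_def coset_lat_def)

lemma fst_aug_lat: "fst (aug_lat G H) = {f. (\<forall>C. C \<notin> LCOSETS G H \<longrightarrow> f C = 0) \<and> (\<Sum>C\<in>LCOSETS G H. f C) = 0}"
  by (auto simp: aug_lat_def coset_lat_def)

locale finite_coset = group G + H: subgroup H G for G (structure) and H +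
  assumes fin: "finite (carrier G)"
begin

lemma finite_LCOSETS: "finite (LCOSETS G H)"
proof -
  have "LCOSETS G H = (\<lambda>a. a <# H) ` carrier G" by (auto simp: LCOSETS_def)
  then show ?thesis using fin by simp
qed

lemma H_LCOSETS: "H \<in> LCOSETS G H"
  using l_coset_LCOSETS[OF one_closed, of H] by (simp add: lcos_mult_one H.subset)

lemma aug_add_subgroup: "add_subgroup (fst (aug_lat G H))"
  by (auto simp: add_subgroup_def fst_aug_lat sum_subtractf)

lemma ind_diff_aug: "A \<in> LCOSETS G H \<Longrightarrow> B \<in> LCOSETS G H \<Longrightarrow> ind A - ind B \<in> fst (aug_lat G H)"
  using finite_LCOSETS by (auto simp: fst_aug_lat ind_def sum_subtractf of_bool_def)

text \<open>The multiples of \<open>ind H\<close> add up to the total coefficient sum, which is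
  0.\<close>

lemma aug_expand:
  assumes "f \<in> fst (aug_lat G H)"
  shows "f = (\<Sum>C\<in>LCOSETS G H. zsc (f C) (ind C - ind H))"
proof
  fix D
  have "(\<Sum>C\<in>LCOSETS G H. zsc (f C) (ind C - ind H)) D
      = (\<Sum>C\<in>LCOSETS G H. f C * of_bool (D = C)) - (\<Sum>C\<in>LCOSETS G H. f C) * of_bool (D = H)"
    by (simp add: sum_fun_apply ind_def algebra_simps sum_subtractf sum_distrib_left)
  also have "(\<Sum>C\<in>LCOSETS G H. f C) = 0" using assms by (simp add: fst_aug_lat)
  also have "(\<Sum>C\<in>LCOSETS G H. f C * of_bool (D = C)) = f D"
    using assms finite_LCOSETS by (auto simp: fst_aug_lat of_bool_def if_distrib cong: if_cong)
  finally show "f D = (\<Sum>C\<in>LCOSETS G H. zsc (f C) (ind C - ind H)) D" by (simp only: mult_zero_left diff_zero)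
qed

lemma chevalley_expand:
  assumes "\<phi> \<in> fst (chevalley G H)" "f \<in> fst (aug_lat G H)"
  shows "\<phi> f = (\<Sum>C\<in>LCOSETS G H. f C * \<phi> (ind C - ind H))"
proof -
  have add: "additive_on (fst (aug_lat G H)) \<phi>" using assms(1) by (simp add: fst_chevalley)
  have m: "ind C - ind H \<in> fst (aug_lat G H)" if "C \<in> LCOSETS G H" for C
    using ind_diff_aug[OF that H_LCOSETS] .
  have "\<phi> f = \<phi> (\<Sum>C\<in>LCOSETS G H. zsc (f C) (ind C - ind H))" using aug_expand[OF assms(2)] by simp
  also have "\<dots> = (\<Sum>C\<in>LCOSETS G H. \<phi> (zsc (f C) (ind C - ind H)))"
    by (rule additive_on_sum[OF add aug_add_subgroup]) (intro zsc_mem aug_add_subgroup m)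
  also have "\<dots> = (\<Sum>C\<in>LCOSETS G H. f C * \<phi> (ind C - ind H))"
    by (rule sum.cong[OF refl]) (simp add: zsc_hom[OF add aug_add_subgroup m])
  finally show ?thesis .
qed

lemma LCOSETS_subset: "C \<in> LCOSETS G H \<Longrightarrow> C \<subseteq> carrier G"
  using lcosets_subset_PowG[OF H.subgroup_axioms] by blast

lemma act_aug:
  assumes "g \<in> carrier G" "f \<in> fst (aug_lat G H)"
  shows "(\<lambda>C. if C \<in> LCOSETS G H then f (g <# C) else 0) \<in> fst (aug_lat G H)"
proof -
  have "(\<Sum>C\<in>LCOSETS G H. f (g <# C)) = (\<Sum>C\<in>LCOSETS G H. f C)"
    by (rule sum.reindex_bij_witness[of _ "\<lambda>C. inv g <# C" "\<lambda>C. g <# C"])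
       (use assms(1) LCOSETS_subset act_LCOSETS[OF _ H.subset] in \<open>auto simp: lcos_m_assoc lcos_mult_one\<close>)
  then show ?thesis using assms(2) by (simp add: fst_aug_lat)
qed

lemma glat_ok_chevalley: "glat_ok G (chevalley G H)"
proof -
  have "snd (chevalley G H) g \<phi> \<in> fst (chevalley G H)" if g: "g \<in> carrier G" and \<phi>: "\<phi> \<in> fst (chevalley G H)" for g \<phi>
  proof -
    have add: "additive_on (fst (aug_lat G H)) \<phi>" using \<phi> by (simp add: fst_chevalley)
    have "snd (chevalley G H) g \<phi> (f + f') = snd (chevalley G H) g \<phi> f + snd (chevalley G H) g \<phi> f'"
      if f: "f \<in> fst (aug_lat G H)" "f' \<in> fst (aug_lat G H)" for f f'
    proof -
      let ?a = "\<lambda>f C. if C \<in> LCOSETS G H then f (inv (inv g) <# C) else 0"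
      have "?a (f + f') = ?a f + ?a f'" by (auto simp: fun_eq_iff)
      then have "\<phi> (?a (f + f')) = \<phi> (?a f) + \<phi> (?a f')"
        using additive_onD(2)[OF add aug_add_subgroup act_aug[OF _ f(1)] act_aug[OF _ f(2)], of "inv (inv g)" "inv (inv g)"] g
        by simp
      then show ?thesis using f add_subgroupD(4)[OF aug_add_subgroup f] by (simp only: snd_chevalley if_True)
    qed
    moreover have "snd (chevalley G H) g \<phi> f = 0" if "f \<notin> fst (aug_lat G H)" for f
      using that by (simp only: snd_chevalley if_False)
    ultimately show ?thesis unfolding fst_chevalley additive_on_def by blast
  qed
  moreover have "add_subgroup (fst (chevalley G H))"
    by (auto simp: add_subgroup_def fst_chevalley additive_on_def)
  ultimately show ?thesis by (simp add: glat_ok_def)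
qed

lemma chev_fun_RL: "chev_fun G H \<phi> \<in> RL G [H]"
  by (auto simp: RL_def chev_fun_def l_coset_right[OF H.subgroup_axioms])

lemma chev_fun_add: "chev_fun G H (\<phi> + \<phi>') = chev_fun G H \<phi> + chev_fun G H \<phi>'"
  by (auto simp: chev_fun_def fun_eq_iff)

lemma chev_fun_one: "\<phi> \<in> fst (chevalley G H) \<Longrightarrow> chev_fun G H \<phi> (0, \<one>) = 0"
  using additive_onD(1)[OF _ aug_add_subgroup, of \<phi>] by (simp add: chev_fun_def lcos_mult_one H.subset fst_chevalley)

lemma chev_fun_inj:
  assumes "\<phi> \<in> fst (chevalley G H)" "\<phi>' \<in> fst (chevalley G H)" "chev_fun G H \<phi> = chev_fun G H \<phi>'"
  shows "\<phi> = \<phi>'"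
proof
  fix f
  have "\<phi> (ind C - ind H) = \<phi>' (ind C - ind H)" if C: "C \<in> LCOSETS G H" for C
  proof -
    obtain x where "x \<in> carrier G" "C = x <# H" using C by (auto simp: LCOSETS_def)
    then show ?thesis using fun_cong[OF assms(3), of "(0, x)"] by (simp add: chev_fun_def)
  qed
  then have "\<phi> f = \<phi>' f" if "f \<in> fst (aug_lat G H)"
    using chevalley_expand[OF assms(1) that] chevalley_expand[OF assms(2) that] by simp
  then show "\<phi> f = \<phi>' f" using assms(1,2) by (cases "f \<in> fst (aug_lat G H)") (simp_all add: fst_chevalley)
qed

text \<open>Translating xH - H moves its base point away from H, and moving it back costs a
  constant. The passage to invariant functions is therefore equivariant only modulo
  constants.\<close>

lemma chev_fun_act:
  assumes \<phi>: "\<phi> \<in> fst (chevalley G H)" and g: "g \<in> carrier G" and x: "x \<in> carrier G"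
  shows "chev_fun G H (snd (chevalley G H) g \<phi>) (0, x) = lt G g (chev_fun G H \<phi>) (0, x) - chev_fun G H \<phi> (0, inv g)"
proof -
  note L = l_coset_LCOSETS
  have add: "additive_on (fst (aug_lat G H)) \<phi>" using \<phi> by (simp add: fst_chevalley)
  have act: "(\<lambda>C. if C \<in> LCOSETS G H then (ind (x <# H) - ind H) (g <# C) else 0)
      = ind ((inv g \<otimes> x) <# H) - ind (inv g <# H)"
  proof
    fix C
    show "(if C \<in> LCOSETS G H then (ind (x <# H) - ind H) (g <# C) else 0) = (ind ((inv g \<otimes> x) <# H) - ind (inv g <# H)) C"
    proof (cases "C \<in> LCOSETS G H")
      case True
      then obtain y where y: "y \<in> carrier G" "C = y <# H" by (auto simp: LCOSETS_def)
      have eq: "g <# C = z <# H \<longleftrightarrow> C = (inv g \<otimes> z) <# H" if z: "z \<in> carrier G" for z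
      proof
        assume "g <# C = z <# H"
        then have "inv g <# (g <# C) = inv g <# (z <# H)" by simp
        then show "C = (inv g \<otimes> z) <# H" using y z g by (simp add: l_coset_mult H.subset)
      qed (use y z g in \<open>simp add: l_coset_mult H.subset\<close>)
      have "H = \<one> <# H" by (simp add: lcos_mult_one H.subset)
      then have "g <# C = H \<longleftrightarrow> C = inv g <# H" using eq[OF one_closed] g by simp
      then show ?thesis using True eq[OF x] by (simp add: ind_def)
    next
      case False
      then have "C \<noteq> (inv g \<otimes> x) <# H" "C \<noteq> inv g <# H" using L g x by auto
      then show ?thesis using False by (simp add: ind_def)
    qed
  qed
  have m: "ind (x <# H) - ind H \<in> fst (aug_lat G H)" using ind_diff_aug[OF L[OF x] H_LCOSETS] .
  have "chev_fun G H (snd (chevalley G H) g \<phi>) (0, x) = \<phi> (ind ((inv g \<otimes> x) <# H) - ind (inv g <# H))"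
    using x m arg_cong[OF act, of \<phi>] by (simp add: chev_fun_def snd_chevalley g cong: if_cong)
  also have "\<dots> = \<phi> ((ind ((inv g \<otimes> x) <# H) - ind H) - (ind (inv g <# H) - ind H))" by simp
  also have "\<dots> = \<phi> (ind ((inv g \<otimes> x) <# H) - ind H) - \<phi> (ind (inv g <# H) - ind H)"
    using L g x H_LCOSETS by (intro additive_onD(4)[OF add aug_add_subgroup] ind_diff_aug) simp_all
  finally show ?thesis using g x by (simp add: chev_fun_def lt_def)
qed

text \<open>Pair \<open>f\<close> with \<open>\<psi>\<close>, regarded as a function of cosets; on
  xH - H this gives the difference of the values at \<open>x\<close> and at the identity.\<close>

lemma chev_fun_surj:
  assumes \<psi>: "\<psi> \<in> RL G [H]"
  obtains \<phi> where "\<phi> \<in> fst (chevalley G H)" "\<And>x. x \<in> carrier G \<Longrightarrow> chev_fun G H \<phi> (0, x) = \<psi> (0, x) - \<psi> (0, \<one>)"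
proof -
  define \<phi> where "\<phi> f = (if f \<in> fst (aug_lat G H) then \<Sum>C\<in>LCOSETS G H. f C * \<psi> (0, SOME y. y \<in> C) else 0)" for f
  have s: "\<psi> (0, SOME y. y \<in> x <# H) = \<psi> (0, x)" if "x \<in> carrier G" for x
    using RL_some[OF \<psi>, of 0 x] that H.subgroup_axioms by simp
  have "\<phi> (f + f') = \<phi> f + \<phi> f'" if "f \<in> fst (aug_lat G H)" "f' \<in> fst (aug_lat G H)" for f f'
    using that add_subgroupD(4)[OF aug_add_subgroup that] by (simp add: \<phi>_def algebra_simps sum.distrib)
  then have "\<phi> \<in> fst (chevalley G H)" by (simp add: fst_chevalley additive_on_def \<phi>_def)
  moreover have "chev_fun G H \<phi> (0, x) = \<psi> (0, x) - \<psi> (0, \<one>)" if x: "x \<in> carrier G" for x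
  proof -
    have ps: "(\<Sum>C\<in>LCOSETS G H. ind A C * h C) = h A" if "A \<in> LCOSETS G H" for A and h :: "'a set \<Rightarrow> int"
      using finite_LCOSETS that by (simp add: ind_def of_bool_def if_distrib[of "\<lambda>t. t * _"] cong: if_cong)
    have "chev_fun G H \<phi> (0, x) = (\<Sum>C\<in>LCOSETS G H. (ind (x <# H) - ind H) C * \<psi> (0, SOME y. y \<in> C))"
      using x ind_diff_aug[OF l_coset_LCOSETS[OF x] H_LCOSETS] by (simp add: chev_fun_def \<phi>_def)
    also have "\<dots> = \<psi> (0, SOME y. y \<in> x <# H) - \<psi> (0, SOME y. y \<in> H)"
      by (simp add: left_diff_distrib sum_subtractf ps l_coset_LCOSETS[OF x] H_LCOSETS)
    also have "\<dots> = \<psi> (0, x) - \<psi> (0, \<one>)" using s[OF x] s[OF one_closed] by (simp add: lcos_mult_one H.subset)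
    finally show ?thesis .
  qed
  ultimately show thesis using that by blast
qed

end

subsection \<open>The kernel of gamma\<close>

definition Flat :: "(mat, nat \<times> mat \<Rightarrow> int) glat" where
  "Flat = ({f \<in> RL Gam KX. kga f = 0}, lt Gam)"

lemma fst_Flat: "f \<in> fst Flat \<longleftrightarrow> f \<in> RL Gam KX \<and> kga f = 0"
  by (simp add: Flat_def)

lemma subsets_all:
  "\<forall>K\<in>set KP. K \<subseteq> carrier Gam" "\<forall>K\<in>set KX. K \<subseteq> carrier Gam" "\<forall>K\<in>set KR. K \<subseteq> carrier Gam" "\<forall>K\<in>set KV. K \<subseteq> carrier Gam"
  using subgroups_all subgroup.subset by blast+

lemma is_glat_RLat_sub:
  assumes "M \<subseteq> RL Gam Ks" "add_subgroup M" "\<And>g f. g \<in> carrier Gam \<Longrightarrow> f \<in> M \<Longrightarrow> lt Gam g f \<in> M"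
  shows "is_glat Gam (M, lt Gam)"
proof -
  have "\<exists>bs. zbasis M bs"
  proof (rule zbasis_subgroup_exists[OF _ assms(2)])
    show "finite ({..<length Ks} \<times> carrier Gam)" using finite_Gam by simp
    show "f x = 0" if "f \<in> M" "x \<notin> {..<length Ks} \<times> carrier Gam" for f x
      using RL_zero[of f Gam Ks "fst x" "snd x"] that assms(1) by (cases x) auto
  qed
  then show ?thesis
    unfolding is_glat_def case_prod_conv
  proof (intro conjI ballI)
    fix f assume "f \<in> M"
    then show "lt Gam \<one>\<^bsub>Gam\<^esub> f = f" using assms(1) by (intro Gam.lt_one) blast
  qed (simp_all only: assms(3) lt_add Gam.lt_mult)
qed

lemma lt_zero: "lt G g 0 = 0"
  by (auto simp: lt_def fun_eq_iff)

lemma is_glat_kernel: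
  assumes "\<forall>K\<in>set Ks. K \<subseteq> carrier Gam"
    and "\<And>g f. g \<in> carrier Gam \<Longrightarrow> f \<in> RL Gam Ks \<Longrightarrow> kop Gam n Ts w (lt Gam g f) = lt Gam g (kop Gam n Ts w f)"
  shows "is_glat Gam ({f \<in> RL Gam Ks. kop Gam n Ts w f = 0}, lt Gam)"
proof (rule is_glat_RLat_sub[of _ Ks])
  show "add_subgroup {f \<in> RL Gam Ks. kop Gam n Ts w f = 0}"
    using add_subgroupD[OF add_subgroup_RL[of Gam Ks]] by (auto simp: add_subgroup_def kop_diff)
  show "lt Gam g f \<in> {f \<in> RL Gam Ks. kop Gam n Ts w f = 0}"
    if "g \<in> carrier Gam" "f \<in> {f \<in> RL Gam Ks. kop Gam n Ts w f = 0}" for g f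
    using that Gam.lt_RL[OF _ that(1) assms(1)] assms(2)[OF that(1)] by (simp add: lt_zero)
qed blast

lemma is_glat_Flat: "is_glat Gam Flat"
  unfolding Flat_def by (rule is_glat_kernel[OF subsets_all(2) kop_lts(2)])

lemma kal_Flat: "kal f \<in> fst Flat"
  by (simp add: fst_Flat kop_RLs ga_al)

lemma Flat_split: "ghom Gam (Flat \<oplus>\<^sub>L RLat Gam KR) (RLat Gam KX) (\<lambda>(f, r). f + kbe r)"
    "ghom Gam (RLat Gam KX) (Flat \<oplus>\<^sub>L RLat Gam KR) (\<lambda>h. (h - kbe (kga h), kga h))"
    "x \<in> fst (Flat \<oplus>\<^sub>L RLat Gam KR) \<Longrightarrow> (\<lambda>h. (h - kbe (kga h), kga h)) ((\<lambda>(f, r). f + kbe r) x) = x"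
    "(\<lambda>(f, r). f + kbe r) ((\<lambda>h. (h - kbe (kga h), kga h)) y) = y"
proof -
  note RX = add_subgroupD[OF add_subgroup_RL[of Gam KX]]
  have lt_diff: "lt Gam g (f - f') = lt Gam g f - lt Gam g f'" for g f f' by (auto simp: lt_def fun_eq_iff)
  show "ghom Gam (Flat \<oplus>\<^sub>L RLat Gam KR) (RLat Gam KX) (\<lambda>(f, r). f + kbe r)"
    using RX(4) kop_RLs(3)
    by (auto simp: ghom_def dsum_def fst_Flat kop_add lt_add kop_lts) (auto simp: Flat_def lt_add)
  show "ghom Gam (RLat Gam KX) (Flat \<oplus>\<^sub>L RLat Gam KR) (\<lambda>h. (h - kbe (kga h), kga h))"
    using RX(2) kop_RLs(2,3)
    by (auto simp: ghom_def dsum_def fst_Flat kop_add kop_diff lt_add kop_lts ga_be) (auto simp: Flat_def lt_diff)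
  show "(\<lambda>h. (h - kbe (kga h), kga h)) ((\<lambda>(f, r). f + kbe r) x) = x" if "x \<in> fst (Flat \<oplus>\<^sub>L RLat Gam KR)"
    using that by (auto simp: dsum_def fst_Flat kop_add ga_be)
  show "(\<lambda>(f, r). f + kbe r) ((\<lambda>h. (h - kbe (kga h), kga h)) y) = y" by simp
qed

lemma Flat_iso: "glat_iso Gam (Flat \<oplus>\<^sub>L RLat Gam KR) (RLat Gam KX)"
  using glat_isoI[OF Flat_split(1,2)] Flat_split(3,4) by blast

text \<open>Counting cosets gives 56 + 9 + 9 + 84 = 158 for X and 84 + 1 = 85 for R, and ranks are
  additive along the splitting.\<close>

lemma rank_Flat:
  assumes "zbasis (fst Flat) bs"
  shows "length bs = 73"
proof -
  have len: "length TU = 63" "length TC = 56" "length TB = 9" "length TS = 84" "length TG = 1" by code_simp+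
  note c = transversal_distinct[THEN distinct_card]
  have cards: "card (set TU) = 63" "card (set TC) = 56" "card (set TB) = 9" "card (set TS) = 84" "card (set TG) = 1"
    using c len by (simp_all add: TG_def)
  obtain ds where ds: "zbasis (RL Gam KR) ds" "length ds = 85"
    using Gam.zbasis_RL[OF tsys_all(3)] cards by (auto simp: lengths sum_small TR_def numeral_2_eq_2)
  obtain es where es: "zbasis (RL Gam KX) es" "length es = 158"
    using Gam.zbasis_RL[OF tsys_all(2)] cards by (auto simp: lengths TX_def numeral_eq_Suc)
  obtain k where k: "ghom Gam (Flat \<oplus>\<^sub>L RLat Gam KR) (RLat Gam KX) k"
    "bij_betw k (fst (Flat \<oplus>\<^sub>L RLat Gam KR)) (RL Gam KX)"
    using Flat_iso by (auto simp: glat_iso_def)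
  have "zbasis (fst (Flat \<oplus>\<^sub>L RLat Gam KR)) (map (\<lambda>b. (b, 0)) bs @ map (\<lambda>d. (0, d)) ds)"
    using zbasis_prod[OF assms ds(1)] by (simp add: dsum_def)
  from zbasis_length_unique[OF zbasis_image[OF this ghomD(4)[OF k(1)] k(2)] es(1)]
  show ?thesis using ds(2) es(2) by simp
qed

subsection \<open>Transport along an isomorphism\<close>

locale gam_iso = group G for G :: "('g,'b) monoid_scheme" (structure) +
  fixes \<Theta> :: "mat \<Rightarrow> 'g"
  assumes iso: "\<Theta> \<in> iso Gam G"
begin

definition \<theta> :: "'g \<Rightarrow> mat" where "\<theta> = inv_into (carrier Gam) \<Theta>"

lemma \<theta>_iso: "\<theta> \<in> iso G Gam"
  unfolding \<theta>_def using Gam.iso_set_sym[OF iso] .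

lemma homs: "\<theta> \<in> hom G Gam" "\<Theta> \<in> hom Gam G"
  using \<theta>_iso iso by (simp_all add: iso_def)

lemma carriers [simp]: "x \<in> carrier G \<Longrightarrow> \<theta> x \<in> carrier Gam" "y \<in> carrier Gam \<Longrightarrow> \<Theta> y \<in> carrier G"
  by (rule hom_in_carrier[OF homs(1)], assumption, rule hom_in_carrier[OF homs(2)], assumption)

lemma bij: "bij_betw \<Theta> (carrier Gam) (carrier G)"
  using iso by (simp add: iso_def)

lemma inverses [simp]: "x \<in> carrier G \<Longrightarrow> \<Theta> (\<theta> x) = x" "y \<in> carrier Gam \<Longrightarrow> \<theta> (\<Theta> y) = y"
  using bij_betw_inv_into_right[OF bij, of x] bij_betw_inv_into_left[OF bij, of y] by (simp_all add: \<theta>_def)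

sublocale TG: group_hom Gam G \<Theta>
  by (rule group_hom.intro) (simp_all add: group_hom_axioms_def homs Gam.is_group)

sublocale GT: group_hom G Gam \<theta>
  by (rule group_hom.intro) (simp_all add: group_hom_axioms_def homs Gam.is_group)

lemma fin: "finite (carrier G)"
  using bij_betw_finite[OF bij] finite_Gam by blast

lemma image_subgroup: "subgroup K Gam \<Longrightarrow> subgroup (\<Theta> ` K) G"
  by (rule TG.subgroup_img_is_subgroup)

lemma image_subgroups: "\<forall>K\<in>set Ks. subgroup K Gam \<Longrightarrow> \<forall>K\<in>set (map ((`) \<Theta>) Ks). subgroup K G"
  using image_subgroup by simp

lemma preimage_subgroup: "subgroup K G \<Longrightarrow> subgroup (\<theta> ` K) Gam"
  by (rule GT.subgroup_img_is_subgroup)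

lemma \<Theta>_\<theta>_image: "K \<subseteq> carrier G \<Longrightarrow> \<Theta> ` \<theta> ` K = K"
  unfolding image_image by (rule image_cong[THEN trans[OF _ image_ident], OF refl]) auto

lemma card_\<theta>: "K \<subseteq> carrier G \<Longrightarrow> card (\<theta> ` K) = card K"
  by (rule card_image) (metis inverses(1) inj_on_inverseI subsetD)

lemma reindex_RLs:
  assumes "\<forall>K\<in>set Ks. subgroup K Gam"
  shows "f \<in> RL Gam Ks \<Longrightarrow> reindex G \<theta> f \<in> RL G (map ((`) \<Theta>) Ks)"
    "h \<in> RL G (map ((`) \<Theta>) Ks) \<Longrightarrow> reindex Gam \<Theta> h \<in> RL Gam Ks"
proof -
  have K: "Ks ! j \<subseteq> carrier Gam" if "j < length Ks" for j
    using assms that subgroup.subset nth_mem by blast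
  show "reindex G \<theta> f \<in> RL G (map ((`) \<Theta>) Ks)" if "f \<in> RL Gam Ks"
  proof (rule reindex_RL[OF homs(1) that _ _ is_group])
    fix j assume "j < length (map ((`) \<Theta>) Ks)"
    then have j: "j < length Ks" by simp
    have "\<Theta> k \<in> carrier G \<and> \<theta> (\<Theta> k) = k" if "k \<in> Ks ! j" for k using K[OF j] that by (simp add: subsetD)
    then show "map ((`) \<Theta>) Ks ! j \<subseteq> carrier G \<and> \<theta> ` (map ((`) \<Theta>) Ks ! j) \<subseteq> Ks ! j" using j by force
  qed simp
  show "reindex Gam \<Theta> h \<in> RL Gam Ks" if "h \<in> RL G (map ((`) \<Theta>) Ks)"
    by (rule reindex_RL[OF homs(2) that _ _ Gam.is_group]) (use K in auto)
qed

lemma reindex_inverses: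
  "f \<in> RL Gam Ks \<Longrightarrow> reindex Gam \<Theta> (reindex G \<theta> f) = f"
  "h \<in> RL G Ls \<Longrightarrow> reindex G \<theta> (reindex Gam \<Theta> h) = h"
  by (rule reindex_inverse, assumption, simp)+

lemma ghom_reindex:
  assumes "\<forall>K\<in>set Ks. subgroup K Gam"
  shows "ghom G (pull \<theta> (RLat Gam Ks)) (RLat G (map ((`) \<Theta>) Ks)) (reindex G \<theta>)"
    "ghom G (RLat G (map ((`) \<Theta>) Ks)) (pull \<theta> (RLat Gam Ks)) (reindex Gam \<Theta>)"
proof -
  have "reindex Gam \<Theta> (lt G g f) = lt Gam (\<theta> g) (reindex Gam \<Theta> f)" if "g \<in> carrier G" for g f
    using reindex_lt[OF homs(2) Gam.is_group is_group, of "\<theta> g" f] that by simp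
  then show "ghom G (RLat G (map ((`) \<Theta>) Ks)) (pull \<theta> (RLat Gam Ks)) (reindex Gam \<Theta>)"
    using reindex_RLs(2)[OF assms] by (auto simp: ghom_def reindex_add)
  show "ghom G (pull \<theta> (RLat Gam Ks)) (RLat G (map ((`) \<Theta>) Ks)) (reindex G \<theta>)"
    using reindex_RLs(1)[OF assms] reindex_lt[OF homs(1) is_group Gam.is_group] by (auto simp: ghom_def reindex_add)
qed

lemma pull_RLat_iso:
  assumes "\<forall>K\<in>set Ks. subgroup K Gam"
  shows "glat_iso G (pull \<theta> (RLat Gam Ks)) (RLat G (map ((`) \<Theta>) Ks))"
    "glat_iso G (RLat G (map ((`) \<Theta>) Ks)) (pull \<theta> (RLat Gam Ks))"
  by (rule glat_isoI[OF ghom_reindex[OF assms]] glat_isoI[OF ghom_reindex(2,1)[OF assms]];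
      use reindex_inverses in auto)+

lemma perm_sum_iso:
  assumes "\<forall>K\<in>set Ks. subgroup K Gam"
  shows "glat_iso G (pull \<theta> (RLat Gam Ks)) (perm_sum G (map ((`) \<Theta>) Ks))"
    "glat_iso G (perm_sum G (map ((`) \<Theta>) Ks)) (pull \<theta> (RLat Gam Ks))"
proof -
  obtain f k where fk: "ghom G (RLat G (map ((`) \<Theta>) Ks)) (perm_sum G (map ((`) \<Theta>) Ks)) f"
    "ghom G (perm_sum G (map ((`) \<Theta>) Ks)) (RLat G (map ((`) \<Theta>) Ks)) k"
    "\<And>x. x \<in> RL G (map ((`) \<Theta>) Ks) \<Longrightarrow> k (f x) = x"
    "\<And>y. y \<in> fst (perm_sum G (map ((`) \<Theta>) Ks)) \<Longrightarrow> f (k y) = y"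
    using perm_sum_RLat[OF image_subgroups[OF assms]] by metis
  show "glat_iso G (pull \<theta> (RLat Gam Ks)) (perm_sum G (map ((`) \<Theta>) Ks))"
    using glat_iso_trans[OF pull_RLat_iso(1)[OF assms] glat_isoI[OF fk(1,2)]] fk(3,4) by simp
  show "glat_iso G (perm_sum G (map ((`) \<Theta>) Ks)) (pull \<theta> (RLat Gam Ks))"
    using glat_iso_trans[OF glat_isoI[OF fk(2,1)] pull_RLat_iso(2)[OF assms]] fk(3,4) by simp
qed

lemma coset_conj_iso:
  assumes K: "subgroup K G" and S: "subgroup S Gam" and d: "d \<in> carrier Gam"
    and eq: "\<theta> ` K = (\<lambda>k. d \<otimes>\<^bsub>Gam\<^esub> k \<otimes>\<^bsub>Gam\<^esub> inv\<^bsub>Gam\<^esub> d) ` S"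
  shows "glat_iso G (coset_lat G K) (RLat G [\<Theta> ` S])"
proof -
  have "K = \<Theta> ` (\<lambda>k. d \<otimes>\<^bsub>Gam\<^esub> k \<otimes>\<^bsub>Gam\<^esub> inv\<^bsub>Gam\<^esub> d) ` S"
    using \<Theta>_\<theta>_image[OF subgroup.subset[OF K]] eq by simp
  also have "\<dots> = (\<lambda>k. \<Theta> d \<otimes> k \<otimes> inv (\<Theta> d)) ` \<Theta> ` S"
    unfolding image_image using d subgroup.mem_carrier[OF S] by (intro image_cong) simp_all
  finally show ?thesis
    using glat_iso_trans[OF coset_RLat[OF K] conj_RLat[OF image_subgroup[OF S], of "\<Theta> d" K]] d by simp
qed

end

lemma is_glat_natlat: "is_glat G L \<Longrightarrow> group G \<Longrightarrow> is_glat G (natlat L)"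
  using is_glat_glat_iso[OF _ natlat_glat_iso(1)] .

lemma ghom_kal: "ghom Gam (RLat Gam KP) Flat kal"
  by (simp only: ghom_def fst_conv snd_conv kal_Flat kop_add) (simp add: kop_lts Flat_def)

lemma Flat_retract:
  "ghom Gam Flat (RLat Gam KX) (\<lambda>f. f)" "ghom Gam (RLat Gam KX) Flat (\<lambda>h. h - kbe (kga h))"
  "f \<in> fst Flat \<Longrightarrow> f - kbe (kga f) = f"
proof -
  show "ghom Gam Flat (RLat Gam KX) (\<lambda>f. f)" by (simp add: ghom_def Flat_def)
  show "ghom Gam (RLat Gam KX) Flat (\<lambda>h. h - kbe (kga h))"
    using ghom_comp[OF Flat_split(2), of Flat fst] by (simp add: ghom_def dsum_def comp_def)
qed (simp add: fst_Flat)

text \<open>The isomorphism has to match the given Sylow subgroup with U exactly, since the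
  Chevalley module is formed from \<open>H\<close> itself.\<close>

locale sylow_iso = gam_iso + fixes H assumes H_def: "H = \<Theta> ` sU"
begin

lemma subgroup_H: "subgroup H G"
  unfolding H_def by (rule image_subgroup[OF subgroup_sU])

sublocale finite_coset G H
  by (intro finite_coset.intro finite_coset_axioms.intro is_group subgroup_H fin)

lemma image_KV: "map ((`) \<Theta>) KV = [H]"
  by (simp add: KV_def H_def)

definition chev_RL :: "(('a set \<Rightarrow> int) \<Rightarrow> int) \<Rightarrow> nat \<times> mat \<Rightarrow> int" where
  "chev_RL \<phi> = reindex Gam \<Theta> (chev_fun G H \<phi>)"

text \<open>As \<open>\<iota>\<close> kills constants, the base point in \<open>chev_fun\<close> no
  longer matters, and this map is equivariant although \<open>chev_fun\<close> is not.\<close>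

definition emb :: "(('a set \<Rightarrow> int) \<Rightarrow> int) \<Rightarrow> nat \<times> mat \<Rightarrow> int" where
  "emb \<phi> = kio (chev_RL \<phi>)"

lemma chev_RL: "chev_RL \<phi> \<in> RL Gam KV"
  unfolding chev_RL_def by (rule reindex_RLs(2)[OF subgroups_all(4)]) (simp add: image_KV chev_fun_RL)

lemma chev_RL_apply: "y \<in> carrier Gam \<Longrightarrow> chev_RL \<phi> (0, y) = chev_fun G H \<phi> (0, \<Theta> y)"
  by (simp add: chev_RL_def reindex_def)

lemma kio_eqI:
  assumes "\<And>y. y \<in> carrier Gam \<Longrightarrow> f (0, y) = f' (0, y) + c"
  shows "kio f = kio f'"
  using kio_const[of "f - f'" c] assms by (simp add: kop_diff)

lemma emb_act:
  assumes "g \<in> carrier G" "\<phi> \<in> fst (chevalley G H)"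
  shows "emb (snd (chevalley G H) g \<phi>) = lt Gam (\<theta> g) (emb \<phi>)"
proof -
  have "chev_RL (snd (chevalley G H) g \<phi>) (0, y) = lt Gam (\<theta> g) (chev_RL \<phi>) (0, y) + - chev_fun G H \<phi> (0, inv g)"
    if y: "y \<in> carrier Gam" for y
  proof -
    have "lt Gam (\<theta> g) (chev_RL \<phi>) (0, y) = lt G g (chev_fun G H \<phi>) (0, \<Theta> y)"
      using y assms(1) by (simp add: chev_RL_apply lt_def)
    then show ?thesis using chev_fun_act[OF assms(2,1), of "\<Theta> y"] y by (simp only: chev_RL_apply carriers)
  qed
  then have "kio (chev_RL (snd (chevalley G H) g \<phi>)) = kio (lt Gam (\<theta> g) (chev_RL \<phi>))" by (rule kio_eqI)
  then show ?thesis using kop_lts(4)[OF chev_RL] assms(1) by (simp only: emb_def carriers)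
qed

lemma emb_KP: "emb \<phi> \<in> RL Gam KP"
  by (simp only: emb_def kop_RLs)

lemma ghom_emb: "ghom G (chevalley G H) (pull \<theta> (RLat Gam KP)) emb"
proof -
  have "emb (\<phi> + \<phi>') = emb \<phi> + emb \<phi>'" for \<phi> \<phi>'
    by (simp only: emb_def chev_RL_def chev_fun_add reindex_add kop_add)
  then show ?thesis using emb_KP emb_act by (simp add: ghom_def)
qed

lemma inj_emb: "inj_on emb (fst (chevalley G H))"
proof (rule inj_onI)
  fix \<phi> \<phi>' assume \<phi>: "\<phi> \<in> fst (chevalley G H)" "\<phi>' \<in> fst (chevalley G H)" and "emb \<phi> = emb \<phi>'"
  then have z: "kio (chev_RL \<phi> - chev_RL \<phi>') = 0" by (simp add: emb_def kop_diff)
  have D: "chev_RL \<phi> - chev_RL \<phi>' \<in> RL Gam KV" using add_subgroupD(2)[OF add_subgroup_RL chev_RL chev_RL] .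
  have "chev_fun G H \<phi> (0, x) = chev_fun G H \<phi>' (0, x)" if x: "x \<in> carrier G" for x
  proof -
    \<comment> \<open>With modulus 0 the divisibility lemma says that a function killed by
      \<open>\<iota>\<close> is constant.\<close>
    have "0 dvd (chev_RL \<phi> - chev_RL \<phi>') (0, \<theta> x) - (chev_RL \<phi> - chev_RL \<phi>') (0, \<theta> \<one>)"
      by (rule kio_dvd[OF D]) (use z x in simp_all)
    then show ?thesis
      using x chev_fun_one[OF \<phi>(1)] chev_fun_one[OF \<phi>(2)]
      by (simp only: chev_RL_apply carriers inverses one_closed minus_apply) simp
  qed
  then have "chev_fun G H \<phi> = chev_fun G H \<phi>'" by (auto simp: chev_fun_def fun_eq_iff)
  then show "\<phi> = \<phi>'" using chev_fun_inj[OF \<phi>] by blast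
qed

lemma emb_image: "emb ` fst (chevalley G H) = {f \<in> RL Gam KP. kal f = 0}"
proof (intro equalityI subsetI)
  fix f assume "f \<in> {f \<in> RL Gam KP. kal f = 0}"
  then obtain \<psi> where \<psi>: "\<psi> \<in> RL Gam KV" "kio \<psi> = f" using ker_al by blast
  have "reindex G \<theta> \<psi> \<in> RL G [H]" using reindex_RLs(1)[OF subgroups_all(4) \<psi>(1)] by (simp only: image_KV)
  then obtain \<phi> where \<phi>: "\<phi> \<in> fst (chevalley G H)"
    "\<And>x. x \<in> carrier G \<Longrightarrow> chev_fun G H \<phi> (0, x) = reindex G \<theta> \<psi> (0, x) - reindex G \<theta> \<psi> (0, \<one>)"
    by (rule chev_fun_surj) (rule that)
  have "chev_RL \<phi> (0, y) = \<psi> (0, y) + - reindex G \<theta> \<psi> (0, \<one>)" if y: "y \<in> carrier Gam" for y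
  proof -
    have "reindex G \<theta> \<psi> (0, \<Theta> y) = \<psi> (0, y)" using y by (simp add: reindex_def)
    then show ?thesis unfolding chev_RL_apply[OF y] \<phi>(2)[OF carriers(2)[OF y]] by simp
  qed
  then have "emb \<phi> = kio \<psi>" unfolding emb_def by (rule kio_eqI)
  then show "f \<in> emb ` fst (chevalley G H)" using \<phi>(1) \<psi>(2) by (intro image_eqI[of _ _ \<phi>]) simp_all
next
  fix f assume "f \<in> emb ` fst (chevalley G H)"
  then obtain \<phi> where f: "f = emb \<phi>" by blast
  have "kal (emb \<phi>) = 0" unfolding emb_def by (rule al_io)
  then show "f \<in> {f \<in> RL Gam KP. kal f = 0}" using emb_KP f by simp
qed

text \<open>Freeness is inherited from the kernel of \<open>\<alpha>\<close>, which is isomorphic to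
  the Chevalley module and consists of functions on a finite set.\<close>

lemma is_glat_chevalley: "is_glat G (chevalley G H)"
proof -
  define L where "L = ({f \<in> RL Gam KP. kal f = 0}, lt Gam)"
  have "is_glat Gam L" unfolding L_def by (rule is_glat_kernel[OF subsets_all(1) kop_lts(1)])
  then have "is_glat G (pull \<theta> L)" by (rule is_glat_pull[OF homs(1) is_group Gam.is_group])
  moreover have "emb \<phi> \<in> fst L" if "\<phi> \<in> fst (chevalley G H)" for \<phi>
    using imageI[OF that, of emb] unfolding emb_image L_def fst_conv .
  then have "ghom G (chevalley G H) (pull \<theta> L) emb"
    using ghom_emb unfolding ghom_def L_def fst_pull snd_pull snd_conv by blast
  then have "glat_iso G (chevalley G H) (pull \<theta> L)"
    using inj_emb emb_image unfolding glat_iso_def bij_betw_def L_def fst_pull fst_conv by blast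
  ultimately show ?thesis
    using is_glat_glat_iso glat_iso_sym glat_ok_chevalley is_group by blast
qed

definition Pl where "Pl = natlat (pull \<theta> (RLat Gam KP))"
definition Fl where "Fl = natlat (pull \<theta> Flat)"

lemma flabby_Fl: "flabby G Fl"
proof -
  have ok: "glat_ok Gam Flat" "glat_ok Gam (RLat Gam KX)" "glat_ok G (RLat G (map ((`) \<Theta>) KX))"
    using is_glat_ok[OF is_glat_Flat] group.glat_ok_RLat[OF Gam.is_group subsets_all(2)]
      glat_ok_RLat[of "map ((`) \<Theta>) KX"] image_subgroups[OF subgroups_all(2)] subgroup.subset by blast+
  note okp = glat_ok_pull[OF homs(1) ok(1)] glat_ok_pull[OF homs(1) ok(2)]
  have "flabby G (pull \<theta> (RLat Gam KX))"
    using flabby_iso[OF pull_RLat_iso(2)[OF subgroups_all(2)] ok(3) okp(2)]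
      flabby_RLat[OF fin image_subgroups[OF subgroups_all(2)]] .
  then have "flabby G (pull \<theta> Flat)"
    using flabby_retract[OF ghom_pull[OF homs(1) Flat_retract(1)] ghom_pull[OF homs(1) Flat_retract(2)] _ okp]
      Flat_retract(3) by simp
  moreover have "glat_ok G (natlat (pull \<theta> Flat))"
    using is_glat_ok[OF is_glat_natlat[OF is_glat_pull[OF homs(1) is_group Gam.is_group is_glat_Flat] is_group]] .
  ultimately show ?thesis
    unfolding Fl_def using flabby_iso[OF natlat_glat_iso(1) okp(1)] by blast
qed

definition proj :: "(nat \<Rightarrow> int) \<Rightarrow> nat \<Rightarrow> int" where "proj y = tonat (kal (\<lambda>i. y (to_nat i)))"

lemma tonat_eq_iff: "tonat f = tonat f' \<longleftrightarrow> f = f'"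
  by (metis tonat_inverse)

lemma tonat_0: "tonat 0 = 0"
  by (auto simp: tonat_def fun_eq_iff)

lemma proj_tonat: "proj (tonat f) = tonat (kal f)"
  by (simp only: proj_def tonat_inverse)

lemma flabby_resolution_Fl: "flabby_resolution G (chevalley G H) Pl Fl (tonat \<circ> emb) proj"
  unfolding flabby_resolution_def
proof (intro conjI)
  show "is_glat G (chevalley G H)" by (rule is_glat_chevalley)
  show "is_glat G Pl" "is_glat G Fl"
    unfolding Pl_def Fl_def
    by (intro is_glat_natlat is_glat_pull[OF homs(1)] is_group Gam.is_group is_glat_Flat
        group.is_glat_RLat[OF Gam.is_group] finite_Gam subsets_all)+
  show "ghom G (chevalley G H) Pl (tonat \<circ> emb)"
    unfolding Pl_def by (rule ghom_comp[OF ghom_emb ghom_natlat(1)])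
  have "proj = tonat \<circ> (kal \<circ> (\<lambda>y i. y (to_nat i)))" by (simp add: fun_eq_iff proj_def)
  then show "ghom G Pl Fl proj"
    unfolding Pl_def Fl_def
    using ghom_comp[OF ghom_comp[OF ghom_natlat(2) ghom_pull[OF homs(1) ghom_kal]] ghom_natlat(1)] by simp
  have "inj_on tonat (emb ` fst (chevalley G H))" by (simp add: inj_on_def tonat_eq_iff)
  then show "inj_on (tonat \<circ> emb) (fst (chevalley G H))" by (rule comp_inj_on[OF inj_emb])
  have Pl: "fst Pl = tonat ` RL Gam KP" and Fl: "fst Fl = tonat ` fst Flat"
    by (simp_all add: Pl_def Fl_def natlat_def)
  have "kal ` RL Gam KP = fst Flat" using ker_ga kal_Flat unfolding fst_Flat set_eq_iff image_iff by metis
  then show "proj ` fst Pl = fst Fl" unfolding Pl Fl image_image proj_tonat by (metis image_image)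
  have pz: "proj (tonat f) = 0 \<longleftrightarrow> kal f = 0" for f
    by (metis proj_tonat tonat_eq_iff tonat_0)
  have "{x \<in> fst Pl. proj x = 0} = tonat ` {f \<in> RL Gam KP. kal f = 0}"
    unfolding Pl using pz by auto
  then show "{x \<in> fst Pl. proj x = 0} = (tonat \<circ> emb) ` fst (chevalley G H)"
    unfolding image_comp[symmetric] emb_image .
  show "permutation_lat G Pl"
    unfolding permutation_lat_def Pl_def
    using image_subgroups[OF subgroups_all(1)] glat_iso_trans[OF natlat_glat_iso(2) perm_sum_iso(1)[OF subgroups_all(1)]]
    by blast
  show "flabby G Fl" by (rule flabby_Fl)
qed

lemma rank_Fl: "glat_rank Fl = 73"
proof -
  obtain bs where bs: "zbasis (fst Flat) bs" using is_glat_Flat unfolding is_glat_def case_prod_beta by blast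
  have "zbasis (fst (natlat (pull \<theta> Flat))) (map tonat bs)"
  proof (rule zbasis_image[OF bs])
    show "additive_on (fst Flat) tonat" using ghomD(4)[OF ghom_natlat(1)[of Gam Flat]] .
    show "bij_betw tonat (fst Flat) (fst (natlat (pull \<theta> Flat)))" using natlat_iso[of "pull \<theta> Flat"] by simp
  qed
  then show ?thesis using rank_Flat[OF bs] by (simp add: glat_rank_def Fl_def zrank_eq)
qed

lemma Fl_iso: "glat_iso G (Fl \<oplus>\<^sub>L pull \<theta> (RLat Gam KR)) (pull \<theta> (RLat Gam KX))"
  using glat_iso_trans[OF glat_iso_dsum[OF natlat_glat_iso(2)[of G "pull \<theta> Flat"] glat_iso_refl]
      glat_iso_pull[OF homs(1) Flat_iso, unfolded pull_dsum]]
  unfolding Fl_def .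

lemma stably_permutation_Fl: "stably_permutation G Fl"
  unfolding stably_permutation_def
  using image_subgroups[OF subgroups_all(3)] image_subgroups[OF subgroups_all(2)]
    glat_iso_trans[OF glat_iso_dsum[OF glat_iso_refl perm_sum_iso(2)[OF subgroups_all(3)]]
      glat_iso_trans[OF Fl_iso perm_sum_iso(1)[OF subgroups_all(2)]]]
  by blast

text \<open>This identifies the normalizer in the theorem with the image of the Borel subgroup B
  that occurs in X.\<close>

lemma normalizer_eq: "normalizer G H = \<Theta> ` sB"
proof -
  have iff: "g \<in> normalizer G H \<longleftrightarrow> \<theta> g \<in> sB" if g: "g \<in> carrier G" for g
  proof -
    let ?c = "\<lambda>k. \<theta> g \<otimes>\<^bsub>Gam\<^esub> k \<otimes>\<^bsub>Gam\<^esub> inv\<^bsub>Gam\<^esub> \<theta> g"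
    note U = subgroup.mem_carrier[OF subgroup_sU]
    have "g \<in> normalizer G H \<longleftrightarrow> g <# H #> inv g = H"
      using g H.subset by (simp add: normalizer_def stabilizer_def)
    also have "g <# H #> inv g = (\<lambda>k. g \<otimes> k \<otimes> inv g) ` H" by (auto simp: l_coset_def r_coset_def)
    also have "\<dots> = \<Theta> ` ?c ` sU"
      unfolding H_def image_image using g U by (intro image_cong) simp_all
    also have "\<dots> = H \<longleftrightarrow> ?c ` sU = sU"
      unfolding H_def
      by (rule inj_on_image_eq_iff[OF bij_betw_imp_inj_on[OF bij]]) (use U g in \<open>auto simp del: mult_Gam\<close>)
    also have "\<dots> \<longleftrightarrow> \<theta> g \<in> sB" by (rule normalizer_sU) (use g in simp)
    finally show ?thesis .
  qed
  have sub: "normalizer G H \<subseteq> carrier G" by (auto simp: normalizer_def stabilizer_def)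
  have B: "y \<in> carrier Gam" if "y \<in> sB" for y using subgroup.mem_carrier[OF subgroup_sB that] .
  show ?thesis
  proof (intro equalityI subsetI)
    fix g assume g: "g \<in> normalizer G H"
    then show "g \<in> \<Theta> ` sB" using iff[of g] sub image_eqI[of g \<Theta> "\<theta> g" sB] by force
  next
    fix g assume "g \<in> \<Theta> ` sB"
    then obtain y where y: "g = \<Theta> y" "y \<in> sB" by (rule imageE)
    then show "g \<in> normalizer G H" using iff[of g] B[OF y(2)] by simp
  qed
qed

lemma coset_conj_isos:
  "subgroup K G \<Longrightarrow> card K = 6 \<Longrightarrow> glat_iso G (coset_lat G K) (RLat G [\<Theta> ` sS])"
  "subgroup K G \<Longrightarrow> card K = 9 \<Longrightarrow> (\<And>x y. x \<in> K \<Longrightarrow> y \<in> K \<Longrightarrow> x \<otimes> y = y \<otimes> x)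
    \<Longrightarrow> glat_iso G (coset_lat G K) (RLat G [\<Theta> ` sC])"
proof -
  assume K: "subgroup K G"
  note KG = subgroup.subset[OF K]
  show "glat_iso G (coset_lat G K) (RLat G [\<Theta> ` sS])" if "card K = 6"
    by (rule conj_sS[OF preimage_subgroup[OF K]])
       (simp add: card_\<theta> KG that, rule coset_conj_iso[OF K subgroup_sS])
  have comm: "x \<otimes>\<^bsub>Gam\<^esub> y = y \<otimes>\<^bsub>Gam\<^esub> x"
    if c: "\<And>x y. x \<in> K \<Longrightarrow> y \<in> K \<Longrightarrow> x \<otimes> y = y \<otimes> x" and x: "x \<in> \<theta> ` K" and y: "y \<in> \<theta> ` K" for x y
  proof -
    obtain x' y' where xy: "x = \<theta> x'" "y = \<theta> y'" "x' \<in> K" "y' \<in> K" using x y by blast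
    then have "x' \<in> carrier G" "y' \<in> carrier G" using KG by blast+
    then have "x \<otimes>\<^bsub>Gam\<^esub> y = \<theta> (x' \<otimes> y')" "y \<otimes>\<^bsub>Gam\<^esub> x = \<theta> (y' \<otimes> x')" unfolding xy(1,2) by (simp_all only: GT.hom_mult)
    then show ?thesis using c[OF xy(3,4)] by simp
  qed
  show "glat_iso G (coset_lat G K) (RLat G [\<Theta> ` sC])"
    if card: "card K = 9" and c: "\<And>x y. x \<in> K \<Longrightarrow> y \<in> K \<Longrightarrow> x \<otimes> y = y \<otimes> x"
  proof -
    have "card (\<theta> ` K) = 9" using card card_\<theta>[OF KG] by simp
    then obtain d where "d \<in> carrier Gam" "\<theta> ` K = (\<lambda>k. d \<otimes>\<^bsub>Gam\<^esub> k \<otimes>\<^bsub>Gam\<^esub> inv\<^bsub>Gam\<^esub> d) ` sC"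
      using comm[OF c] by (rule conj_sC[OF preimage_subgroup[OF K]])
    then show ?thesis by (rule coset_conj_iso[OF K subgroup_sC])
  qed
qed

lemma main_iso:
  assumes K1: "subgroup K1 G" "card K1 = 6"
    and K2: "subgroup K2 G" "card K2 = 9" "\<And>x y. x \<in> K2 \<Longrightarrow> y \<in> K2 \<Longrightarrow> x \<otimes> y = y \<otimes> x"
  shows "glat_iso G ((coset_lat G K1 \<oplus>\<^sub>L coset_lat G K2) \<oplus>\<^sub>L (coset_lat G (normalizer G H) \<oplus>\<^sub>L coset_lat G (normalizer G H)))
    ((coset_lat G K1 \<oplus>\<^sub>L trivial_lat) \<oplus>\<^sub>L Fl)"
proof -
  let ?S = "\<Theta> ` sS" and ?C = "\<Theta> ` sC" and ?B = "\<Theta> ` sB" and ?G = "carrier G"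
  note [trans] = glat_iso_trans
  have sub: "?S \<subseteq> carrier G" "?C \<subseteq> carrier G" "?B \<subseteq> carrier G"
    using image_subgroup[THEN subgroup.subset] subgroup_sS subgroup_sC subgroup_sB by blast+
  have ok_Fl: "glat_ok G Fl" and ok_R: "glat_ok G (pull \<theta> (RLat Gam KR))"
    using is_glat_ok flabby_resolution_Fl glat_ok_pull[OF homs(1) group.glat_ok_RLat[OF Gam.is_group subsets_all(3)]]
    unfolding flabby_resolution_def by blast+
  have B: "subgroup ?B G" using image_subgroup[OF subgroup_sB] .
  note S1 = coset_conj_isos(1)[OF K1] and C1 = coset_conj_isos(2)[OF K2]
  have KX: "map ((`) \<Theta>) KX = [?C, ?B, ?B, ?S]" and KR: "map ((`) \<Theta>) KR = [?S, ?G]"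
    using bij_betw_imp_surj_on[OF bij] by (simp_all add: KX_def KR_def)
  have "glat_iso G ((coset_lat G K1 \<oplus>\<^sub>L coset_lat G K2) \<oplus>\<^sub>L (coset_lat G ?B \<oplus>\<^sub>L coset_lat G ?B))
      ((RLat G [?S] \<oplus>\<^sub>L RLat G [?C]) \<oplus>\<^sub>L (RLat G [?B] \<oplus>\<^sub>L RLat G [?B]))"
    by (intro glat_iso_dsum S1 C1 coset_RLat B)
  also have "glat_iso G \<dots> ((RLat G [?S] \<oplus>\<^sub>L RLat G [?C]) \<oplus>\<^sub>L RLat G [?B, ?B])"
    using append_RLat[of "[?B]" "[?B]"] sub by (intro glat_iso_dsum glat_iso_refl) simp
  also have "glat_iso G \<dots> (RLat G [?S] \<oplus>\<^sub>L RLat G [?C] \<oplus>\<^sub>L RLat G [?B, ?B])"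
    by (rule glat_iso_dsum_assoc)
  also have "glat_iso G \<dots> (RLat G [?S] \<oplus>\<^sub>L RLat G [?C, ?B, ?B])"
    using append_RLat[of "[?C]" "[?B, ?B]"] sub by (intro glat_iso_dsum glat_iso_refl) simp
  also have "glat_iso G \<dots> (RLat G [?C, ?B, ?B] \<oplus>\<^sub>L RLat G [?S])"
    by (rule glat_iso_dsum_comm)
  also have "glat_iso G \<dots> (RLat G [?C, ?B, ?B, ?S])"
    using append_RLat[of "[?C, ?B, ?B]" "[?S]"] sub by simp
  also have "glat_iso G \<dots> (pull \<theta> (RLat Gam KX))"
    using pull_RLat_iso(2)[OF subgroups_all(2)] by (simp only: KX)
  \<comment> \<open>Here the splitting of X enters; all other links replace subgroups by conjugates
    or rearrange summands.\<close>
  also have "glat_iso G \<dots> (Fl \<oplus>\<^sub>L pull \<theta> (RLat Gam KR))"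
    by (rule glat_iso_sym[OF Fl_iso glat_ok_dsum[OF ok_Fl ok_R]])
  also have "glat_iso G \<dots> (pull \<theta> (RLat Gam KR) \<oplus>\<^sub>L Fl)"
    by (rule glat_iso_dsum_comm)
  also have "glat_iso G \<dots> (RLat G [?S, ?G] \<oplus>\<^sub>L Fl)"
    using pull_RLat_iso(1)[OF subgroups_all(3)] by (intro glat_iso_dsum glat_iso_refl) (simp only: KR)
  also have "glat_iso G \<dots> ((RLat G [?S] \<oplus>\<^sub>L RLat G [?G]) \<oplus>\<^sub>L Fl)"
    using glat_iso_sym[OF append_RLat[of "[?S]" "[?G]"] glat_ok_dsum[OF glat_ok_RLat glat_ok_RLat]] sub
    by (intro glat_iso_dsum glat_iso_refl) simp
  also have "glat_iso G \<dots> ((coset_lat G K1 \<oplus>\<^sub>L trivial_lat) \<oplus>\<^sub>L Fl)"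
    by (intro glat_iso_dsum glat_iso_refl trivial_RLat glat_iso_sym[OF S1 glat_ok_coset])
  finally show ?thesis unfolding normalizer_eq .
qed

end

section \<open>The theorem for an arbitrary field and Sylow subgroup\<close>

context group
begin

lemma iso_conj:
  assumes "\<Theta> \<in> iso G' G" "group G'" "d \<in> carrier G'"
  shows "(\<lambda>x. \<Theta> (d \<otimes>\<^bsub>G'\<^esub> x \<otimes>\<^bsub>G'\<^esub> inv\<^bsub>G'\<^esub> d)) \<in> iso G' G"
proof -
  interpret G': group G' by fact
  have "(\<lambda>x. d \<otimes>\<^bsub>G'\<^esub> x \<otimes>\<^bsub>G'\<^esub> inv\<^bsub>G'\<^esub> d) \<in> iso G' G'"
  proof (rule isoI)
    show "(\<lambda>x. d \<otimes>\<^bsub>G'\<^esub> x \<otimes>\<^bsub>G'\<^esub> inv\<^bsub>G'\<^esub> d) \<in> hom G' G'"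
      using assms(3) by (intro homI) (simp_all add: G'.m_assoc)
    show "bij_betw (\<lambda>x. d \<otimes>\<^bsub>G'\<^esub> x \<otimes>\<^bsub>G'\<^esub> inv\<^bsub>G'\<^esub> d) (carrier G') (carrier G')"
      using assms(3)
      by (intro bij_betw_byWitness[of _ "\<lambda>y. inv\<^bsub>G'\<^esub> d \<otimes>\<^bsub>G'\<^esub> y \<otimes>\<^bsub>G'\<^esub> d"]) (auto simp: G'.m_assoc)
  qed
  from iso_set_trans[OF this assms(1)] show ?thesis by (simp add: compose_def comp_def)
qed

end

lemma card_iso: "A \<cong> B \<Longrightarrow> card (carrier A) = card (carrier B)"
  by (auto simp: is_iso_def iso_def dest: bij_betw_same_card)

theorem theorem1p3:
  fixes H :: "('k::{field,finite} mat2) set set"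
  assumes "card (UNIV :: 'k set) = 8"
    and "sylow_subgroup PSL2 2 H"
  shows "\<exists>(P :: ('k mat2 set, nat \<Rightarrow> int) glat) (F :: ('k mat2 set, nat \<Rightarrow> int) glat) i p.
           flabby_resolution PSL2 (chevalley PSL2 H) P F i p
         \<and> glat_rank F = 73
         \<and> (\<forall>K1 K2. subgroup K1 PSL2 \<and> PSL2\<lparr>carrier := K1\<rparr> \<cong> sym_group 3
                 \<and> subgroup K2 PSL2 \<and> PSL2\<lparr>carrier := K2\<rparr> \<cong> integer_mod_group 9 \<longrightarrow>
              glat_iso PSL2
                ((coset_lat PSL2 K1 \<oplus>\<^sub>L coset_lat PSL2 K2)
                   \<oplus>\<^sub>L (coset_lat PSL2 (normalizer PSL2 H) \<oplus>\<^sub>L coset_lat PSL2 (normalizer PSL2 H)))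
                ((coset_lat PSL2 K1 \<oplus>\<^sub>L trivial_lat) \<oplus>\<^sub>L F))
         \<and> stably_permutation PSL2 F"
proof -
  let ?G = "PSL2 :: 'k mat2 set monoid"
  obtain \<Theta>\<^sub>0 where \<Theta>\<^sub>0: "\<Theta>\<^sub>0 \<in> iso Gam ?G" "group ?G" using PSL2_iso_exists[OF assms(1)] by blast
  interpret G: group ?G by fact
  interpret I0: gam_iso ?G \<Theta>\<^sub>0 by unfold_locales (rule \<Theta>\<^sub>0)
  have H: "subgroup H ?G" and card: "card H = 2 ^ multiplicity 2 (order ?G)"
    using assms(2) by (simp_all add: sylow_subgroup_def)
  have "order ?G = 2 ^ 3 * 63"
    using bij_betw_same_card[OF I0.bij] card_Gam by (simp add: order_def)
  moreover have "multiplicity 2 (2 ^ 3 * 63 :: nat) = 3" by (rule multiplicity_eqI) simp_all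
  ultimately have "card (I0.\<theta> ` H) = 8" using card I0.card_\<theta>[OF subgroup.subset[OF H]] by simp
  then obtain d where d: "d \<in> carrier Gam"
      "I0.\<theta> ` H = (\<lambda>k. d \<otimes>\<^bsub>Gam\<^esub> k \<otimes>\<^bsub>Gam\<^esub> inv\<^bsub>Gam\<^esub> d) ` sU"
    by (rule conj_sU[OF I0.preimage_subgroup[OF H]])
  \<comment> \<open>Precomposing with conjugation by \<open>d\<close> turns the conjugate of U that
    corresponds to \<open>H\<close> into U itself.\<close>
  define \<Theta> where "\<Theta> = (\<lambda>x. \<Theta>\<^sub>0 (d \<otimes>\<^bsub>Gam\<^esub> x \<otimes>\<^bsub>Gam\<^esub> inv\<^bsub>Gam\<^esub> d))"
  interpret I: sylow_iso ?G \<Theta> H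
  proof unfold_locales
    show "\<Theta> \<in> iso Gam ?G" unfolding \<Theta>_def by (rule G.iso_conj[OF \<Theta>\<^sub>0(1) Gam.is_group d(1)])
    have "H = \<Theta>\<^sub>0 ` I0.\<theta> ` H" using I0.\<Theta>_\<theta>_image[OF subgroup.subset[OF H]] by simp
    also have "\<dots> = \<Theta> ` sU" unfolding d(2) \<Theta>_def image_image ..
    finally show "H = \<Theta> ` sU" .
  qed
  have "glat_iso ?G ((coset_lat ?G K1 \<oplus>\<^sub>L coset_lat ?G K2)
        \<oplus>\<^sub>L (coset_lat ?G (normalizer ?G H) \<oplus>\<^sub>L coset_lat ?G (normalizer ?G H)))
      ((coset_lat ?G K1 \<oplus>\<^sub>L trivial_lat) \<oplus>\<^sub>L I.Fl)"
    if K1: "subgroup K1 ?G" "?G\<lparr>carrier := K1\<rparr> \<cong> sym_group 3"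
      and K2: "subgroup K2 ?G" "?G\<lparr>carrier := K2\<rparr> \<cong> integer_mod_group 9" for K1 K2
  proof (rule I.main_iso[OF K1(1) _ K2(1)])
    show "card K1 = 6" using card_iso[OF K1(2)] by (simp add: sym_group_card_carrier fact_numeral)
    show "card K2 = 9" using card_iso[OF K2(2)] by (simp add: carrier_integer_mod_group)
    have gK: "group (?G\<lparr>carrier := K2\<rparr>)" by (rule G.subgroup_imp_group[OF K2(1)])
    have "integer_mod_group 9 \<cong> ?G\<lparr>carrier := K2\<rparr>" by (rule group.iso_sym[OF gK K2(2)])
    then interpret K: comm_group "?G\<lparr>carrier := K2\<rparr>"
      using comm_group.iso_imp_comm_group[OF abelian_integer_mod_group] gK group.is_monoid by blast
    show "x \<otimes>\<^bsub>?G\<^esub> y = y \<otimes>\<^bsub>?G\<^esub> x" if "x \<in> K2" "y \<in> K2" for x y using K.m_comm that by simp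
  qed
  then show ?thesis using I.flabby_resolution_Fl I.rank_Fl I.stably_permutation_Fl by blast
qed

end
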